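(* Let $k$ be a commutative ring, $H$ a Hopf algebra over $k$ (unit $\eta$, counit $\varepsilon$, antipode $S$), $\alpha,\beta: H\to k$ two characters and $\pi\in H$ a grouplike element such that condition (CM), recalled in the context, is satisfied. Put $S_\pi=\pi S$, i.e. $S_\pi(a)=\pi\, S(a)$. Then the following data define a cyclic module $C_*^{(\pi,\alpha,\beta)}(H)$: $C_n^{(\pi,\alpha,\beta)}(H)=H^{\otimes n}$ for $n\ge 0$; for $n\geq 1$ the faces $d_i: H^{\otimes n+1}\to H^{\otimes n}$, $0\le i\le n+1$, are $$d_i(a_0\otimes\cdots\otimes a_n)=\begin{cases}\alpha(a_0)\,a_1\otimes\cdots\otimes a_n & i=0,\\ a_0\otimes\cdots\otimes a_{i-1}a_i\otimes\cdots\otimes a_n & 1\le i\le n,\\ a_0\otimes\cdots\otimes a_{n-1}\,\beta(a_n) & i=n+1;\end{cases}$$ for $n\ge1$ the degeneracies $s_i: H^{\otimes n}\to H^{\otimes n+1}$, $0\le i\le n$, are $$s_i(a_1\otimes\cdots\otimes a_n)=\begin{cases} a_1\otimes\cdots\otimes a_i\otimes 1\otimes a_{i+1}\otimes\cdots\otimes a_n & 0\le i\le n-1,\\ a_1\otimes\cdots\otimes a_n\otimes 1 & i=n;\end{cases}$$ for $n\ge1$ the cyclic operators $t_n: H^{\otimes n}\to H^{\otimes n}$ are $$t_n(a_1\otimes\cdots\otimes a_n)=\alpha(a_1^{(1)}\cdots a_n^{(1)})\, S_\pi(a_1^{(2)}\cdots a_n^{(2)})\otimes a_1^{(3)}\otimes\cdots\otimes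 a_{n-1}^{(3)}\,\beta(a_n^{(3)});$$ and in the lowest degree $d_0=\alpha,\ d_1=\beta: H\to k$, $s_0=\eta: k\to H$, $t_0=\mathrm{id}_k$.
   Context: Sweedler notation: $a^{(1)}\otimes a^{(2)}\otimes\cdots$ denotes the iterated comultiplication of $a$ (summation understood). A character is a unital $k$-algebra map $H\to k$. Condition (CM): (i) $\alpha(\pi)=1=\beta(\pi)$; (ii) $(\alpha*S_\pi*\beta)^2=\mathrm{id}_H$, where $*$ is the convolution product (defined for linear maps from $H$ to $H$ or $k$) and the square is composition. Equivalently to (ii), for all $a\in H$, $$\alpha(a^{(1)})\,\alpha(S(a^{(4)}))\,\pi S^2(a^{(3)})\pi^{-1}\,\beta(S(a^{(2)}))\,\beta(a^{(5)})=a.$$ A cyclic module is a simplicial $k$-module $(C_n,d_i,s_i)$ with operators $t_n:C_n\to C_n$ such that $t_n^{n+1}=\mathrm{id}$, $d_it_n=t_{n-1}d_{i-1}$ and $s_it_n=t_{n+1}s_{i-1}$ for $1\le i\le n$, $d_0t_n=d_n$, $s_0t_n=t_{n+1}^2s_n$ (no signs are included in $t_n$). *)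

theory Defs
  imports "HOL-Algebra.Module"
begin

section \<open>Linear maps and algebras over a commutative ring\<close>

definition linear_maps ::
  "('k, 'r) ring_scheme \<Rightarrow> ('k, 'a, 'm) module_scheme \<Rightarrow> ('k, 'b, 'n) module_scheme \<Rightarrow> ('a \<Rightarrow> 'b) set"
  where
  "linear_maps R M N = {f. f \<in> carrier M \<rightarrow> carrier N \<and>
     (\<forall>x\<in>carrier M. \<forall>y\<in>carrier M. f (x \<oplus>\<^bsub>M\<^esub> y) = f x \<oplus>\<^bsub>N\<^esub> f y) \<and>
     (\<forall>c\<in>carrier R. \<forall>x\<in>carrier M. f (c \<odot>\<^bsub>M\<^esub> x) = c \<odot>\<^bsub>N\<^esub> f x)}"

text \<open>The locale \<open>algebra\<close> of the library requires a commutative multiplication.\<close>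

locale assoc_algebra = module R A + ring A
  for R :: "('k, 'r) ring_scheme" (structure) and A :: "('k, 'a, 'm) module_scheme" (structure) +
  assumes smult_mult_left:
      "\<lbrakk>c \<in> carrier R; x \<in> carrier A; y \<in> carrier A\<rbrakk> \<Longrightarrow>
        (c \<odot>\<^bsub>A\<^esub> x) \<otimes>\<^bsub>A\<^esub> y = c \<odot>\<^bsub>A\<^esub> (x \<otimes>\<^bsub>A\<^esub> y)"
    and smult_mult_right:
      "\<lbrakk>c \<in> carrier R; x \<in> carrier A; y \<in> carrier A\<rbrakk> \<Longrightarrow>
        x \<otimes>\<^bsub>A\<^esub> (c \<odot>\<^bsub>A\<^esub> y) = c \<odot>\<^bsub>A\<^esub> (x \<otimes>\<^bsub>A\<^esub> y)"

definition algebra_homs ::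
  "('k, 'r) ring_scheme \<Rightarrow> ('k, 'a, 'm) module_scheme \<Rightarrow> ('k, 'b, 'n) module_scheme \<Rightarrow> ('a \<Rightarrow> 'b) set"
  where
  "algebra_homs R A B = ring_hom A B \<inter> linear_maps R A B"

definition base_algebra :: "('k, 'r) ring_scheme \<Rightarrow> ('k, 'k) module" where
  "base_algebra R = \<lparr>carrier = carrier R, mult = mult R, one = one R,
     zero = zero R, add = add R, smult = mult R\<rparr>"

definition characters ::
  "('k, 'r) ring_scheme \<Rightarrow> ('k, 'a, 'm) module_scheme \<Rightarrow> ('a \<Rightarrow> 'k) set" where
  "characters R A = algebra_homs R A (base_algebra R)"


section \<open>Tensor powers\<close>

text \<open>
  The tensor power \<open>M\<^sup>\<otimes>\<^sup>n\<close> is the module of formal sums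
  \<open>c\<^sub>1 (a\<^sub>1\<^sub>1, \<dots>, a\<^sub>1\<^sub>n) + \<dots> + c\<^sub>r (a\<^sub>r\<^sub>1, \<dots>, a\<^sub>r\<^sub>n)\<close>,
  written as lists of pairs \<open>(c, [a\<^sub>1, \<dots>, a\<^sub>n])\<close>, modulo the least congruence that makes them a
  module and the tuple multilinear.  For \<open>n = 0\<close> there is only the empty tuple and no
  multilinearity relation, so the result is a copy of the base ring.
\<close>

type_synonym ('k, 'a) tensor = "('k \<times> 'a list) list set"

definition tuples :: "('k, 'a, 'm) module_scheme \<Rightarrow> nat \<Rightarrow> 'a list set" where
  "tuples M n = {w. length w = n \<and> set w \<subseteq> carrier M}"

definition formal_sums ::
  "('k, 'r) ring_scheme \<Rightarrow> ('k, 'a, 'm) module_scheme \<Rightarrow> nat \<Rightarrow> ('k \<times> 'a list) list set" where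
  "formal_sums R M n = lists (carrier R \<times> tuples M n)"

inductive tensor_eq ::
  "('k, 'r) ring_scheme \<Rightarrow> ('k, 'a, 'm) module_scheme \<Rightarrow> nat \<Rightarrow>
   ('k \<times> 'a list) list \<Rightarrow> ('k \<times> 'a list) list \<Rightarrow> bool"
  for R :: "('k, 'r) ring_scheme" and M :: "('k, 'a, 'm) module_scheme" and n :: nat
  where
    refl: "u \<in> formal_sums R M n \<Longrightarrow> tensor_eq R M n u u"
  | sym: "tensor_eq R M n u v \<Longrightarrow> tensor_eq R M n v u"
  | trans: "tensor_eq R M n u v \<Longrightarrow> tensor_eq R M n v x \<Longrightarrow> tensor_eq R M n u x"
  | append: "tensor_eq R M n u u' \<Longrightarrow> tensor_eq R M n v v' \<Longrightarrow> tensor_eq R M n (u @ v) (u' @ v')"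
  | commute: "u \<in> formal_sums R M n \<Longrightarrow> v \<in> formal_sums R M n \<Longrightarrow>
      tensor_eq R M n (u @ v) (v @ u)"
  | coeff_zero: "w \<in> tuples M n \<Longrightarrow> tensor_eq R M n [(\<zero>\<^bsub>R\<^esub>, w)] []"
  | coeff_add: "c \<in> carrier R \<Longrightarrow> d \<in> carrier R \<Longrightarrow> w \<in> tuples M n \<Longrightarrow>
      tensor_eq R M n [(c \<oplus>\<^bsub>R\<^esub> d, w)] [(c, w), (d, w)]"
  | slot_add: "c \<in> carrier R \<Longrightarrow> w \<in> tuples M n \<Longrightarrow> i < n \<Longrightarrow>
      a \<in> carrier M \<Longrightarrow> b \<in> carrier M \<Longrightarrow>
      tensor_eq R M n [(c, w[i := a \<oplus>\<^bsub>M\<^esub> b])] [(c, w[i := a]), (c, w[i := b])]"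
  | slot_smult: "c \<in> carrier R \<Longrightarrow> w \<in> tuples M n \<Longrightarrow> i < n \<Longrightarrow>
      r \<in> carrier R \<Longrightarrow> a \<in> carrier M \<Longrightarrow>
      tensor_eq R M n [(c, w[i := r \<odot>\<^bsub>M\<^esub> a])] [(c \<otimes>\<^bsub>R\<^esub> r, w[i := a])]"

definition tensor_class ::
  "('k, 'r) ring_scheme \<Rightarrow> ('k, 'a, 'm) module_scheme \<Rightarrow> nat \<Rightarrow> ('k \<times> 'a list) list \<Rightarrow> ('k, 'a) tensor"
  where
  "tensor_class R M n u = {v. tensor_eq R M n u v}"

definition pure ::
  "('k, 'r) ring_scheme \<Rightarrow> ('k, 'a, 'm) module_scheme \<Rightarrow> 'a list \<Rightarrow> ('k, 'a) tensor" where
  "pure R M w = tensor_class R M (length w) [(\<one>\<^bsub>R\<^esub>, w)]"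

text \<open>
  \<open>A\<^sup>\<otimes>\<^sup>n\<close> with its componentwise algebra structure.  Every operation takes the union of the
  classes obtained from all choices of representatives (these classes coincide).
\<close>

definition tensor_power ::
  "('k, 'r) ring_scheme \<Rightarrow> ('k, 'a, 'm) module_scheme \<Rightarrow> nat \<Rightarrow> ('k, ('k, 'a) tensor) module" where
  "tensor_power R A n =
     \<lparr>carrier = tensor_class R A n ` formal_sums R A n,
      mult = (\<lambda>X Y. \<Union>u\<in>X. \<Union>v\<in>Y. tensor_class R A n
                [(c \<otimes>\<^bsub>R\<^esub> d, map2 (mult A) w z). (c, w) \<leftarrow> u, (d, z) \<leftarrow> v]),
      one = pure R A (replicate n \<one>\<^bsub>A\<^esub>),
      zero = tensor_class R A n [],
      add = (\<lambda>X Y. \<Union>u\<in>X. \<Union>v\<in>Y. tensor_class R A n (u @ v)),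
      smult = (\<lambda>c X. \<Union>u\<in>X. tensor_class R A n [(c \<otimes>\<^bsub>R\<^esub> d, w). (d, w) \<leftarrow> u])\<rparr>"

text \<open>Concatenation \<open>M\<^sup>\<otimes>\<^sup>m \<times> M\<^sup>\<otimes>\<^sup>n \<rightarrow> M\<^sup>\<otimes>\<^sup>m\<^sup>+\<^sup>n\<close>.\<close>

definition tensor_concat ::
  "('k, 'r) ring_scheme \<Rightarrow> ('k, 'a, 'm) module_scheme \<Rightarrow> nat \<Rightarrow> nat \<Rightarrow>
   ('k, 'a) tensor \<Rightarrow> ('k, 'a) tensor \<Rightarrow> ('k, 'a) tensor" where
  "tensor_concat R M m n X Y =
     (\<Union>u\<in>X. \<Union>v\<in>Y. tensor_class R M (m + n)
        [(c \<otimes>\<^bsub>R\<^esub> d, w @ z). (c, w) \<leftarrow> u, (d, z) \<leftarrow> v])"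

text \<open>
  The linear map \<open>M\<^sup>\<otimes>\<^sup>n \<rightarrow> N\<close> induced by a multilinear map \<open>f\<close> on \<open>n\<close>-tuples.
  With Sweedler notation, \<open>tensor_lift N f (\<Delta> a)\<close> is \<open>f [a\<^sup>(\<^sup>1\<^sup>), a\<^sup>(\<^sup>2\<^sup>)]\<close>
  (summation understood).
\<close>

definition eval_sum :: "('k, 'b, 'n) module_scheme \<Rightarrow> ('a list \<Rightarrow> 'b) \<Rightarrow> ('k \<times> 'a list) list \<Rightarrow> 'b" where
  "eval_sum N f u = foldr (\<lambda>(c, w) y. c \<odot>\<^bsub>N\<^esub> f w \<oplus>\<^bsub>N\<^esub> y) u \<zero>\<^bsub>N\<^esub>"

definition tensor_lift :: "('k, 'b, 'n) module_scheme \<Rightarrow> ('a list \<Rightarrow> 'b) \<Rightarrow> ('k, 'a) tensor \<Rightarrow> 'b" where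
  "tensor_lift N f X = the_elem (eval_sum N f ` X)"


section \<open>Hopf algebras\<close>

record ('k, 'h) hopf = "('k, 'h) module" +
  comult :: "'h \<Rightarrow> ('k, 'h) tensor"
  counit :: "'h \<Rightarrow> 'k"
  antipode :: "'h \<Rightarrow> 'h"

text \<open>Convolution of \<open>f\<close> and \<open>g\<close>, their values being combined in \<open>N\<close> by the bilinear map \<open>m\<close>.\<close>

definition convolution ::
  "('k, 'h, 'z) hopf_scheme \<Rightarrow> ('k, 'b, 'n) module_scheme \<Rightarrow> ('c \<Rightarrow> 'd \<Rightarrow> 'b) \<Rightarrow>
   ('h \<Rightarrow> 'c) \<Rightarrow> ('h \<Rightarrow> 'd) \<Rightarrow> 'h \<Rightarrow> 'b" where
  "convolution H N m f g a = tensor_lift N (\<lambda>w. m (f (w ! 0)) (g (w ! 1))) (comult H a)"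

locale hopf_algebra = assoc_algebra R H
  for R :: "('k, 'r) ring_scheme" (structure) and H :: "('k, 'h, 'z) hopf_scheme" (structure) +
  assumes comult_hom: "comult H \<in> algebra_homs R H (tensor_power R H 2)"
    and counit_hom: "counit H \<in> characters R H"
    and antipode_linear: "antipode H \<in> linear_maps R H H"
    and coassociative: "a \<in> carrier H \<Longrightarrow>
      tensor_lift (tensor_power R H 3)
        (\<lambda>w. tensor_concat R H 2 1 (comult H (w ! 0)) (pure R H [w ! 1])) (comult H a) =
      tensor_lift (tensor_power R H 3)
        (\<lambda>w. tensor_concat R H 1 2 (pure R H [w ! 0]) (comult H (w ! 1))) (comult H a)"
    and counit_left: "a \<in> carrier H \<Longrightarrow>
      tensor_lift H (\<lambda>w. counit H (w ! 0) \<odot>\<^bsub>H\<^esub> w ! 1) (comult H a) = a"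
    and counit_right: "a \<in> carrier H \<Longrightarrow>
      tensor_lift H (\<lambda>w. counit H (w ! 1) \<odot>\<^bsub>H\<^esub> w ! 0) (comult H a) = a"
    and antipode_left: "a \<in> carrier H \<Longrightarrow>
      convolution H H (mult H) (antipode H) (\<lambda>x. x) a = counit H a \<odot>\<^bsub>H\<^esub> \<one>\<^bsub>H\<^esub>"
    and antipode_right: "a \<in> carrier H \<Longrightarrow>
      convolution H H (mult H) (\<lambda>x. x) (antipode H) a = counit H a \<odot>\<^bsub>H\<^esub> \<one>\<^bsub>H\<^esub>"

definition grouplike :: "('k, 'r) ring_scheme \<Rightarrow> ('k, 'h, 'z) hopf_scheme \<Rightarrow> 'h \<Rightarrow> bool" where
  "grouplike R H p \<longleftrightarrow> p \<in> carrier H \<and> comult H p = pure R H [p, p] \<and> counit H p = \<one>\<^bsub>R\<^esub>"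

definition twisted_antipode :: "('k, 'h, 'z) hopf_scheme \<Rightarrow> 'h \<Rightarrow> 'h \<Rightarrow> 'h" where
  "twisted_antipode H p a = p \<otimes>\<^bsub>H\<^esub> antipode H a"

text \<open>The map \<open>\<alpha> * S\<^sub>\<pi> * \<beta>\<close> on \<open>H\<close>.\<close>

definition twisted_conv ::
  "('k, 'h, 'z) hopf_scheme \<Rightarrow> 'h \<Rightarrow> ('h \<Rightarrow> 'k) \<Rightarrow> ('h \<Rightarrow> 'k) \<Rightarrow> 'h \<Rightarrow> 'h" where
  "twisted_conv H p \<alpha> \<beta> =
     convolution H H (\<lambda>x c. c \<odot>\<^bsub>H\<^esub> x)
       (convolution H H (smult H) \<alpha> (twisted_antipode H p)) \<beta>"

definition condition_CM ::
  "('k, 'r) ring_scheme \<Rightarrow> ('k, 'h, 'z) hopf_scheme \<Rightarrow> 'h \<Rightarrow> ('h \<Rightarrow> 'k) \<Rightarrow> ('h \<Rightarrow> 'k) \<Rightarrow> bool" where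
  "condition_CM R H p \<alpha> \<beta> \<longleftrightarrow> \<alpha> p = \<one>\<^bsub>R\<^esub> \<and> \<beta> p = \<one>\<^bsub>R\<^esub> \<and>
     (\<forall>a\<in>carrier H. twisted_conv H p \<alpha> \<beta> (twisted_conv H p \<alpha> \<beta> a) = a)"

text \<open>\<open>a\<^sup>(\<^sup>1\<^sup>) \<otimes> a\<^sup>(\<^sup>2\<^sup>) \<otimes> a\<^sup>(\<^sup>3\<^sup>)\<close>\<close>

definition comult3 ::
  "('k, 'r) ring_scheme \<Rightarrow> ('k, 'h, 'z) hopf_scheme \<Rightarrow> 'h \<Rightarrow> ('k, 'h) tensor" where
  "comult3 R H a = tensor_lift (tensor_power R H 3)
     (\<lambda>w. tensor_concat R H 2 1 (comult H (w ! 0)) (pure R H [w ! 1])) (comult H a)"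

text \<open>
  \<open>a\<^sub>1\<^sup>(\<^sup>1\<^sup>) \<otimes> a\<^sub>1\<^sup>(\<^sup>2\<^sup>) \<otimes> a\<^sub>1\<^sup>(\<^sup>3\<^sup>) \<otimes> \<dots> \<otimes> a\<^sub>n\<^sup>(\<^sup>1\<^sup>) \<otimes> a\<^sub>n\<^sup>(\<^sup>2\<^sup>) \<otimes> a\<^sub>n\<^sup>(\<^sup>3\<^sup>)\<close>
  in \<open>H\<^sup>\<otimes>\<^sup>3\<^sup>n\<close>; the factor \<open>a\<^sub>i\<^sub>+\<^sub>1\<^sup>(\<^sup>j\<^sup>+\<^sup>1\<^sup>)\<close> sits at position \<open>3 * i + j\<close>.
\<close>

primrec comult3_list ::
  "('k, 'r) ring_scheme \<Rightarrow> ('k, 'h, 'z) hopf_scheme \<Rightarrow> 'h list \<Rightarrow> ('k, 'h) tensor" where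
  "comult3_list R H [] = pure R H []"
| "comult3_list R H (a # as) =
     tensor_concat R H 3 (3 * length as) (comult3 R H a) (comult3_list R H as)"

definition list_prod :: "('a, 'm) monoid_scheme \<Rightarrow> 'a list \<Rightarrow> 'a" where
  "list_prod A as = foldr (mult A) as \<one>\<^bsub>A\<^esub>"


section \<open>Cyclic modules\<close>

text \<open>
  \<open>d n i\<close> is \<open>d\<^sub>i : C\<^sub>n \<rightarrow> C\<^sub>n\<^sub>-\<^sub>1\<close>, \<open>s n i\<close> is \<open>s\<^sub>i : C\<^sub>n \<rightarrow> C\<^sub>n\<^sub>+\<^sub>1\<close>,
  and \<open>t n\<close> is \<open>t\<^sub>n : C\<^sub>n \<rightarrow> C\<^sub>n\<close>.
\<close>

locale simplicial_module =
  fixes R :: "('k, 'r) ring_scheme"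
    and C :: "nat \<Rightarrow> ('k, 'a, 'm) module_scheme"
    and d :: "nat \<Rightarrow> nat \<Rightarrow> 'a \<Rightarrow> 'a"
    and s :: "nat \<Rightarrow> nat \<Rightarrow> 'a \<Rightarrow> 'a"
  assumes module_C: "module R (C n)"
    and face_linear: "i \<le> Suc n \<Longrightarrow> d (Suc n) i \<in> linear_maps R (C (Suc n)) (C n)"
    and degeneracy_linear: "i \<le> n \<Longrightarrow> s n i \<in> linear_maps R (C n) (C (Suc n))"
    and face_face: "\<lbrakk>i < j; j \<le> Suc (Suc n); x \<in> carrier (C (Suc (Suc n)))\<rbrakk> \<Longrightarrow>
      d (Suc n) i (d (Suc (Suc n)) j x) = d (Suc n) (j - 1) (d (Suc (Suc n)) i x)"
    and degeneracy_degeneracy: "\<lbrakk>i \<le> j; j \<le> n; x \<in> carrier (C n)\<rbrakk> \<Longrightarrow>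
      s (Suc n) i (s n j x) = s (Suc n) (Suc j) (s n i x)"
    and face_degeneracy_less: "\<lbrakk>i < j; j \<le> n; x \<in> carrier (C n)\<rbrakk> \<Longrightarrow>
      d (Suc n) i (s n j x) = s (n - 1) (j - 1) (d n i x)"
    and face_degeneracy_eq: "\<lbrakk>i = j \<or> i = Suc j; j \<le> n; x \<in> carrier (C n)\<rbrakk> \<Longrightarrow>
      d (Suc n) i (s n j x) = x"
    and face_degeneracy_greater: "\<lbrakk>Suc j < i; i \<le> Suc n; x \<in> carrier (C n)\<rbrakk> \<Longrightarrow>
      d (Suc n) i (s n j x) = s (n - 1) j (d n (i - 1) x)"

locale cyclic_module = simplicial_module R C d s
  for R :: "('k, 'r) ring_scheme"
    and C :: "nat \<Rightarrow> ('k, 'a, 'm) module_scheme"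
    and d :: "nat \<Rightarrow> nat \<Rightarrow> 'a \<Rightarrow> 'a"
    and s :: "nat \<Rightarrow> nat \<Rightarrow> 'a \<Rightarrow> 'a" +
  fixes t :: "nat \<Rightarrow> 'a \<Rightarrow> 'a"
  assumes cyclic_linear: "t n \<in> linear_maps R (C n) (C n)"
    and cyclic_power: "x \<in> carrier (C n) \<Longrightarrow> (t n ^^ Suc n) x = x"
    and face_cyclic: "\<lbrakk>1 \<le> i; i \<le> n; x \<in> carrier (C n)\<rbrakk> \<Longrightarrow>
      d n i (t n x) = t (n - 1) (d n (i - 1) x)"
    and face_0_cyclic: "\<lbrakk>1 \<le> n; x \<in> carrier (C n)\<rbrakk> \<Longrightarrow> d n 0 (t n x) = d n n x"
    and degeneracy_cyclic: "\<lbrakk>1 \<le> i; i \<le> n; x \<in> carrier (C n)\<rbrakk> \<Longrightarrow>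
      s n i (t n x) = t (Suc n) (s n (i - 1) x)"
    and degeneracy_0_cyclic: "x \<in> carrier (C n) \<Longrightarrow>
      s n 0 (t n x) = t (Suc n) (t (Suc n) (s n n x))"


section \<open>The operators on the tensor powers of a Hopf algebra\<close>

text \<open>The element of \<open>H\<^sup>\<otimes>\<^sup>0\<close> that corresponds to \<open>c \<in> k\<close>.\<close>

definition scalar_tensor ::
  "('k, 'r) ring_scheme \<Rightarrow> ('k, 'a, 'm) module_scheme \<Rightarrow> 'k \<Rightarrow> ('k, 'a) tensor" where
  "scalar_tensor R M c = c \<odot>\<^bsub>tensor_power R M 0\<^esub> pure R M []"

text \<open>
  Each operator is a linear map given by its values on pure tensors.  The tuple \<open>as\<close> is indexed
  from \<open>0\<close>, as in the usual formula for the faces; a face defined on \<open>H\<^sup>\<otimes>\<^sup>n\<^sup>+\<^sup>1\<close> is \<open>d (Suc n) i\<close>.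
\<close>

definition face_operators ::
  "('k, 'r) ring_scheme \<Rightarrow> ('k, 'h, 'z) hopf_scheme \<Rightarrow> ('h \<Rightarrow> 'k) \<Rightarrow> ('h \<Rightarrow> 'k) \<Rightarrow>
   (nat \<Rightarrow> nat \<Rightarrow> ('k, 'h) tensor \<Rightarrow> ('k, 'h) tensor) \<Rightarrow> bool" where
  "face_operators R H \<alpha> \<beta> d \<longleftrightarrow>
     (\<forall>n. \<forall>i\<le>Suc n. d (Suc n) i \<in> linear_maps R (tensor_power R H (Suc n)) (tensor_power R H n)) \<and>
     (\<forall>a\<in>carrier H. d 1 0 (pure R H [a]) = scalar_tensor R H (\<alpha> a) \<and>
                    d 1 1 (pure R H [a]) = scalar_tensor R H (\<beta> a)) \<and>
     (\<forall>n\<ge>1. \<forall>as\<in>tuples H (Suc n).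
        d (Suc n) 0 (pure R H as) = \<alpha> (as ! 0) \<odot>\<^bsub>tensor_power R H n\<^esub> pure R H (tl as) \<and>
        (\<forall>i\<in>{1..n}. d (Suc n) i (pure R H as) =
           pure R H (take (i - 1) as @ [as ! (i - 1) \<otimes>\<^bsub>H\<^esub> as ! i] @ drop (Suc i) as)) \<and>
        d (Suc n) (Suc n) (pure R H as) =
          \<beta> (as ! n) \<odot>\<^bsub>tensor_power R H n\<^esub> pure R H (take n as))"

definition degeneracy_operators ::
  "('k, 'r) ring_scheme \<Rightarrow> ('k, 'h, 'z) hopf_scheme \<Rightarrow>
   (nat \<Rightarrow> nat \<Rightarrow> ('k, 'h) tensor \<Rightarrow> ('k, 'h) tensor) \<Rightarrow> bool" where
  "degeneracy_operators R H s \<longleftrightarrow>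
     (\<forall>n. \<forall>i\<le>n. s n i \<in> linear_maps R (tensor_power R H n) (tensor_power R H (Suc n))) \<and>
     (\<forall>c\<in>carrier R. s 0 0 (scalar_tensor R H c) = pure R H [c \<odot>\<^bsub>H\<^esub> \<one>\<^bsub>H\<^esub>]) \<and>
     (\<forall>n\<ge>1. \<forall>as\<in>tuples H n. \<forall>i\<le>n.
        s n i (pure R H as) = pure R H (take i as @ [\<one>\<^bsub>H\<^esub>] @ drop i as))"

definition cyclic_operators ::
  "('k, 'r) ring_scheme \<Rightarrow> ('k, 'h, 'z) hopf_scheme \<Rightarrow> 'h \<Rightarrow> ('h \<Rightarrow> 'k) \<Rightarrow> ('h \<Rightarrow> 'k) \<Rightarrow>
   (nat \<Rightarrow> ('k, 'h) tensor \<Rightarrow> ('k, 'h) tensor) \<Rightarrow> bool" where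
  "cyclic_operators R H p \<alpha> \<beta> t \<longleftrightarrow>
     (\<forall>n. t n \<in> linear_maps R (tensor_power R H n) (tensor_power R H n)) \<and>
     (\<forall>x\<in>carrier (tensor_power R H 0). t 0 x = x) \<and>
     (\<forall>n\<ge>1. \<forall>as\<in>tuples H n.
        t n (pure R H as) =
          tensor_lift (tensor_power R H n)
            (\<lambda>w. (\<alpha> (list_prod H (map (\<lambda>i. w ! (3 * i)) [0..<n])) \<otimes>\<^bsub>R\<^esub> \<beta> (w ! (3 * (n - 1) + 2)))
                 \<odot>\<^bsub>tensor_power R H n\<^esub>
                 pure R H (twisted_antipode H p (list_prod H (map (\<lambda>i. w ! (3 * i + 1)) [0..<n])) #
                           map (\<lambda>i. w ! (3 * i + 2)) [0..<n - 1]))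
            (comult3_list R H as))"

end

theory Submission
  imports Defs
begin

text \<open>
  Write \<open>f = \<alpha> * S\<^sub>\<pi>\<close>, that is \<open>f(a) = \<alpha>(a\<^sup>(\<^sup>1\<^sup>)) \<pi> S(a\<^sup>(\<^sup>2\<^sup>))\<close>.  Everything is governed by the single map
  \<open>J : H\<^sup>\<otimes>\<^sup>n \<rightarrow> H\<^sup>\<otimes>\<^sup>n\<^sup>+\<^sup>1\<close> (\<open>extra\<close> below),
  \<open>J(a\<^sub>1 \<otimes> \<dots> \<otimes> a\<^sub>n) = f(a\<^sub>1\<^sup>(\<^sup>1\<^sup>) \<cdots> a\<^sub>n\<^sup>(\<^sup>1\<^sup>)) \<otimes> a\<^sub>1\<^sup>(\<^sup>2\<^sup>) \<otimes> \<dots> \<otimes> a\<^sub>n\<^sup>(\<^sup>2\<^sup>)\<close>,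
  the codiagonal left coaction of \<open>H\<close> followed by \<open>f\<close> on the first factor.  It is an extra
  degeneracy for the simplicial module:
  \<open>d\<^sub>0 J = id\<close>, \<open>d\<^sub>i\<^sub>+\<^sub>1 J = J d\<^sub>i\<close> for \<open>i < n\<close>, \<open>s\<^sub>i\<^sub>+\<^sub>1 J = J s\<^sub>i\<close> and \<open>s\<^sub>0 J = J J\<close>.
  These identities rest on \<open>\<alpha>(f(a)) = \<epsilon>(a)\<close>, on \<open>f(a\<^sup>(\<^sup>1\<^sup>) b) a\<^sup>(\<^sup>2\<^sup>) = \<alpha>(a) f(b)\<close> and on
  \<open>\<Delta>(f(a)) = \<pi> S(a\<^sup>(\<^sup>2\<^sup>)) \<otimes> f(a\<^sup>(\<^sup>1\<^sup>))\<close>.  Moreover \<open>t\<^sub>n = d\<^sub>n\<^sub>+\<^sub>1 J\<close>, so every relation between the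
  cyclic operators and the faces and degeneracies is a formal consequence of the simplicial
  identities and of those for \<open>J\<close>.

  The square condition enters only in \<open>t\<^sub>n\<^sup>n\<^sup>+\<^sup>1 = id\<close>.  The map \<open>J\<close> is injective and turns \<open>t\<^sub>n\<close> into
  the twisted rotation \<open>a\<^sub>0 \<otimes> \<dots> \<otimes> a\<^sub>n \<mapsto> \<theta>(a\<^sub>n) \<otimes> a\<^sub>0 \<otimes> \<dots> \<otimes> a\<^sub>n\<^sub>-\<^sub>1\<close> with
  \<open>\<theta>(a) = f(\<pi> S(a\<^sup>(\<^sup>1\<^sup>))) \<beta>(a\<^sup>(\<^sup>2\<^sup>))\<close> (lemma \<open>extra_t\<close>), whose power \<open>n + 1\<close> is \<open>\<theta>\<^sup>\<otimes>\<^sup>n\<^sup>+\<^sup>1\<close>.  Now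
  \<open>(\<alpha> * S\<^sub>\<pi> * \<beta>)\<^sup>2 = (\<beta> \<circ> f) * \<theta>\<close>, and \<open>\<beta> \<circ> f\<close> is a character, so the condition says
  \<open>\<theta> = \<psi> * id\<close> for the inverse character \<open>\<psi> = \<beta> \<circ> f \<circ> S\<close>.  As \<open>\<psi>\<close> is multiplicative, \<open>\<theta>\<^sup>\<otimes>\<^sup>n\<close> acts on
  \<open>H\<^sup>\<otimes>\<^sup>n\<close> by applying \<open>\<psi>\<close> to the coaction, and this cancels against \<open>\<theta>\<close> on the first factor:
  \<open>\<theta>\<^sup>\<otimes>\<^sup>n\<^sup>+\<^sup>1\<close> fixes the image of \<open>J\<close> (lemma \<open>rotate_theta_power_extra\<close>).

  Sweedler calculations are carried out as identities between iterated sums of values of a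
  multilinear expression: \<open>sw\<close> sums over \<open>\<Delta> a\<close>, and \<open>coact\<close> over the coproducts of all entries of a
  tuple at once.  An identity between tensors is the case where the expression is a pure tensor.
  That \<open>S\<close> reverses products and coproducts is derived from the axioms.
\<close>

section \<open>Linear and multilinear maps\<close>

lemma linear_mapsI:
  assumes "\<And>x. x \<in> carrier M \<Longrightarrow> f x \<in> carrier N"
    and "\<And>x y. \<lbrakk>x \<in> carrier M; y \<in> carrier M\<rbrakk> \<Longrightarrow> f (x \<oplus>\<^bsub>M\<^esub> y) = f x \<oplus>\<^bsub>N\<^esub> f y"
    and "\<And>c x. \<lbrakk>c \<in> carrier R; x \<in> carrier M\<rbrakk> \<Longrightarrow> f (c \<odot>\<^bsub>M\<^esub> x) = c \<odot>\<^bsub>N\<^esub> f x"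
  shows "f \<in> linear_maps R M N"
  using assms unfolding linear_maps_def by auto

lemma linear_closed: "f \<in> linear_maps R M N \<Longrightarrow> x \<in> carrier M \<Longrightarrow> f x \<in> carrier N"
  unfolding linear_maps_def by auto

lemma linear_add:
  "\<lbrakk>f \<in> linear_maps R M N; x \<in> carrier M; y \<in> carrier M\<rbrakk> \<Longrightarrow> f (x \<oplus>\<^bsub>M\<^esub> y) = f x \<oplus>\<^bsub>N\<^esub> f y"
  unfolding linear_maps_def by auto

lemma linear_smult:
  "\<lbrakk>f \<in> linear_maps R M N; c \<in> carrier R; x \<in> carrier M\<rbrakk> \<Longrightarrow> f (c \<odot>\<^bsub>M\<^esub> x) = c \<odot>\<^bsub>N\<^esub> f x"
  unfolding linear_maps_def by auto

lemma linear_zero: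
  assumes "module R M" "module R N" "f \<in> linear_maps R M N"
  shows "f \<zero>\<^bsub>M\<^esub> = \<zero>\<^bsub>N\<^esub>"
proof -
  interpret M: module R M by fact
  interpret N: module R N by fact
  have "f (\<zero>\<^bsub>R\<^esub> \<odot>\<^bsub>M\<^esub> \<zero>\<^bsub>M\<^esub>) = \<zero>\<^bsub>R\<^esub> \<odot>\<^bsub>N\<^esub> f \<zero>\<^bsub>M\<^esub>"
    by (rule linear_smult[OF assms(3)]) auto
  then show ?thesis using linear_closed[OF assms(3), of "\<zero>\<^bsub>M\<^esub>"] by simp
qed

lemma linear_cong:
  assumes "module R M" "\<And>x. x \<in> carrier M \<Longrightarrow> f x = g x"
  shows "f \<in> linear_maps R M N \<longleftrightarrow> g \<in> linear_maps R M N"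
proof -
  interpret M: module R M by fact
  show ?thesis using assms(2) unfolding linear_maps_def by (auto simp: Pi_iff)
qed

lemma linear_compose:
  assumes "g \<in> linear_maps R M N" "f \<in> linear_maps R L M"
  shows "(\<lambda>x. g (f x)) \<in> linear_maps R L N"
  using assms unfolding linear_maps_def by (auto simp: Pi_iff)

lemma linear_ident: "(\<lambda>x. x) \<in> linear_maps R M M"
  unfolding linear_maps_def by auto

lemma linear_scale:
  assumes "module R N" "f \<in> linear_maps R M N" "c \<in> carrier R"
  shows "(\<lambda>x. c \<odot>\<^bsub>N\<^esub> f x) \<in> linear_maps R M N"
proof -
  interpret N: module R N by fact
  show ?thesis
    using assms(2,3)
    by (intro linear_mapsI)
       (auto simp: linear_closed linear_add linear_smult N.smult_r_distr N.smult_assoc1[symmetric]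
          N.R.m_comm)
qed

lemma linear_plus:
  assumes "module R N" "f \<in> linear_maps R M N" "g \<in> linear_maps R M N"
  shows "(\<lambda>x. f x \<oplus>\<^bsub>N\<^esub> g x) \<in> linear_maps R M N"
proof -
  interpret N: module R N by fact
  show ?thesis
    using assms(2,3)
    by (intro linear_mapsI)
       (auto simp: linear_closed linear_add linear_smult N.smult_r_distr N.M.a_ac)
qed

lemma linear_const_zero:
  assumes "module R N"
  shows "(\<lambda>x. \<zero>\<^bsub>N\<^esub>) \<in> linear_maps R M N"
proof -
  interpret N: module R N by fact
  show ?thesis by (intro linear_mapsI) auto
qed

definition multilinear ::
  "('k, 'r) ring_scheme \<Rightarrow> ('k, 'a, 'm) module_scheme \<Rightarrow> ('k, 'b, 'n) module_scheme \<Rightarrow> nat \<Rightarrow>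
   ('a list \<Rightarrow> 'b) \<Rightarrow> bool" where
  "multilinear R M N n f \<longleftrightarrow> (\<forall>w\<in>tuples M n. f w \<in> carrier N) \<and>
     (\<forall>us vs. us @ vs \<in> tuples M (n - 1) \<and> 0 < n \<longrightarrow>
        (\<lambda>x. f (us @ x # vs)) \<in> linear_maps R M N)"

lemma tuples_0 [simp]: "w \<in> tuples M 0 \<longleftrightarrow> w = []"
  unfolding tuples_def by auto

lemma Nil_tuples [simp]: "[] \<in> tuples M n \<longleftrightarrow> n = 0"
  unfolding tuples_def by auto

lemma Cons_tuples [simp]:
  "x # w \<in> tuples M n \<longleftrightarrow> x \<in> carrier M \<and> 0 < n \<and> w \<in> tuples M (n - 1)"
  unfolding tuples_def by auto

lemma tuples_Suc: "w \<in> tuples M (Suc n) \<longleftrightarrow> (\<exists>x u. w = x # u \<and> x \<in> carrier M \<and> u \<in> tuples M n)"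
  unfolding tuples_def by (cases w) auto

lemma tuples_length: "w \<in> tuples M n \<Longrightarrow> length w = n"
  unfolding tuples_def by auto

lemma tuples_nth: "w \<in> tuples M n \<Longrightarrow> i < n \<Longrightarrow> w ! i \<in> carrier M"
  unfolding tuples_def by auto

lemma multilinear_closed: "multilinear R M N n f \<Longrightarrow> w \<in> tuples M n \<Longrightarrow> f w \<in> carrier N"
  unfolding multilinear_def by blast

lemma multilinear_slot:
  assumes "multilinear R M N n f" "us @ vs \<in> tuples M (n - 1)" "0 < n"
  shows "(\<lambda>x. f (us @ x # vs)) \<in> linear_maps R M N"
  using assms unfolding multilinear_def by blast

lemma multilinear_0: "multilinear R M N 0 f \<longleftrightarrow> f [] \<in> carrier N"
  unfolding multilinear_def by (simp add: Ball_def)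

text \<open>This makes multilinearity accessible to induction over tuples.\<close>

lemma multilinear_Suc:
  "multilinear R M N (Suc n) f \<longleftrightarrow>
     (\<forall>w\<in>tuples M n. (\<lambda>x. f (x # w)) \<in> linear_maps R M N) \<and>
     (\<forall>x\<in>carrier M. multilinear R M N n (\<lambda>w. f (x # w)))"
proof
  assume f: "multilinear R M N (Suc n) f"
  have "(\<lambda>x. f (x # w)) \<in> linear_maps R M N" if "w \<in> tuples M n" for w
    using multilinear_slot[OF f, of "[]" w] that by simp
  moreover have "multilinear R M N n (\<lambda>w. f (x # w))" if x: "x \<in> carrier M" for x
    unfolding multilinear_def
  proof (intro conjI ballI allI impI)
    show "f (x # w) \<in> carrier N" if "w \<in> tuples M n" for w
      using multilinear_closed[OF f] x that by simp
    fix us vs assume "us @ vs \<in> tuples M (n - 1) \<and> 0 < n"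
    then show "(\<lambda>y. f (x # us @ y # vs)) \<in> linear_maps R M N"
      using multilinear_slot[OF f, of "x # us" vs] x by simp
  qed
  ultimately show "(\<forall>w\<in>tuples M n. (\<lambda>x. f (x # w)) \<in> linear_maps R M N) \<and>
     (\<forall>x\<in>carrier M. multilinear R M N n (\<lambda>w. f (x # w)))" by blast
next
  assume a: "(\<forall>w\<in>tuples M n. (\<lambda>x. f (x # w)) \<in> linear_maps R M N) \<and>
     (\<forall>x\<in>carrier M. multilinear R M N n (\<lambda>w. f (x # w)))"
  show "multilinear R M N (Suc n) f"
    unfolding multilinear_def
  proof (intro conjI ballI allI impI)
    show "f w \<in> carrier N" if "w \<in> tuples M (Suc n)" for w
      using a that multilinear_closed by (fastforce simp: tuples_Suc)
    fix us vs assume u: "us @ vs \<in> tuples M (Suc n - 1) \<and> 0 < Suc n"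
    show "(\<lambda>x. f (us @ x # vs)) \<in> linear_maps R M N"
    proof (cases us)
      case Nil
      then show ?thesis using a u by simp
    next
      case (Cons y us')
      then have "multilinear R M N n (\<lambda>w. f (y # w))" using a u by simp
      from multilinear_slot[OF this, of us' vs] show ?thesis using Cons u by simp
    qed
  qed
qed

lemma multilinear_cong:
  assumes "\<And>w. w \<in> tuples M n \<Longrightarrow> f w = g w" "module R M"
  shows "multilinear R M N n f \<longleftrightarrow> multilinear R M N n g"
  using assms(1)
proof (induction n arbitrary: f g)
  case 0
  then show ?case by (simp add: multilinear_0)
next
  case (Suc n)
  have "(\<lambda>x. f (x # w)) \<in> linear_maps R M N \<longleftrightarrow> (\<lambda>x. g (x # w)) \<in> linear_maps R M N"
    if "w \<in> tuples M n" for w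
    using Suc.prems that by (intro linear_cong[OF assms(2)]) simp
  moreover have "multilinear R M N n (\<lambda>w. f (x # w)) \<longleftrightarrow> multilinear R M N n (\<lambda>w. g (x # w))"
    if "x \<in> carrier M" for x
    using Suc.prems that by (intro Suc.IH) simp
  ultimately show ?case by (simp add: multilinear_Suc)
qed

lemma multilinear_compose:
  assumes "g \<in> linear_maps R N P" "multilinear R M N n f"
  shows "multilinear R M P n (\<lambda>w. g (f w))"
  unfolding multilinear_def
proof (intro conjI ballI allI impI)
  show "g (f w) \<in> carrier P" if "w \<in> tuples M n" for w
    using linear_closed[OF assms(1) multilinear_closed[OF assms(2) that]] .
  show "(\<lambda>x. g (f (us @ x # vs))) \<in> linear_maps R M P"
    if "us @ vs \<in> tuples M (n - 1) \<and> 0 < n" for us vs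
    using linear_compose[OF assms(1) multilinear_slot[OF assms(2)]] that by blast
qed

section \<open>Tensor powers as modules\<close>

lemma eval_sum_Nil [simp]: "eval_sum N f [] = \<zero>\<^bsub>N\<^esub>"
  by (simp add: eval_sum_def)

lemma eval_sum_Cons [simp]: "eval_sum N f ((c, w) # u) = c \<odot>\<^bsub>N\<^esub> f w \<oplus>\<^bsub>N\<^esub> eval_sum N f u"
  by (simp add: eval_sum_def)

lemma formal_sums_Nil [simp]: "[] \<in> formal_sums R M n"
  by (simp add: formal_sums_def)

lemma formal_sums_Cons [simp]:
  "(c, w) # u \<in> formal_sums R M n \<longleftrightarrow>
     c \<in> carrier R \<and> w \<in> tuples M n \<and> u \<in> formal_sums R M n"
  by (auto simp: formal_sums_def)

lemma formal_sums_append [simp]: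
  "u @ v \<in> formal_sums R M n \<longleftrightarrow> u \<in> formal_sums R M n \<and> v \<in> formal_sums R M n"
  by (auto simp: formal_sums_def)

lemma formal_sums_induct [consumes 1, case_names Nil Cons]:
  assumes "u \<in> formal_sums R M n" "P []"
    and "\<And>c w u. \<lbrakk>c \<in> carrier R; w \<in> tuples M n; u \<in> formal_sums R M n; P u\<rbrakk> \<Longrightarrow> P ((c, w) # u)"
  shows "P u"
  using assms(1)
proof (induction u)
  case Nil
  show ?case by (rule assms(2))
next
  case (Cons a u)
  then show ?case using assms(3) by (cases a) simp
qed

lemma eval_sum_closed:
  assumes "module R N" "u \<in> formal_sums R M n" "\<And>w. w \<in> tuples M n \<Longrightarrow> f w \<in> carrier N"
  shows "eval_sum N f u \<in> carrier N"
proof -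
  interpret N: module R N by fact
  show ?thesis using assms(2) by (induction rule: formal_sums_induct) (auto simp: assms(3))
qed

lemma eval_sum_cong:
  assumes "u \<in> formal_sums R M n" "\<And>w. w \<in> tuples M n \<Longrightarrow> f w = g w"
  shows "eval_sum N f u = eval_sum N g u"
  using assms(1) by (induction rule: formal_sums_induct) (auto simp: assms(2))

lemma eval_sum_append:
  assumes "module R N" "u \<in> formal_sums R M n" "v \<in> formal_sums R M n"
    "\<And>w. w \<in> tuples M n \<Longrightarrow> f w \<in> carrier N"
  shows "eval_sum N f (u @ v) = eval_sum N f u \<oplus>\<^bsub>N\<^esub> eval_sum N f v"
proof -
  interpret N: module R N by fact
  note cl = eval_sum_closed[OF assms(1) _ assms(4)]
  show ?thesis using assms(2)
    by (induction rule: formal_sums_induct)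
       (auto simp: assms(3,4) cl cl[OF assms(3)] N.M.a_assoc)
qed

lemma linear_eval_sum:
  assumes "module R M" "module R N" "g \<in> linear_maps R M N" "u \<in> formal_sums R L n"
    "\<And>w. w \<in> tuples L n \<Longrightarrow> f w \<in> carrier M"
  shows "g (eval_sum M f u) = eval_sum N (\<lambda>w. g (f w)) u"
proof -
  interpret M: module R M by fact
  show ?thesis using assms(4)
    by (induction rule: formal_sums_induct)
       (auto simp: linear_zero[OF assms(1,2,3)] assms(5) linear_add[OF assms(3)]
          linear_smult[OF assms(3)] eval_sum_closed[OF assms(1) _ assms(5)])
qed

lemma eval_sum_linear:
  assumes "module R M" "module R N" "u \<in> formal_sums R L n"
    "\<And>w. w \<in> tuples L n \<Longrightarrow> (\<lambda>x. f x w) \<in> linear_maps R M N"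
  shows "(\<lambda>x. eval_sum N (f x) u) \<in> linear_maps R M N"
  using assms(3)
  by (induction rule: formal_sums_induct)
     (auto intro!: linear_const_zero linear_plus linear_scale assms)

lemma eval_sum_swap:
  assumes N: "module R N" and u: "u \<in> formal_sums R L n" and v: "v \<in> formal_sums R L' m"
    and f: "\<And>w z. \<lbrakk>w \<in> tuples L n; z \<in> tuples L' m\<rbrakk> \<Longrightarrow> f w z \<in> carrier N"
  shows "eval_sum N (\<lambda>w. eval_sum N (f w) v) u = eval_sum N (\<lambda>z. eval_sum N (\<lambda>w. f w z) u) v"
proof -
  interpret N: module R N by fact
  have zero: "eval_sum N (\<lambda>w. \<zero>\<^bsub>N\<^esub>) v = \<zero>\<^bsub>N\<^esub>"
    using v by (induction rule: formal_sums_induct) auto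
  have comb: "eval_sum N (\<lambda>z. c \<odot>\<^bsub>N\<^esub> g z \<oplus>\<^bsub>N\<^esub> h z) v = c \<odot>\<^bsub>N\<^esub> eval_sum N g v \<oplus>\<^bsub>N\<^esub> eval_sum N h v"
    if c: "c \<in> carrier R" and g: "\<And>z. z \<in> tuples L' m \<Longrightarrow> g z \<in> carrier N"
      and h: "\<And>z. z \<in> tuples L' m \<Longrightarrow> h z \<in> carrier N" for c g h
    using v
  proof (induction rule: formal_sums_induct)
    case Nil
    then show ?case using c by simp
  next
    case (Cons e z v)
    have cl: "eval_sum N g v \<in> carrier N" "eval_sum N h v \<in> carrier N"
      using Cons eval_sum_closed[OF N] g h by blast+
    have "e \<odot>\<^bsub>N\<^esub> (c \<odot>\<^bsub>N\<^esub> g z) = c \<odot>\<^bsub>N\<^esub> (e \<odot>\<^bsub>N\<^esub> g z)"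
      using c g Cons by (simp add: N.smult_assoc1[symmetric] N.R.m_comm)
    then show ?case using Cons c g h cl
      by (simp add: N.smult_r_distr N.M.a_ac)
  qed
  show ?thesis using u
  proof (induction rule: formal_sums_induct)
    case Nil
    then show ?case by (simp add: zero)
  next
    case (Cons c w u)
    then show ?case
      by (simp, subst comb) (auto simp: f intro!: eval_sum_closed[OF N])
  qed
qed

lemma tensor_eq_formal_sums:
  assumes "module R M" "tensor_eq R M n u v"
  shows "u \<in> formal_sums R M n" "v \<in> formal_sums R M n"
proof -
  interpret M: module R M by fact
  have "u \<in> formal_sums R M n \<and> v \<in> formal_sums R M n"
    using assms(2)
    by induction (auto simp: tuples_def dest: set_update_subset_insert[THEN subsetD])
  then show "u \<in> formal_sums R M n" "v \<in> formal_sums R M n" by auto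
qed

text \<open>Multilinear maps descend to tensor powers: each multilinearity generator of the congruence
  is an instance of additivity or homogeneity in one slot, and the others hold in every module.\<close>

lemma eval_sum_tensor_eq:
  assumes "module R M" "module R N" "multilinear R M N n f" "tensor_eq R M n u v"
  shows "eval_sum N f u = eval_sum N f v"
proof -
  interpret M: module R M by fact
  interpret N: module R N by fact
  have cl: "\<And>w. w \<in> tuples M n \<Longrightarrow> f w \<in> carrier N"
    using assms(3) by (rule multilinear_closed)
  have slot: "(\<lambda>a. f (w[i := a])) \<in> linear_maps R M N" if "w \<in> tuples M n" "i < n" for w i
  proof -
    have "take i w @ drop (Suc i) w \<in> tuples M (n - 1)"
      using that unfolding tuples_def by (auto dest: in_set_takeD in_set_dropD)
    from multilinear_slot[OF assms(3) this] show ?thesis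
      using that tuples_length[OF that(1)] by (simp add: upd_conv_take_nth_drop)
  qed
  have upd: "w[i := a] \<in> tuples M n" if "w \<in> tuples M n" "a \<in> carrier M" for w i a
    using that unfolding tuples_def by (auto dest: set_update_subset_insert[THEN subsetD])
  show ?thesis using assms(4)
  proof induction
    case (append u u' v v')
    note app = eval_sum_append[where f = f, OF assms(2) _ _ cl]
    show ?case
      using append.IH app[OF append.hyps[THEN tensor_eq_formal_sums(1)[OF assms(1)]]]
        app[OF append.hyps[THEN tensor_eq_formal_sums(2)[OF assms(1)]]] by simp
  next
    case (commute u v)
    then show ?case
      using eval_sum_append[where f = f, OF assms(2) commute cl]
        eval_sum_append[where f = f, OF assms(2) commute(2,1) cl]
        eval_sum_closed[where f = f, OF assms(2) commute(1) cl]
        eval_sum_closed[where f = f, OF assms(2) commute(2) cl]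
      by (simp add: N.M.a_comm)
  next
    case (slot_add c w i a b)
    then show ?case
      using linear_add[OF slot, of w i a b] by (simp add: cl upd N.smult_r_distr)
  next
    case (slot_smult c w i r a)
    then show ?case
      using linear_smult[OF slot, of w i r a] by (simp add: cl upd N.smult_assoc1)
  qed (auto simp: cl N.smult_l_distr)
qed

lemma tensor_class_eq:
  assumes "v \<in> formal_sums R M n"
  shows "tensor_class R M n u = tensor_class R M n v \<longleftrightarrow> tensor_eq R M n u v"
proof
  assume "tensor_class R M n u = tensor_class R M n v"
  then show "tensor_eq R M n u v"
    using tensor_eq.refl[OF assms] unfolding tensor_class_def by blast
next
  assume "tensor_eq R M n u v"
  then show "tensor_class R M n u = tensor_class R M n v"
    unfolding tensor_class_def by (blast intro: tensor_eq.sym tensor_eq.trans)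
qed

lemma tensor_class_self: "u \<in> formal_sums R M n \<Longrightarrow> u \<in> tensor_class R M n u"
  unfolding tensor_class_def by (auto intro: tensor_eq.refl)

lemma Union_const:
  assumes "x \<in> X" "\<And>y. y \<in> X \<Longrightarrow> g y = c"
  shows "(\<Union>y\<in>X. g y) = c"
  using assms by blast

lemma tensor_carrierE:
  assumes "X \<in> carrier (tensor_power R M n)"
  obtains u where "u \<in> formal_sums R M n" "X = tensor_class R M n u"
  using assms unfolding tensor_power_def by auto

lemma tensor_class_closed:
  "u \<in> formal_sums R M n \<Longrightarrow> tensor_class R M n u \<in> carrier (tensor_power R M n)"
  unfolding tensor_power_def by auto

lemma tensor_zero: "\<zero>\<^bsub>tensor_power R M n\<^esub> = tensor_class R M n []"
  by (simp add: tensor_power_def)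

context module
begin

lemma tensor_class_cong:
  assumes "tensor_eq R M n u v"
  shows "tensor_class R M n u = tensor_class R M n v"
  using tensor_class_eq[OF tensor_eq_formal_sums(2)[OF module_axioms assms]] assms by blast

lemma mem_tensor_class: "v \<in> tensor_class R M n u \<longleftrightarrow> tensor_eq R M n u v"
  by (simp add: tensor_class_def)

lemma tensor_add:
  assumes "u \<in> formal_sums R M n" "v \<in> formal_sums R M n"
  shows "tensor_class R M n u \<oplus>\<^bsub>tensor_power R M n\<^esub> tensor_class R M n v = tensor_class R M n (u @ v)"
proof -
  have "(\<Union>v'\<in>tensor_class R M n v. tensor_class R M n (u' @ v')) = tensor_class R M n (u @ v)"
    if "u' \<in> tensor_class R M n u" for u'
    by (rule Union_const[OF tensor_class_self[OF assms(2)]])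
       (metis that mem_tensor_class tensor_eq.append tensor_eq.sym tensor_class_cong)
  then have "(\<Union>u'\<in>tensor_class R M n u. \<Union>v'\<in>tensor_class R M n v. tensor_class R M n (u' @ v')) =
      tensor_class R M n (u @ v)"
    by (rule Union_const[OF tensor_class_self[OF assms(1)]])
  then show ?thesis unfolding tensor_power_def by simp
qed

abbreviation (input) scale :: "'a \<Rightarrow> ('a \<times> 'c list) list \<Rightarrow> ('a \<times> 'c list) list" where
  "scale c u \<equiv> [(c \<otimes> d, w). (d, w) \<leftarrow> u]"

lemma scale_formal_sums:
  assumes "c \<in> carrier R" "u \<in> formal_sums R M n"
  shows "scale c u \<in> formal_sums R M n"
  using assms(2) by (induction rule: formal_sums_induct) (auto simp: assms(1))

lemma scale_tensor_eq:
  assumes c: "c \<in> carrier R" and "tensor_eq R M n u v"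
  shows "tensor_eq R M n (scale c u) (scale c v)"
  using assms(2)
proof induction
  case (refl u)
  then show ?case by (rule tensor_eq.refl[OF scale_formal_sums[OF c]])
next
  case (sym u v)
  show ?case using sym.IH by (rule tensor_eq.sym)
next
  case (trans u v x)
  show ?case using trans.IH by (rule tensor_eq.trans)
next
  case (append u u' v v')
  show ?case using tensor_eq.append[OF append.IH] by simp
next
  case (commute u v)
  then show ?case
    using tensor_eq.commute[OF scale_formal_sums[OF c] scale_formal_sums[OF c], of u n v] by simp
next
  case (coeff_zero w)
  then show ?case using tensor_eq.coeff_zero c by auto
next
  case (coeff_add d e w)
  then show ?case using tensor_eq.coeff_add[of "c \<otimes> d" R "c \<otimes> e" w M n] c by (simp add: R.r_distr)
next
  case (slot_add d w i a b)
  then show ?case using tensor_eq.slot_add[of "c \<otimes> d" R w M n i a b] c by simp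
next
  case (slot_smult d w i r a)
  then show ?case
    using tensor_eq.slot_smult[of "c \<otimes> d" R w M n i r a] c by (simp add: R.m_assoc)
qed

lemma tensor_smult:
  assumes "c \<in> carrier R" "u \<in> formal_sums R M n"
  shows "c \<odot>\<^bsub>tensor_power R M n\<^esub> tensor_class R M n u = tensor_class R M n (scale c u)"
  unfolding tensor_power_def
  by (simp, rule Union_const[OF tensor_class_self[OF assms(2)]])
     (metis assms(1) mem_tensor_class scale_tensor_eq tensor_eq.sym tensor_class_cong)

text \<open>Once \<open>(c + d) X = c X + d X\<close> is known on representatives, negatives come for free:
  \<open>- X\<close> is \<open>(- 1) X\<close>.\<close>

lemma tensor_power_module: "module R (tensor_power R M n)"
proof -
  let ?T = "tensor_power R M n"
  let ?F = "formal_sums R M n"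
  let ?cl = "tensor_class R M n"
  have comm: "X \<oplus>\<^bsub>?T\<^esub> Y = Y \<oplus>\<^bsub>?T\<^esub> X" if "X \<in> carrier ?T" "Y \<in> carrier ?T" for X Y
    using that by (elim tensor_carrierE)
      (simp add: tensor_add, rule tensor_class_cong[OF tensor_eq.commute])
  have assoc: "X \<oplus>\<^bsub>?T\<^esub> Y \<oplus>\<^bsub>?T\<^esub> Z = X \<oplus>\<^bsub>?T\<^esub> (Y \<oplus>\<^bsub>?T\<^esub> Z)"
    if "X \<in> carrier ?T" "Y \<in> carrier ?T" "Z \<in> carrier ?T" for X Y Z
    using that by (elim tensor_carrierE) (simp add: tensor_add)
  have add_closed: "X \<oplus>\<^bsub>?T\<^esub> Y \<in> carrier ?T" if "X \<in> carrier ?T" "Y \<in> carrier ?T" for X Y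
    using that by (elim tensor_carrierE) (simp add: tensor_add tensor_class_closed)
  have zero: "\<zero>\<^bsub>?T\<^esub> \<in> carrier ?T" by (simp add: tensor_zero tensor_class_closed)
  have l_zero: "\<zero>\<^bsub>?T\<^esub> \<oplus>\<^bsub>?T\<^esub> X = X" if "X \<in> carrier ?T" for X
    using that by (elim tensor_carrierE) (simp add: tensor_zero tensor_add)
  interpret T: abelian_monoid ?T
    by (rule abelian_monoidI) (rule add_closed zero assoc l_zero comm; assumption)+
  have smult_closed: "c \<odot>\<^bsub>?T\<^esub> X \<in> carrier ?T" if "c \<in> carrier R" "X \<in> carrier ?T" for c X
    using that by (elim tensor_carrierE) (simp add: tensor_smult tensor_class_closed scale_formal_sums)
  have split: "?cl ((c, w) # u) = ?cl [(c, w)] \<oplus>\<^bsub>?T\<^esub> ?cl u"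
    if "c \<in> carrier R" "w \<in> tuples M n" "u \<in> ?F" for c w u
    using that tensor_add[of "[(c, w)]" n u] by simp
  have distr: "?cl (scale (c \<oplus> d) u) = ?cl (scale c u) \<oplus>\<^bsub>?T\<^esub> ?cl (scale d u)"
    if c: "c \<in> carrier R" and d: "d \<in> carrier R" and u: "u \<in> ?F" for c d u
    using u
  proof (induction rule: formal_sums_induct)
    case Nil
    then show ?case by (simp flip: tensor_zero)
  next
    case (Cons e w u)
    have "?cl [((c \<oplus> d) \<otimes> e, w)] = ?cl [(c \<otimes> e, w)] \<oplus>\<^bsub>?T\<^esub> ?cl [(d \<otimes> e, w)]"
      using tensor_class_cong[OF tensor_eq.coeff_add[of "c \<otimes> e" R "d \<otimes> e" w M n]] Cons c d
      by (simp add: tensor_add R.l_distr)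
    moreover have "?cl (scale c u) \<in> carrier ?T" "?cl (scale d u) \<in> carrier ?T"
      "?cl [(c \<otimes> e, w)] \<in> carrier ?T" "?cl [(d \<otimes> e, w)] \<in> carrier ?T"
      using Cons c d by (auto intro!: tensor_class_closed scale_formal_sums)
    ultimately show ?case
      using Cons c d
      by (simp add: split[of _ _ "scale _ u"] scale_formal_sums T.a_ac)
  qed
  have scale_zero: "?cl (scale \<zero> u) = \<zero>\<^bsub>?T\<^esub>" if "u \<in> ?F" for u
    using that
  proof (induction rule: formal_sums_induct)
    case (Cons e w u)
    then have "?cl [(\<zero>, w)] = \<zero>\<^bsub>?T\<^esub>"
      using tensor_class_cong[OF tensor_eq.coeff_zero] by (simp add: tensor_zero)
    then show ?case using Cons by (simp add: split[of _ _ "scale \<zero> u"] scale_formal_sums zero)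
  qed (simp add: tensor_zero)
  have scale_one: "scale \<one> u = u" if "u \<in> ?F" for u
    using that by (induction rule: formal_sums_induct) auto
  have l_distr: "(c \<oplus> d) \<odot>\<^bsub>?T\<^esub> X = c \<odot>\<^bsub>?T\<^esub> X \<oplus>\<^bsub>?T\<^esub> d \<odot>\<^bsub>?T\<^esub> X"
    if "c \<in> carrier R" "d \<in> carrier R" "X \<in> carrier ?T" for c d X
    using that by (elim tensor_carrierE) (simp add: tensor_smult distr)
  have one: "\<one> \<odot>\<^bsub>?T\<^esub> X = X" if "X \<in> carrier ?T" for X
    using that by (elim tensor_carrierE) (simp add: tensor_smult scale_one)
  have null: "\<zero> \<odot>\<^bsub>?T\<^esub> X = \<zero>\<^bsub>?T\<^esub>" if "X \<in> carrier ?T" for X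
    using that by (elim tensor_carrierE) (simp add: tensor_smult scale_zero)
  have inv: "\<exists>Y\<in>carrier ?T. Y \<oplus>\<^bsub>?T\<^esub> X = \<zero>\<^bsub>?T\<^esub>" if X: "X \<in> carrier ?T" for X
  proof
    have "(\<ominus> \<one>) \<odot>\<^bsub>?T\<^esub> X \<oplus>\<^bsub>?T\<^esub> X = (\<ominus> \<one> \<oplus> \<one>) \<odot>\<^bsub>?T\<^esub> X"
      using X by (simp add: l_distr one)
    then show "(\<ominus> \<one>) \<odot>\<^bsub>?T\<^esub> X \<oplus>\<^bsub>?T\<^esub> X = \<zero>\<^bsub>?T\<^esub>"
      using X by (simp add: R.l_neg null)
  qed (use X smult_closed in simp)
  show ?thesis
  proof (rule moduleI)
    show "cring R" by (rule R.is_cring)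
    show "abelian_group ?T"
      by (rule abelian_groupI) (rule add_closed zero assoc l_zero comm inv; assumption)+
    show "c \<odot>\<^bsub>?T\<^esub> (X \<oplus>\<^bsub>?T\<^esub> Y) = c \<odot>\<^bsub>?T\<^esub> X \<oplus>\<^bsub>?T\<^esub> c \<odot>\<^bsub>?T\<^esub> Y"
      if "c \<in> carrier R" "X \<in> carrier ?T" "Y \<in> carrier ?T" for c X Y
      using that by (elim tensor_carrierE) (simp add: tensor_smult tensor_add scale_formal_sums)
    have "scale (c \<otimes> d) u = scale c (scale d u)"
      if "c \<in> carrier R" "d \<in> carrier R" "u \<in> ?F" for c d u
      using that(3) by (induction rule: formal_sums_induct) (auto simp: that(1,2) R.m_assoc)
    note scale_assoc = this
    show "c \<otimes> d \<odot>\<^bsub>?T\<^esub> X = c \<odot>\<^bsub>?T\<^esub> (d \<odot>\<^bsub>?T\<^esub> X)"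
      if cd: "c \<in> carrier R" "d \<in> carrier R" and X: "X \<in> carrier ?T" for c d X
    proof -
      obtain u where u: "u \<in> ?F" "X = ?cl u" using X by (rule tensor_carrierE)
      then show ?thesis
        using cd by (simp only: tensor_smult scale_formal_sums scale_assoc R.m_closed)
    qed
  qed (rule smult_closed l_distr one; assumption)+
qed

lemma pure_closed: "w \<in> tuples M n \<Longrightarrow> pure R M w \<in> carrier (tensor_power R M n)"
  unfolding pure_def using tuples_length[of w M n]
  by (auto intro!: tensor_class_closed)

lemma tensor_class_eval_sum:
  assumes "u \<in> formal_sums R M n"
  shows "tensor_class R M n u = eval_sum (tensor_power R M n) (pure R M) u"
  using assms
proof (induction rule: formal_sums_induct)
  case Nil
  then show ?case by (simp add: tensor_zero)
next
  case (Cons c w u)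
  then have "c \<odot>\<^bsub>tensor_power R M n\<^esub> pure R M w = tensor_class R M n [(c, w)]"
    unfolding pure_def by (simp add: tensor_smult tuples_length[of w M n])
  then show ?case using Cons tensor_add[of "[(c, w)]" n u] by simp
qed

lemma pure_multilinear: "multilinear R M (tensor_power R M n) n (pure R M)"
  unfolding multilinear_def
proof (intro conjI ballI allI impI)
  show "pure R M w \<in> carrier (tensor_power R M n)" if "w \<in> tuples M n" for w
    using that by (rule pure_closed)
  fix us vs assume uv: "us @ vs \<in> tuples M (n - 1) \<and> 0 < n"
  then have len: "length us < n" "Suc (length us + length vs) = n"
    by (auto simp: tuples_def)
  have tup: "us @ x # vs \<in> tuples M n" if "x \<in> carrier M" for x
    using uv that by (auto simp: tuples_def)
  show "(\<lambda>x. pure R M (us @ x # vs)) \<in> linear_maps R M (tensor_power R M n)"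
  proof (rule linear_mapsI)
    fix x y assume xy: "x \<in> carrier M" "y \<in> carrier M"
    show "pure R M (us @ (x \<oplus>\<^bsub>M\<^esub> y) # vs) =
        pure R M (us @ x # vs) \<oplus>\<^bsub>tensor_power R M n\<^esub> pure R M (us @ y # vs)"
      using tensor_class_cong[OF tensor_eq.slot_add[OF R.one_closed tup[OF xy(1)] len(1) xy]] len tup xy
      unfolding pure_def by (simp add: tensor_add)
  next
    fix c x assume cx: "c \<in> carrier R" "x \<in> carrier M"
    show "pure R M (us @ (c \<odot>\<^bsub>M\<^esub> x) # vs) = c \<odot>\<^bsub>tensor_power R M n\<^esub> pure R M (us @ x # vs)"
      using tensor_class_cong[OF tensor_eq.slot_smult[OF R.one_closed tup[OF cx(2)] len(1) cx]] len tup cx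
      unfolding pure_def by (simp add: tensor_smult)
  qed (simp add: pure_closed tup)
qed

lemma tensor_lift_class:
  assumes "module R N" "multilinear R M N n f" "u \<in> formal_sums R M n"
  shows "tensor_lift N f (tensor_class R M n u) = eval_sum N f u"
proof -
  have "eval_sum N f v = eval_sum N f u" if "v \<in> tensor_class R M n u" for v
    using that eval_sum_tensor_eq[OF module_axioms assms(1,2), of u v]
    by (simp add: mem_tensor_class)
  moreover have "tensor_class R M n u \<noteq> {}"
    using tensor_class_self[OF assms(3)] by blast
  ultimately show ?thesis
    unfolding tensor_lift_def by (rule the_elem_image_unique[rotated])
qed

lemma tensor_lift_pure:
  assumes "module R N" "multilinear R M N n f" "w \<in> tuples M n"
  shows "tensor_lift N f (pure R M w) = f w"
proof -
  interpret N: module R N by fact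
  show ?thesis
    using assms tensor_lift_class[OF assms(1,2), of "[(\<one>, w)]"] multilinear_closed[OF assms(2,3)]
    unfolding pure_def by (simp add: tuples_length[of w M n])
qed

lemma tensor_lift_linear:
  assumes "module R N" "multilinear R M N n f"
  shows "tensor_lift N f \<in> linear_maps R (tensor_power R M n) N"
proof -
  interpret N: module R N by fact
  note cl = multilinear_closed[OF assms(2)]
  show ?thesis
  proof (rule linear_mapsI)
    show "tensor_lift N f X \<in> carrier N" if "X \<in> carrier (tensor_power R M n)" for X
      using that by (elim tensor_carrierE)
        (simp add: tensor_lift_class[OF assms] eval_sum_closed[OF assms(1) _ cl])
    show "tensor_lift N f (X \<oplus>\<^bsub>tensor_power R M n\<^esub> Y) = tensor_lift N f X \<oplus>\<^bsub>N\<^esub> tensor_lift N f Y"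
      if "X \<in> carrier (tensor_power R M n)" "Y \<in> carrier (tensor_power R M n)" for X Y
      using that by (elim tensor_carrierE)
        (simp add: tensor_add tensor_lift_class[OF assms] eval_sum_append[OF assms(1) _ _ cl])
    have "eval_sum N f (scale c u) = c \<odot>\<^bsub>N\<^esub> eval_sum N f u"
      if "c \<in> carrier R" "u \<in> formal_sums R M n" for c u
      using that(2)
      by (induction rule: formal_sums_induct)
         (auto simp: that(1) cl N.smult_r_distr N.smult_assoc1 eval_sum_closed[OF assms(1) _ cl])
    then show "tensor_lift N f (c \<odot>\<^bsub>tensor_power R M n\<^esub> X) = c \<odot>\<^bsub>N\<^esub> tensor_lift N f X"
      if "c \<in> carrier R" "X \<in> carrier (tensor_power R M n)" for c X
      using that by (elim tensor_carrierE)
        (simp add: tensor_smult tensor_lift_class[OF assms] scale_formal_sums)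
  qed
qed

text \<open>Pure tensors span, so a linear map on a tensor power is determined by its values on them.\<close>

lemma tensor_ext:
  assumes "module R N" "f \<in> linear_maps R (tensor_power R M n) N"
    "g \<in> linear_maps R (tensor_power R M n) N"
    "\<And>w. w \<in> tuples M n \<Longrightarrow> f (pure R M w) = g (pure R M w)" "X \<in> carrier (tensor_power R M n)"
  shows "f X = g X"
  using assms(5)
  by (elim tensor_carrierE)
     (simp add: tensor_class_eval_sum
        linear_eval_sum[OF tensor_power_module assms(1,2) _ pure_closed]
        linear_eval_sum[OF tensor_power_module assms(1,3) _ pure_closed]
        assms(4) cong: eval_sum_cong)

lemma tensor_lift_cong:
  assumes "module R N" "multilinear R M N n f" "\<And>w. w \<in> tuples M n \<Longrightarrow> f w = g w"
    "X \<in> carrier (tensor_power R M n)"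
  shows "tensor_lift N f X = tensor_lift N g X"
proof -
  have g: "multilinear R M N n g"
    by (rule multilinear_cong[THEN iffD1, OF assms(3) module_axioms assms(2)])
  show ?thesis using assms(4)
    by (elim tensor_carrierE)
      (simp add: tensor_lift_class assms(1,2) g eval_sum_cong[OF _ assms(3)])
qed

text \<open>Concatenation and componentwise multiplication are both induced by a map \<open>g\<close> of pairs of
  tuples that becomes multilinear in each of its arguments after passing to pure tensors.\<close>

lemma bilinear_classes:
  fixes n m k :: nat and g :: "'c list \<Rightarrow> 'c list \<Rightarrow> 'c list"
  defines "B \<equiv> (\<lambda>X Y. \<Union>u\<in>X. \<Union>v\<in>Y. tensor_class R M k [(c \<otimes> d, g w z). (c, w) \<leftarrow> u, (d, z) \<leftarrow> v])"
  assumes g: "\<And>w z. \<lbrakk>w \<in> tuples M n; z \<in> tuples M m\<rbrakk> \<Longrightarrow> g w z \<in> tuples M k"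
    and g1: "\<And>z. z \<in> tuples M m \<Longrightarrow> multilinear R M (tensor_power R M k) n (\<lambda>w. pure R M (g w z))"
    and g2: "\<And>w. w \<in> tuples M n \<Longrightarrow> multilinear R M (tensor_power R M k) m (\<lambda>z. pure R M (g w z))"
    and X: "X \<in> carrier (tensor_power R M n)" and Y: "Y \<in> carrier (tensor_power R M m)"
  shows "B X Y = tensor_lift (tensor_power R M k)
      (\<lambda>w. tensor_lift (tensor_power R M k) (\<lambda>z. pure R M (g w z)) Y) X"
    and "multilinear R M (tensor_power R M k) n
      (\<lambda>w. tensor_lift (tensor_power R M k) (\<lambda>z. pure R M (g w z)) Y)"
proof -
  let ?T = "tensor_power R M k"
  interpret T: module R ?T by (rule tensor_power_module)
  note T = tensor_power_module[of k]
  have fs: "[(c \<otimes> d, g w z). (d, z) \<leftarrow> v] \<in> formal_sums R M k"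
    if "c \<in> carrier R" "w \<in> tuples M n" "v \<in> formal_sums R M m" for c w v
    using that(3) by (induction rule: formal_sums_induct) (auto simp: that(1,2) g)
  have fs2: "[(c \<otimes> d, g w z). (c, w) \<leftarrow> u, (d, z) \<leftarrow> v] \<in> formal_sums R M k"
    if "u \<in> formal_sums R M n" "v \<in> formal_sums R M m" for u v
    using that(1) by (induction rule: formal_sums_induct) (auto simp: that(2) fs)
  have cl: "pure R M (g w z) \<in> carrier ?T" if "w \<in> tuples M n" "z \<in> tuples M m" for w z
    using that by (simp add: pure_closed g)
  have inner: "tensor_class R M k [(c \<otimes> d, g w z). (d, z) \<leftarrow> v] =
      c \<odot>\<^bsub>?T\<^esub> eval_sum ?T (\<lambda>z. pure R M (g w z)) v"
    if c: "c \<in> carrier R" and w: "w \<in> tuples M n" and v: "v \<in> formal_sums R M m" for c w v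
    using v
  proof (induction rule: formal_sums_induct)
    case Nil
    then show ?case using c by (simp add: tensor_zero[symmetric])
  next
    case (Cons d z v)
    let ?e = "eval_sum ?T (\<lambda>z. pure R M (g w z)) v"
    have e: "?e \<in> carrier ?T"
      by (rule eval_sum_closed[OF T Cons(3) cl[OF w]])
    have "tensor_class R M k [(c \<otimes> d, g w z). (d, z) \<leftarrow> (d, z) # v] =
        tensor_class R M k [(c \<otimes> d, g w z)] \<oplus>\<^bsub>?T\<^esub>
        tensor_class R M k [(c \<otimes> d, g w z). (d, z) \<leftarrow> v]"
      using tensor_add[of "[(c \<otimes> d, g w z)]" k "[(c \<otimes> d, g w z). (d, z) \<leftarrow> v]"]
        fs[OF c w Cons(3)] Cons(1,2) c w g by simp
    also have "tensor_class R M k [(c \<otimes> d, g w z)] = c \<odot>\<^bsub>?T\<^esub> (d \<odot>\<^bsub>?T\<^esub> pure R M (g w z))"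
      using tensor_class_eval_sum[of "[(c \<otimes> d, g w z)]" k] Cons(1,2) c w g cl[OF w Cons(2)]
      by (simp add: T.smult_assoc1)
    finally show ?case
      using Cons(1,2,4) c cl[OF w Cons(2)] e by (simp add: T.smult_r_distr)
  qed
  have outer: "tensor_class R M k [(c \<otimes> d, g w z). (c, w) \<leftarrow> u, (d, z) \<leftarrow> v] =
      eval_sum ?T (\<lambda>w. eval_sum ?T (\<lambda>z. pure R M (g w z)) v) u"
    if u: "u \<in> formal_sums R M n" and v: "v \<in> formal_sums R M m" for u v
    using u
  proof (induction rule: formal_sums_induct)
    case Nil
    then show ?case by (simp add: tensor_zero)
  next
    case (Cons c w u)
    then show ?case
      using tensor_add[OF fs[of c w v] fs2[of u v], symmetric] v inner[of c w v] by simp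
  qed
  obtain u v where uv: "u \<in> formal_sums R M n" "X = tensor_class R M n u"
    "v \<in> formal_sums R M m" "Y = tensor_class R M m v"
    using X Y by (elim tensor_carrierE)
  have lift2: "tensor_lift ?T (\<lambda>z. pure R M (g w z)) Y = eval_sum ?T (\<lambda>z. pure R M (g w z)) v'"
    if "w \<in> tuples M n" "v' \<in> Y" for w v'
    using that uv tensor_lift_class[OF T g2[OF that(1)] uv(3)]
      eval_sum_tensor_eq[OF module_axioms T g2[OF that(1)]] by (simp add: mem_tensor_class)
  have slot: "(\<lambda>x. eval_sum ?T (\<lambda>z. pure R M (g (us @ x # vs) z)) v) \<in> linear_maps R M ?T"
    if "us @ vs \<in> tuples M (n - 1)" "0 < n" for us vs
    by (rule eval_sum_linear[OF module_axioms T uv(3)]) (rule multilinear_slot[OF g1 that])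
  show ml: "multilinear R M ?T n (\<lambda>w. tensor_lift ?T (\<lambda>z. pure R M (g w z)) Y)"
  proof (subst multilinear_cong[OF _ module_axioms])
    show "tensor_lift ?T (\<lambda>z. pure R M (g w z)) Y = eval_sum ?T (\<lambda>z. pure R M (g w z)) v"
      if "w \<in> tuples M n" for w using lift2[OF that, of v] uv tensor_class_self by blast
    show "multilinear R M ?T n (\<lambda>w. eval_sum ?T (\<lambda>z. pure R M (g w z)) v)"
      unfolding multilinear_def using slot cl by (auto intro!: eval_sum_closed[OF T uv(3)])
  qed
  have fsX: "u' \<in> formal_sums R M n" if "u' \<in> X" for u'
    using that uv tensor_eq_formal_sums(2)[OF module_axioms] by (auto simp: mem_tensor_class)
  have fsY: "v' \<in> formal_sums R M m" if "v' \<in> Y" for v'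
    using that uv tensor_eq_formal_sums(2)[OF module_axioms] by (auto simp: mem_tensor_class)
  have "tensor_class R M k [(c \<otimes> d, g w z). (c, w) \<leftarrow> u', (d, z) \<leftarrow> v'] =
      tensor_lift ?T (\<lambda>w. tensor_lift ?T (\<lambda>z. pure R M (g w z)) Y) X"
    if "u' \<in> X" "v' \<in> Y" for u' v'
  proof -
    have "tensor_lift ?T (\<lambda>w. tensor_lift ?T (\<lambda>z. pure R M (g w z)) Y) X =
        eval_sum ?T (\<lambda>w. tensor_lift ?T (\<lambda>z. pure R M (g w z)) Y) u'"
      using that uv tensor_lift_class[OF T ml uv(1)]
        eval_sum_tensor_eq[OF module_axioms T ml] by (simp add: mem_tensor_class)
    also have "\<dots> = eval_sum ?T (\<lambda>w. eval_sum ?T (\<lambda>z. pure R M (g w z)) v') u'"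
      using lift2 that(2) by (intro eval_sum_cong[OF fsX[OF that(1)]]) blast
    finally show ?thesis using outer fsX fsY that by simp
  qed
  then show "B X Y = tensor_lift ?T (\<lambda>w. tensor_lift ?T (\<lambda>z. pure R M (g w z)) Y) X"
    unfolding B_def using uv tensor_class_self
    by (intro Union_const[of u] Union_const[of v]) auto
qed

lemma concat_multilinear:
  "z \<in> tuples M m \<Longrightarrow> multilinear R M (tensor_power R M (n + m)) n (\<lambda>w. pure R M (w @ z))"
  "w \<in> tuples M n \<Longrightarrow> multilinear R M (tensor_power R M (n + m)) m (\<lambda>z. pure R M (w @ z))"
proof -
  assume z: "z \<in> tuples M m"
  show "multilinear R M (tensor_power R M (n + m)) n (\<lambda>w. pure R M (w @ z))"
    unfolding multilinear_def
  proof (intro conjI ballI allI impI)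
    show "pure R M (w @ z) \<in> carrier (tensor_power R M (n + m))" if "w \<in> tuples M n" for w
      using that z by (auto intro!: pure_closed simp: tuples_def)
    show "(\<lambda>x. pure R M ((us @ x # vs) @ z)) \<in> linear_maps R M (tensor_power R M (n + m))"
      if "us @ vs \<in> tuples M (n - 1) \<and> 0 < n" for us vs
      using multilinear_slot[OF pure_multilinear, of us "vs @ z" "n + m"] that z
      by (auto simp: tuples_def)
  qed
next
  assume w: "w \<in> tuples M n"
  show "multilinear R M (tensor_power R M (n + m)) m (\<lambda>z. pure R M (w @ z))"
    unfolding multilinear_def
  proof (intro conjI ballI allI impI)
    show "pure R M (w @ z) \<in> carrier (tensor_power R M (n + m))" if "z \<in> tuples M m" for z
      using that w by (auto intro!: pure_closed simp: tuples_def)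
    show "(\<lambda>x. pure R M (w @ us @ x # vs)) \<in> linear_maps R M (tensor_power R M (n + m))"
      if "us @ vs \<in> tuples M (m - 1) \<and> 0 < m" for us vs
      using multilinear_slot[OF pure_multilinear, of "w @ us" vs "n + m"] that w
      by (auto simp: tuples_def)
  qed
qed

lemma tensor_concat_lift:
  assumes X: "X \<in> carrier (tensor_power R M n)" and Y: "Y \<in> carrier (tensor_power R M m)"
  shows "tensor_concat R M n m X Y = tensor_lift (tensor_power R M (n + m))
      (\<lambda>w. tensor_lift (tensor_power R M (n + m)) (\<lambda>z. pure R M (w @ z)) Y) X"
    and "multilinear R M (tensor_power R M (n + m)) n
      (\<lambda>w. tensor_lift (tensor_power R M (n + m)) (\<lambda>z. pure R M (w @ z)) Y)"
  using bilinear_classes[OF _ concat_multilinear X Y, folded tensor_concat_def]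
  by (auto simp: tuples_def)

lemma tensor_concat_closed:
  assumes X: "X \<in> carrier (tensor_power R M n)" and Y: "Y \<in> carrier (tensor_power R M m)"
  shows "tensor_concat R M n m X Y \<in> carrier (tensor_power R M (n + m))"
  using linear_closed[OF tensor_lift_linear[OF tensor_power_module tensor_concat_lift(2)[OF X Y]] X]
    tensor_concat_lift(1)[OF X Y] by simp

lemma tensor_lift_lift:
  assumes N: "module R N" and P: "module R P" and f: "multilinear R M N n f"
    and g: "g \<in> linear_maps R N P" and X: "X \<in> carrier (tensor_power R M n)"
  shows "g (tensor_lift N f X) = tensor_lift P (\<lambda>w. g (f w)) X"
  using X
  by (elim tensor_carrierE)
     (simp add: tensor_lift_class N P f multilinear_compose[OF g f]
        linear_eval_sum[OF N P g _ multilinear_closed[OF f]])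

lemma tensor_lift_concat:
  assumes N: "module R N" and f: "multilinear R M N (n + m) f"
    and X: "X \<in> carrier (tensor_power R M n)" and Y: "Y \<in> carrier (tensor_power R M m)"
  shows "tensor_lift N f (tensor_concat R M n m X Y) =
    tensor_lift N (\<lambda>w. tensor_lift N (\<lambda>z. f (w @ z)) Y) X"
proof -
  note T = tensor_power_module
  note L = tensor_lift_linear[OF N f]
  have "tensor_lift N f (tensor_concat R M n m X Y) =
      tensor_lift N (\<lambda>w. tensor_lift N f
        (tensor_lift (tensor_power R M (n + m)) (\<lambda>z. pure R M (w @ z)) Y)) X"
    unfolding tensor_concat_lift(1)[OF X Y]
    by (rule tensor_lift_lift[OF T N tensor_concat_lift(2)[OF X Y] L X])
  also have "\<dots> = tensor_lift N (\<lambda>w. tensor_lift N (\<lambda>z. f (w @ z)) Y) X"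
  proof (rule tensor_lift_cong[OF N multilinear_compose[OF L tensor_concat_lift(2)[OF X Y]] _ X])
    fix w assume w: "w \<in> tuples M n"
    have "tensor_lift N f (tensor_lift (tensor_power R M (n + m)) (\<lambda>z. pure R M (w @ z)) Y) =
        tensor_lift N (\<lambda>z. tensor_lift N f (pure R M (w @ z))) Y"
      by (rule tensor_lift_lift[OF T N concat_multilinear(2)[OF w] L Y])
    also have "\<dots> = tensor_lift N (\<lambda>z. f (w @ z)) Y"
      using w by (intro tensor_lift_cong[OF N multilinear_compose[OF L concat_multilinear(2)[OF w]] _ Y]
          tensor_lift_pure[OF N f]) (auto simp: tuples_def)
    finally show "tensor_lift N f (tensor_lift (tensor_power R M (n + m)) (\<lambda>z. pure R M (w @ z)) Y) =
        tensor_lift N (\<lambda>z. f (w @ z)) Y" .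
  qed
  finally show ?thesis .
qed

lemma tensor_concat_linear:
  "Y \<in> carrier (tensor_power R M m) \<Longrightarrow>
    (\<lambda>X. tensor_concat R M n m X Y) \<in>
      linear_maps R (tensor_power R M n) (tensor_power R M (n + m))"
  "X \<in> carrier (tensor_power R M n) \<Longrightarrow>
    (\<lambda>Y. tensor_concat R M n m X Y) \<in>
      linear_maps R (tensor_power R M m) (tensor_power R M (n + m))"
proof -
  note T = tensor_power_module
  let ?T = "tensor_power R M (n + m)"
  assume Y: "Y \<in> carrier (tensor_power R M m)"
  obtain X0 where X0: "X0 \<in> carrier (tensor_power R M n)"
    using tensor_class_closed[OF formal_sums_Nil] by blast
  show "(\<lambda>X. tensor_concat R M n m X Y) \<in> linear_maps R (tensor_power R M n) ?T"
    by (rule linear_cong[THEN iffD2, OF T tensor_concat_lift(1)[OF _ Y]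
          tensor_lift_linear[OF T tensor_concat_lift(2)[OF X0 Y]]])
next
  note T = tensor_power_module
  let ?T = "tensor_power R M (n + m)"
  assume X: "X \<in> carrier (tensor_power R M n)"
  then obtain u where u: "u \<in> formal_sums R M n" "X = tensor_class R M n u"
    by (rule tensor_carrierE)
  have "tensor_concat R M n m X Y =
      eval_sum ?T (\<lambda>w. tensor_lift ?T (\<lambda>z. pure R M (w @ z)) Y) u"
    if "Y \<in> carrier (tensor_power R M m)" for Y
    using tensor_concat_lift[OF X that] tensor_lift_class[OF T _ u(1)] u(2) by simp
  moreover have "(\<lambda>Y. eval_sum ?T (\<lambda>w. tensor_lift ?T (\<lambda>z. pure R M (w @ z)) Y) u)
      \<in> linear_maps R (tensor_power R M m) ?T"
    by (rule eval_sum_linear[OF T T u(1)]) (rule tensor_lift_linear[OF T concat_multilinear(2)])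
  ultimately show "(\<lambda>Y. tensor_concat R M n m X Y) \<in> linear_maps R (tensor_power R M m) ?T"
    by (rule linear_cong[THEN iffD2, OF T])
qed

end

lemma (in assoc_algebra) mult_linear:
  "c \<in> carrier A \<Longrightarrow> (\<lambda>x. c \<otimes>\<^bsub>A\<^esub> x) \<in> linear_maps R A A"
  "c \<in> carrier A \<Longrightarrow> (\<lambda>x. x \<otimes>\<^bsub>A\<^esub> c) \<in> linear_maps R A A"
  by (auto intro!: linear_mapsI simp: l_distr r_distr smult_mult_left smult_mult_right)

lemma (in assoc_algebra) tensor_mult_lift:
  assumes X: "X \<in> carrier (tensor_power R A n)" and Y: "Y \<in> carrier (tensor_power R A n)"
  shows "X \<otimes>\<^bsub>tensor_power R A n\<^esub> Y = tensor_lift (tensor_power R A n)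
      (\<lambda>w. tensor_lift (tensor_power R A n) (\<lambda>z. pure R A (map2 (mult A) w z)) Y) X"
    and "multilinear R A (tensor_power R A n) n
      (\<lambda>w. tensor_lift (tensor_power R A n) (\<lambda>z. pure R A (map2 (mult A) w z)) Y)"
    and "w \<in> tuples A n \<Longrightarrow>
      multilinear R A (tensor_power R A n) n (\<lambda>z. pure R A (map2 (mult A) w z))"
proof -
  have cl: "set (map2 (mult A) w z) \<subseteq> carrier A" if "set w \<subseteq> carrier A" "set z \<subseteq> carrier A" for w z
    using that by (induction w z rule: list_induct2') auto
  have g: "map2 (mult A) w z \<in> tuples A n" if "w \<in> tuples A n" "z \<in> tuples A n" for w z
    using that cl unfolding tuples_def by simp
  have slot: "(\<lambda>x. pure R A (map2 (mult A) us us' @ h x # map2 (mult A) vs vs'))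
      \<in> linear_maps R A (tensor_power R A n)"
    if "length us + length vs = n - 1" "0 < n" "length us = length us'" "length vs = length vs'"
      "set us \<subseteq> carrier A" "set us' \<subseteq> carrier A" "set vs \<subseteq> carrier A" "set vs' \<subseteq> carrier A"
      "h \<in> linear_maps R A A" for us vs us' vs' h
  proof -
    have "map2 (mult A) us us' @ map2 (mult A) vs vs' \<in> tuples A (n - 1)"
      using that cl unfolding tuples_def by simp
    from linear_compose[OF multilinear_slot[OF pure_multilinear this that(2)] that(9)]
    show ?thesis .
  qed
  have split: "\<exists>us' c vs'. z = us' @ c # vs' \<and> length us = length us' \<and> length vs = length vs' \<and>
      c \<in> carrier A \<and> set us' \<subseteq> carrier A \<and> set vs' \<subseteq> carrier A"
    if "us @ vs \<in> tuples A (n - 1)" "0 < n" "z \<in> tuples A n" for us vs z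
  proof -
    have len: "length us < n" "length z = n" "n = Suc (length us + length vs)"
      using that(2) tuples_length[OF that(1)] tuples_length[OF that(3)] by auto
    then have "z = take (length us) z @ z ! length us # drop (Suc (length us)) z"
      by (intro id_take_nth_drop) auto
    moreover have "z ! length us \<in> carrier A"
      using that(3) len by (intro tuples_nth[of z A n]) auto
    ultimately show ?thesis using that(3) len
      by (intro exI[of _ "take (length us) z"] exI[of _ "z ! length us"]
          exI[of _ "drop (Suc (length us)) z"])
         (auto simp: tuples_def dest: in_set_takeD in_set_dropD)
  qed
  have m1: "multilinear R A (tensor_power R A n) n (\<lambda>w. pure R A (map2 (mult A) w z))"
    if z: "z \<in> tuples A n" for z
    unfolding multilinear_def
  proof (intro conjI ballI allI impI)
    show "pure R A (map2 (mult A) w z) \<in> carrier (tensor_power R A n)" if "w \<in> tuples A n" for w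
      using pure_closed g that z by blast
    fix us vs assume uv: "us @ vs \<in> tuples A (n - 1) \<and> 0 < n"
    then obtain us' c vs' where s: "z = us' @ c # vs'" "length us = length us'"
      "length vs = length vs'" "c \<in> carrier A" "set us' \<subseteq> carrier A" "set vs' \<subseteq> carrier A"
      using split z by blast
    show "(\<lambda>x. pure R A (map2 (mult A) (us @ x # vs) z)) \<in> linear_maps R A (tensor_power R A n)"
      using slot[OF _ _ s(2,3) _ s(5) _ s(6) mult_linear(2)[OF s(4)]] uv s(1)
      by (simp add: tuples_def s(2,3))
  qed
  have m2: "multilinear R A (tensor_power R A n) n (\<lambda>z. pure R A (map2 (mult A) w z))"
    if w: "w \<in> tuples A n" for w
    unfolding multilinear_def
  proof (intro conjI ballI allI impI)
    show "pure R A (map2 (mult A) w z) \<in> carrier (tensor_power R A n)" if "z \<in> tuples A n" for z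
      using pure_closed g that w by blast
    fix us vs assume uv: "us @ vs \<in> tuples A (n - 1) \<and> 0 < n"
    then obtain us' c vs' where s: "w = us' @ c # vs'" "length us = length us'"
      "length vs = length vs'" "c \<in> carrier A" "set us' \<subseteq> carrier A" "set vs' \<subseteq> carrier A"
      using split w by blast
    show "(\<lambda>x. pure R A (map2 (mult A) w (us @ x # vs))) \<in> linear_maps R A (tensor_power R A n)"
      using slot[OF _ _ s(2,3)[symmetric] s(5) _ s(6) _ mult_linear(1)[OF s(4)]] uv s(1)
      by (simp add: tuples_def s(2,3))
  qed
  have eq: "X \<otimes>\<^bsub>tensor_power R A n\<^esub> Y = (\<Union>u\<in>X. \<Union>v\<in>Y. tensor_class R A n
                [(c \<otimes>\<^bsub>R\<^esub> d, map2 (mult A) w z). (c, w) \<leftarrow> u, (d, z) \<leftarrow> v])"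
    by (simp add: tensor_power_def)
  show "X \<otimes>\<^bsub>tensor_power R A n\<^esub> Y = tensor_lift (tensor_power R A n)
      (\<lambda>w. tensor_lift (tensor_power R A n) (\<lambda>z. pure R A (map2 (mult A) w z)) Y) X"
    unfolding eq by (rule bilinear_classes(1)[OF g m1 m2 X Y])
  show "multilinear R A (tensor_power R A n) n
      (\<lambda>w. tensor_lift (tensor_power R A n) (\<lambda>z. pure R A (map2 (mult A) w z)) Y)"
    by (rule bilinear_classes(2)[OF g m1 m2 X Y])
  show "w \<in> tuples A n \<Longrightarrow>
      multilinear R A (tensor_power R A n) n (\<lambda>z. pure R A (map2 (mult A) w z))"
    by (rule m2)
qed

section \<open>Sweedler calculus\<close>

context hopf_algebra
begin

abbreviation T :: "nat \<Rightarrow> ('k, ('k, 'h) tensor) module" where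
  "T \<equiv> tensor_power R H"

abbreviation K :: "('k, 'k) module" where
  "K \<equiv> base_algebra R"

abbreviation S :: "'h \<Rightarrow> 'h" where
  "S \<equiv> antipode H"

abbreviation hmult :: "'h \<Rightarrow> 'h \<Rightarrow> 'h" (infixl "\<cdot>" 70) where
  "x \<cdot> y \<equiv> x \<otimes>\<^bsub>H\<^esub> y"

abbreviation eps :: "'h \<Rightarrow> 'k" where
  "eps \<equiv> counit H"

lemma base_simps [simp]:
  "carrier K = carrier R" "mult K = mult R" "one K = one R" "zero K = zero R" "add K = add R"
  "smult K = mult R"
  by (simp_all add: base_algebra_def)

lemma base_module [simp]: "module R K"
proof (rule moduleI)
  show "abelian_group K"
    by (rule abelian_groupI) (auto simp: R.a_ac intro: R.l_neg bexI[of _ "\<ominus>\<^bsub>R\<^esub> _"])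
qed (auto simp: R.is_cring R.l_distr R.r_distr R.m_assoc)

lemma hopf_module [simp]: "module R H" ..

lemma tensor_module [simp]: "module R (T n)"
  by (rule tensor_power_module)

section \<open>Linear maps out of the Hopf algebra\<close>

definition bilinear :: "('k, 'b, 'n) module_scheme \<Rightarrow> ('h \<Rightarrow> 'h \<Rightarrow> 'b) \<Rightarrow> bool" where
  "bilinear N B \<longleftrightarrow> (\<forall>x\<in>carrier H. (\<lambda>y. B x y) \<in> linear_maps R H N) \<and>
     (\<forall>y\<in>carrier H. (\<lambda>x. B x y) \<in> linear_maps R H N)"

lemma bilinearI:
  assumes "\<And>x. x \<in> carrier H \<Longrightarrow> (\<lambda>y. B x y) \<in> linear_maps R H N"
    and "\<And>y. y \<in> carrier H \<Longrightarrow> (\<lambda>x. B x y) \<in> linear_maps R H N"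
  shows "bilinear N B"
  using assms by (simp add: bilinear_def)

lemma bilinear_left: "bilinear N B \<Longrightarrow> y \<in> carrier H \<Longrightarrow> (\<lambda>x. B x y) \<in> linear_maps R H N"
  and bilinear_right: "bilinear N B \<Longrightarrow> x \<in> carrier H \<Longrightarrow> (\<lambda>y. B x y) \<in> linear_maps R H N"
  by (simp_all add: bilinear_def)

lemma bilinear_closed:
  "bilinear N B \<Longrightarrow> x \<in> carrier H \<Longrightarrow> y \<in> carrier H \<Longrightarrow> B x y \<in> carrier N"
  using linear_closed[OF bilinear_left] .

lemma tuples_2: "w \<in> tuples H 2 \<longleftrightarrow> (\<exists>x y. w = [x, y] \<and> x \<in> carrier H \<and> y \<in> carrier H)"
  by (auto simp: numeral_2_eq_2 tuples_Suc)

lemma bilinear_multilinear: "bilinear N B \<Longrightarrow> multilinear R H N 2 (\<lambda>w. B (w ! 0) (w ! 1))"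
  unfolding numeral_2_eq_2
  by (auto simp: multilinear_Suc multilinear_0 tuples_Suc bilinear_left bilinear_right bilinear_closed)

lemma bilinear_compose:
  assumes "bilinear N B" "f \<in> linear_maps R M H" "y \<in> carrier H"
  shows "(\<lambda>x. B (f x) y) \<in> linear_maps R M N" "(\<lambda>x. B y (f x)) \<in> linear_maps R M N"
  by (rule linear_compose[OF bilinear_left[OF assms(1,3)] assms(2)])
     (rule linear_compose[OF bilinear_right[OF assms(1,3)] assms(2)])

definition sweedler_rep :: "'h \<Rightarrow> ('k \<times> 'h list) list" where
  "sweedler_rep a = (SOME u. u \<in> formal_sums R H 2 \<and> comult H a = tensor_class R H 2 u)"

text \<open>
  \<open>sw N a B\<close> is \<open>B a\<^sup>(\<^sup>1\<^sup>) a\<^sup>(\<^sup>2\<^sup>)\<close>.  Evaluating on one chosen representative of \<open>\<Delta> a\<close> makes it a plain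
  finite sum for every \<open>B\<close>, through which linear maps and further sums can be moved; bilinearity of
  \<open>B\<close> is what makes the value independent of the representative.
\<close>

definition sw :: "('k, 'b, 'n) module_scheme \<Rightarrow> 'h \<Rightarrow> ('h \<Rightarrow> 'h \<Rightarrow> 'b) \<Rightarrow> 'b" where
  "sw N a B = eval_sum N (\<lambda>w. B (w ! 0) (w ! 1)) (sweedler_rep a)"

lemma comult_linear: "comult H \<in> linear_maps R H (T 2)"
  using comult_hom by (simp add: algebra_homs_def)

lemma sweedler_rep:
  assumes "a \<in> carrier H"
  shows "sweedler_rep a \<in> formal_sums R H 2" "comult H a = tensor_class R H 2 (sweedler_rep a)"
proof -
  have "\<exists>u. u \<in> formal_sums R H 2 \<and> comult H a = tensor_class R H 2 u"
    using linear_closed[OF comult_linear assms] by (elim tensor_carrierE) blast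
  from someI_ex[OF this] show "sweedler_rep a \<in> formal_sums R H 2"
    "comult H a = tensor_class R H 2 (sweedler_rep a)"
    unfolding sweedler_rep_def by auto
qed

lemma sw_lift:
  assumes "module R N" "bilinear N B" "a \<in> carrier H"
  shows "tensor_lift N (\<lambda>w. B (w ! 0) (w ! 1)) (comult H a) = sw N a B"
  using tensor_lift_class[OF assms(1) bilinear_multilinear[OF assms(2)] sweedler_rep(1)[OF assms(3)]]
  by (simp add: sw_def sweedler_rep(2)[OF assms(3)])

lemma sw_closed [intro]:
  assumes "module R N" "a \<in> carrier H"
    "\<And>x y. \<lbrakk>x \<in> carrier H; y \<in> carrier H\<rbrakk> \<Longrightarrow> B x y \<in> carrier N"
  shows "sw N a B \<in> carrier N"
  unfolding sw_def by (rule eval_sum_closed[OF assms(1) sweedler_rep(1)[OF assms(2)]])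
    (auto simp: tuples_2 assms(3))

lemma sw_cong:
  assumes "a = b" "b \<in> carrier H"
    "\<And>x y. \<lbrakk>x \<in> carrier H; y \<in> carrier H\<rbrakk> \<Longrightarrow> B x y = B' x y"
  shows "sw N a B = sw N b B'"
  unfolding sw_def assms(1) by (rule eval_sum_cong[OF sweedler_rep(1)[OF assms(2)]])
    (auto simp: tuples_2 assms(3))

lemma sw_apply:
  assumes "module R M" "module R N" "g \<in> linear_maps R M N" "a \<in> carrier H"
    "\<And>x y. \<lbrakk>x \<in> carrier H; y \<in> carrier H\<rbrakk> \<Longrightarrow> B x y \<in> carrier M"
  shows "g (sw M a B) = sw N a (\<lambda>x y. g (B x y))"
  unfolding sw_def by (rule linear_eval_sum[OF assms(1-3) sweedler_rep(1)[OF assms(4)]])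
    (auto simp: tuples_2 assms(5))

lemma sw_scale:
  assumes "module R N" "c \<in> carrier R" "a \<in> carrier H"
    "\<And>x y. \<lbrakk>x \<in> carrier H; y \<in> carrier H\<rbrakk> \<Longrightarrow> B x y \<in> carrier N"
  shows "c \<odot>\<^bsub>N\<^esub> sw N a B = sw N a (\<lambda>x y. c \<odot>\<^bsub>N\<^esub> B x y)"
  by (rule sw_apply[OF assms(1,1) _ assms(3,4)]) (rule linear_scale[OF assms(1) linear_ident assms(2)])

lemma sw_swap:
  assumes "module R N" "a \<in> carrier H" "b \<in> carrier H"
    "\<And>x y z w. \<lbrakk>x \<in> carrier H; y \<in> carrier H; z \<in> carrier H; w \<in> carrier H\<rbrakk> \<Longrightarrow> F x y z w \<in> carrier N"
  shows "sw N a (\<lambda>x y. sw N b (\<lambda>z w. F x y z w)) = sw N b (\<lambda>z w. sw N a (\<lambda>x y. F x y z w))"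
  unfolding sw_def
  by (rule eval_sum_swap[OF assms(1) sweedler_rep(1)[OF assms(2)] sweedler_rep(1)[OF assms(3)]])
    (auto simp: tuples_2 assms(4))

lemma linear_sw_body:
  assumes "module R M" "module R N" "a \<in> carrier H"
    "\<And>u v. \<lbrakk>u \<in> carrier H; v \<in> carrier H\<rbrakk> \<Longrightarrow> (\<lambda>x. B x u v) \<in> linear_maps R M N"
  shows "(\<lambda>x. sw N a (\<lambda>u v. B x u v)) \<in> linear_maps R M N"
  unfolding sw_def by (rule eval_sum_linear[OF assms(1,2) sweedler_rep(1)[OF assms(3)]])
    (auto simp: tuples_2 assms(4))

lemma linear_sw:
  assumes "module R N" "bilinear N B" "module R M" "f \<in> linear_maps R M H"
  shows "(\<lambda>x. sw N (f x) (\<lambda>u v. B u v)) \<in> linear_maps R M N"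
proof -
  have "(\<lambda>a. sw N a B) \<in> linear_maps R H N"
  proof (rule linear_cong[THEN iffD1, OF hopf_module])
    show "(\<lambda>a. tensor_lift N (\<lambda>w. B (w ! 0) (w ! 1)) (comult H a)) \<in> linear_maps R H N"
      by (rule linear_compose[OF tensor_lift_linear[OF assms(1) bilinear_multilinear[OF assms(2)]]])
         (rule comult_linear)
  qed (rule sw_lift[OF assms(1,2)])
  from linear_compose[OF this assms(4)] show ?thesis .
qed

lemma pure_linear:
  assumes "f \<in> linear_maps R M H" "set us \<subseteq> carrier H" "set vs \<subseteq> carrier H"
    "n = Suc (length us + length vs)"
  shows "(\<lambda>x. pure R H (us @ f x # vs)) \<in> linear_maps R M (T n)"
  using linear_compose[OF multilinear_slot[OF pure_multilinear, of us vs n] assms(1)] assms(2-4)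
  by (auto simp: tuples_def)

lemma pure_linear_0:
  assumes "f \<in> linear_maps R M H" "vs \<in> tuples H n"
  shows "(\<lambda>x. pure R H (f x # vs)) \<in> linear_maps R M (T (Suc n))"
  using pure_linear[OF assms(1), of "[]" vs] assms(2) by (simp add: tuples_def)

lemma pure_linear_1:
  assumes "f \<in> linear_maps R M H" "a \<in> carrier H" "vs \<in> tuples H n"
  shows "(\<lambda>x. pure R H (a # f x # vs)) \<in> linear_maps R M (T (Suc (Suc n)))"
  using pure_linear[OF assms(1), of "[a]" vs] assms(2,3) by (simp add: tuples_def)

lemma linear_coeff:
  assumes "module R N" "f \<in> linear_maps R M K" "y \<in> carrier N"
  shows "(\<lambda>x. f x \<odot>\<^bsub>N\<^esub> y) \<in> linear_maps R M N"
proof -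
  interpret N: module R N by fact
  show ?thesis
    using linear_closed[OF assms(2)] linear_add[OF assms(2)] linear_smult[OF assms(2)] assms(3)
    by (intro linear_mapsI) (auto simp: N.smult_l_distr N.smult_assoc1)
qed

lemma linear_mult_left:
  assumes "f \<in> linear_maps R M H" "c \<in> carrier H"
  shows "(\<lambda>x. c \<cdot> f x) \<in> linear_maps R M H"
  by (rule linear_compose[OF mult_linear(1)[OF assms(2)] assms(1)])

lemma linear_mult_right:
  assumes "f \<in> linear_maps R M H" "c \<in> carrier H"
  shows "(\<lambda>x. f x \<cdot> c) \<in> linear_maps R M H"
  by (rule linear_compose[OF mult_linear(2)[OF assms(2)] assms(1)])

lemma linear_base_mult_left:
  assumes "f \<in> linear_maps R M K" "c \<in> carrier R"
  shows "(\<lambda>x. c \<otimes> f x) \<in> linear_maps R M K"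
  using linear_scale[OF base_module assms] by simp

lemma linear_base_mult_right:
  assumes "f \<in> linear_maps R M K" "c \<in> carrier R"
  shows "(\<lambda>x. f x \<otimes> c) \<in> linear_maps R M K"
  using linear_coeff[OF base_module assms(1)] assms(2) by simp

lemma linear_antipode:
  "f \<in> linear_maps R M H \<Longrightarrow> (\<lambda>x. S (f x)) \<in> linear_maps R M H"
  by (rule linear_compose[OF antipode_linear])

lemma antipode_closed [simp, intro]: "x \<in> carrier H \<Longrightarrow> S x \<in> carrier H"
  by (rule linear_closed[OF antipode_linear])

lemma character_linear:
  assumes "\<chi> \<in> characters R H" "f \<in> linear_maps R M H"
  shows "(\<lambda>x. \<chi> (f x)) \<in> linear_maps R M K"
  using assms(1) by (intro linear_compose[OF _ assms(2)]) (simp add: characters_def algebra_homs_def)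

lemma character_simps:
  assumes "\<chi> \<in> characters R H"
  shows "x \<in> carrier H \<Longrightarrow> \<chi> x \<in> carrier R"
    and "\<lbrakk>x \<in> carrier H; y \<in> carrier H\<rbrakk> \<Longrightarrow> \<chi> (x \<cdot> y) = \<chi> x \<otimes> \<chi> y"
    and "\<chi> \<one>\<^bsub>H\<^esub> = \<one>"
    and "\<lbrakk>c \<in> carrier R; x \<in> carrier H\<rbrakk> \<Longrightarrow> \<chi> (c \<odot>\<^bsub>H\<^esub> x) = c \<otimes> \<chi> x"
proof -
  have "\<chi> \<in> ring_hom H K" "\<chi> \<in> linear_maps R H K"
    using assms by (auto simp: characters_def algebra_homs_def)
  then show "x \<in> carrier H \<Longrightarrow> \<chi> x \<in> carrier R"
    "\<lbrakk>x \<in> carrier H; y \<in> carrier H\<rbrakk> \<Longrightarrow> \<chi> (x \<cdot> y) = \<chi> x \<otimes> \<chi> y"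
    "\<chi> \<one>\<^bsub>H\<^esub> = \<one>"
    "\<lbrakk>c \<in> carrier R; x \<in> carrier H\<rbrakk> \<Longrightarrow> \<chi> (c \<odot>\<^bsub>H\<^esub> x) = c \<otimes> \<chi> x"
    using linear_closed[of \<chi> R H K] linear_smult[of \<chi> R H K]
    by (auto dest: ring_hom_mult ring_hom_one)
qed

lemmas counit_linear = character_linear[OF counit_hom]
lemmas counit_simps [simp] = character_simps[OF counit_hom]

lemmas linear_intros =
  linear_ident linear_mult_left linear_mult_right linear_base_mult_left linear_base_mult_right
  linear_antipode counit_linear linear_scale linear_coeff pure_linear_0 pure_linear_1
  linear_sw linear_sw_body bilinearI

section \<open>The Hopf algebra axioms\<close>

lemma smult_ring [simp]:
  "\<lbrakk>c \<in> carrier R; x \<in> carrier H; y \<in> carrier H\<rbrakk> \<Longrightarrow> (c \<odot>\<^bsub>H\<^esub> x) \<cdot> y = c \<odot>\<^bsub>H\<^esub> (x \<cdot> y)"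
  "\<lbrakk>c \<in> carrier R; x \<in> carrier H; y \<in> carrier H\<rbrakk> \<Longrightarrow> x \<cdot> (c \<odot>\<^bsub>H\<^esub> y) = c \<odot>\<^bsub>H\<^esub> (x \<cdot> y)"
  by (rule smult_mult_left smult_mult_right; assumption)+

lemma sw_eq:
  assumes "tensor_lift H (\<lambda>w. B (w ! 0) (w ! 1)) (comult H a) = v" "bilinear H B"
    "module R N" "f \<in> linear_maps R H N" "a \<in> carrier H"
  shows "sw N a (\<lambda>x y. f (B x y)) = f v"
proof -
  have "sw N a (\<lambda>x y. f (B x y)) = f (sw H a B)"
    by (rule sw_apply[symmetric]) (auto simp: assms bilinear_closed[OF assms(2)])
  then show ?thesis using sw_lift[OF hopf_module assms(2,5)] assms(1) by simp
qed

lemma sw_counit_left: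
  assumes "module R N" "f \<in> linear_maps R H N" "a \<in> carrier H"
  shows "sw N a (\<lambda>x y. eps x \<odot>\<^bsub>N\<^esub> f y) = f a"
proof -
  have "sw N a (\<lambda>x y. f (eps x \<odot>\<^bsub>H\<^esub> y)) = f a"
    by (rule sw_eq[OF counit_left[OF assms(3)] _ assms]) (auto intro!: linear_intros)
  then show ?thesis by (simp add: linear_smult[OF assms(2)] assms(3) cong: sw_cong)
qed

lemma sw_counit_right:
  assumes "module R N" "f \<in> linear_maps R H N" "a \<in> carrier H"
  shows "sw N a (\<lambda>x y. eps y \<odot>\<^bsub>N\<^esub> f x) = f a"
proof -
  have "sw N a (\<lambda>x y. f (eps y \<odot>\<^bsub>H\<^esub> x)) = f a"
    by (rule sw_eq[OF counit_right[OF assms(3)] _ assms]) (auto intro!: linear_intros)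
  then show ?thesis by (simp add: linear_smult[OF assms(2)] assms(3) cong: sw_cong)
qed

lemma sw_antipode_left:
  assumes "module R N" "f \<in> linear_maps R H N" "a \<in> carrier H"
  shows "sw N a (\<lambda>x y. f (S x \<cdot> y)) = eps a \<odot>\<^bsub>N\<^esub> f \<one>\<^bsub>H\<^esub>"
proof -
  have "sw N a (\<lambda>x y. f (S x \<cdot> y)) = f (eps a \<odot>\<^bsub>H\<^esub> \<one>\<^bsub>H\<^esub>)"
    by (rule sw_eq[OF antipode_left[OF assms(3), unfolded convolution_def] _ assms])
       (auto intro!: linear_intros)
  then show ?thesis by (simp add: assms linear_smult[OF assms(2)])
qed

lemma sw_antipode_right:
  assumes "module R N" "f \<in> linear_maps R H N" "a \<in> carrier H"
  shows "sw N a (\<lambda>x y. f (x \<cdot> S y)) = eps a \<odot>\<^bsub>N\<^esub> f \<one>\<^bsub>H\<^esub>"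
proof -
  have "sw N a (\<lambda>x y. f (x \<cdot> S y)) = f (eps a \<odot>\<^bsub>H\<^esub> \<one>\<^bsub>H\<^esub>)"
    by (rule sw_eq[OF antipode_right[OF assms(3), unfolded convolution_def] _ assms])
       (auto intro!: linear_intros)
  then show ?thesis by (simp add: assms linear_smult[OF assms(2)])
qed

lemma sw_pure:
  assumes "module R N" "bilinear N B" "a \<in> carrier H" "comult H a = pure R H [x, y]"
    "x \<in> carrier H" "y \<in> carrier H"
  shows "sw N a B = B x y"
  using sw_lift[OF assms(1-3)]
    tensor_lift_pure[OF assms(1) bilinear_multilinear[OF assms(2)], of "[x, y]"] assms(4-6)
  by simp

lemma sw_grouplike:
  assumes "module R N" "bilinear N B" "grouplike R H a"
  shows "sw N a B = B a a"
  using sw_pure[OF assms(1,2)] assms(3) unfolding grouplike_def by blast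

lemma sw_one:
  assumes "module R N" "bilinear N B"
  shows "sw N \<one>\<^bsub>H\<^esub> B = B \<one>\<^bsub>H\<^esub> \<one>\<^bsub>H\<^esub>"
proof (rule sw_pure[OF assms])
  have "comult H \<one>\<^bsub>H\<^esub> = \<one>\<^bsub>T 2\<^esub>"
    using comult_hom ring_hom_one by (auto simp: algebra_homs_def)
  then show "comult H \<one>\<^bsub>H\<^esub> = pure R H [\<one>\<^bsub>H\<^esub>, \<one>\<^bsub>H\<^esub>]"
    by (simp add: tensor_power_def numeral_2_eq_2)
qed auto

lemma sw_lift_lift:
  assumes N: "module R N" and f: "multilinear R H N n f"
    and a: "a \<in> carrier H" and g: "\<And>x y. \<lbrakk>x \<in> carrier H; y \<in> carrier H\<rbrakk> \<Longrightarrow> g x y \<in> carrier (T n)"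
  shows "tensor_lift N f (sw (T n) a g) = sw N a (\<lambda>x y. tensor_lift N f (g x y))"
  by (rule sw_apply[OF tensor_module N tensor_lift_linear[OF N f] a g])

text \<open>\<open>\<Delta>(a b) = \<Delta>(a) \<Delta>(b)\<close>, where the product in \<open>H \<otimes> H\<close> is unfolded into a double sum of
  componentwise products.\<close>

lemma sw_mult:
  assumes N: "module R N" and B: "bilinear N B" and a: "a \<in> carrier H" and b: "b \<in> carrier H"
  shows "sw N (a \<cdot> b) B =
    sw N a (\<lambda>x y. sw N b (\<lambda>z w. B (x \<cdot> z) (y \<cdot> w)))"
proof -
  let ?f = "\<lambda>w. B (w ! 0) (w ! 1)"
  let ?p = "\<lambda>w z. pure R H (map2 (mult H) w z)"
  let ?G = "\<lambda>w. tensor_lift (T 2) (?p w) (comult H b)"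
  have ab: "comult H a \<in> carrier (T 2)" "comult H b \<in> carrier (T 2)"
    using linear_closed[OF comult_linear] a b by auto
  note f = bilinear_multilinear[OF B]
  note L = tensor_lift_linear[OF N f]
  have inner: "tensor_lift N ?f (?G w) = sw N b (\<lambda>z w'. B (w ! 0 \<cdot> z) (w ! 1 \<cdot> w'))"
    if w: "w \<in> tuples H 2" for w
  proof -
    have bw: "bilinear N (\<lambda>z w'. B (w ! 0 \<cdot> z) (w ! 1 \<cdot> w'))"
      using tuples_nth[OF w, of 0] tuples_nth[OF w, of 1]
      by (auto intro!: bilinear_compose[OF B] linear_intros)
    have "tensor_lift N ?f (?G w) = tensor_lift N (\<lambda>z. tensor_lift N ?f (?p w z)) (comult H b)"
      by (rule tensor_lift_lift[OF tensor_module N tensor_mult_lift(3)[OF ab(1,2) w] L ab(2)])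
    also have "\<dots> = tensor_lift N (\<lambda>z. B (w ! 0 \<cdot> z ! 0) (w ! 1 \<cdot> z ! 1)) (comult H b)"
      using w tensor_lift_pure[OF N f]
      by (intro tensor_lift_cong[OF N multilinear_compose[OF L tensor_mult_lift(3)[OF ab(1,2) w]] _ ab(2)])
         (auto simp: tuples_2)
    also have "\<dots> = sw N b (\<lambda>z w'. B (w ! 0 \<cdot> z) (w ! 1 \<cdot> w'))"
      by (rule sw_lift[OF N bw b])
    finally show ?thesis .
  qed
  have bo: "bilinear N (\<lambda>x y. sw N b (\<lambda>z w. B (x \<cdot> z) (y \<cdot> w)))"
    using N b by (auto intro!: bilinear_compose[OF B] linear_intros)
  have "comult H (a \<cdot> b) = comult H a \<otimes>\<^bsub>T 2\<^esub> comult H b"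
    using comult_hom ring_hom_mult a b by (fastforce simp: algebra_homs_def)
  then have "sw N (a \<cdot> b) B = tensor_lift N ?f (tensor_lift (T 2) ?G (comult H a))"
    using sw_lift[OF N B m_closed[OF a b]] tensor_mult_lift(1)[OF ab] by simp
  also have "\<dots> = tensor_lift N (\<lambda>w. tensor_lift N ?f (?G w)) (comult H a)"
    by (rule tensor_lift_lift[OF tensor_module N tensor_mult_lift(2)[OF ab] L ab(1)])
  also have "\<dots> = tensor_lift N (\<lambda>w. sw N b (\<lambda>z w'. B (w ! 0 \<cdot> z) (w ! 1 \<cdot> w'))) (comult H a)"
    by (rule tensor_lift_cong[OF N multilinear_compose[OF L tensor_mult_lift(2)[OF ab]] inner ab(1)])
  also have "\<dots> = sw N a (\<lambda>x y. sw N b (\<lambda>z w. B (x \<cdot> z) (y \<cdot> w)))"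
    by (rule sw_lift[OF N bo a])
  finally show ?thesis .
qed

definition trilinear :: "('k, 'b, 'n) module_scheme \<Rightarrow> ('h \<Rightarrow> 'h \<Rightarrow> 'h \<Rightarrow> 'b) \<Rightarrow> bool" where
  "trilinear N F \<longleftrightarrow>
     (\<forall>x\<in>carrier H. \<forall>y\<in>carrier H. (\<lambda>z. F x y z) \<in> linear_maps R H N) \<and>
     (\<forall>x\<in>carrier H. \<forall>z\<in>carrier H. (\<lambda>y. F x y z) \<in> linear_maps R H N) \<and>
     (\<forall>y\<in>carrier H. \<forall>z\<in>carrier H. (\<lambda>x. F x y z) \<in> linear_maps R H N)"

lemma trilinear_multilinear:
  "trilinear N F \<Longrightarrow> multilinear R H N 3 (\<lambda>w. F (w ! 0) (w ! 1) (w ! 2))"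
  unfolding numeral_3_eq_3
  by (auto simp: multilinear_Suc multilinear_0 tuples_Suc trilinear_def intro: linear_closed)

lemma comult3_multilinear:
  "bilinear (T 3) (\<lambda>x y. tensor_concat R H 2 1 (comult H x) (pure R H [y]))"
  "bilinear (T 3) (\<lambda>x y. tensor_concat R H 1 2 (pure R H [x]) (comult H y))"
proof -
  have p: "pure R H [y] \<in> carrier (T 1)" if "y \<in> carrier H" for y
    using that by (intro pure_closed) simp
  have pl: "(\<lambda>y. pure R H [y]) \<in> linear_maps R H (T 1)"
    using pure_linear_0[OF linear_ident, of "[]" 0] by simp
  have t: "T (2 + 1) = T 3" "T (1 + 2) = T 3" by (simp_all add: numeral_3_eq_3)
  note cl = linear_closed[OF comult_linear]
  show "bilinear (T 3) (\<lambda>x y. tensor_concat R H 2 1 (comult H x) (pure R H [y]))"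
  proof (rule bilinearI)
    show "(\<lambda>y. tensor_concat R H 2 1 (comult H x) (pure R H [y])) \<in> linear_maps R H (T 3)"
      if x: "x \<in> carrier H" for x
      using linear_compose[OF tensor_concat_linear(2)[OF cl[OF x]] pl] by (simp only: t)
    show "(\<lambda>x. tensor_concat R H 2 1 (comult H x) (pure R H [y])) \<in> linear_maps R H (T 3)"
      if y: "y \<in> carrier H" for y
      using linear_compose[OF tensor_concat_linear(1)[OF p[OF y]] comult_linear] by (simp only: t)
  qed
  show "bilinear (T 3) (\<lambda>x y. tensor_concat R H 1 2 (pure R H [x]) (comult H y))"
  proof (rule bilinearI)
    show "(\<lambda>y. tensor_concat R H 1 2 (pure R H [x]) (comult H y)) \<in> linear_maps R H (T 3)"
      if x: "x \<in> carrier H" for x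
      using linear_compose[OF tensor_concat_linear(2)[OF p[OF x]] comult_linear] by (simp only: t)
    show "(\<lambda>x. tensor_concat R H 1 2 (pure R H [x]) (comult H y)) \<in> linear_maps R H (T 3)"
      if y: "y \<in> carrier H" for y
      using linear_compose[OF tensor_concat_linear(1)[OF cl[OF y]] pl] by (simp only: t)
  qed
qed

lemma comult3_sw:
  "a \<in> carrier H \<Longrightarrow>
    comult3 R H a = sw (T 3) a (\<lambda>x y. tensor_concat R H 2 1 (comult H x) (pure R H [y]))"
  unfolding comult3_def by (rule sw_lift[OF tensor_module comult3_multilinear(1)])

lemma lift_comult3:
  assumes N: "module R N" and F: "trilinear N F" and a: "a \<in> carrier H"
  shows "tensor_lift N (\<lambda>w. F (w ! 0) (w ! 1) (w ! 2)) (comult3 R H a) =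
    sw N a (\<lambda>r z. sw N r (\<lambda>x y. F x y z))"
proof -
  let ?f = "\<lambda>w. F (w ! 0) (w ! 1) (w ! 2)"
  have f: "multilinear R H N (2 + 1) ?f" using trilinear_multilinear[OF F] by simp
  have "tensor_lift N ?f (tensor_concat R H 2 1 (comult H r) (pure R H [z])) = sw N r (\<lambda>x y. F x y z)"
    if r: "r \<in> carrier H" and z: "z \<in> carrier H" for r z
  proof -
    have R: "comult H r \<in> carrier (T 2)" using linear_closed[OF comult_linear r] .
    have Z: "pure R H [z] \<in> carrier (T 1)" using z by (intro pure_closed) simp
    have b: "bilinear N (\<lambda>x y. F x y z)"
      using F z by (auto simp: trilinear_def intro!: bilinearI)
    have ml: "multilinear R H N 1 (\<lambda>v. ?f (w @ v))" if "w \<in> tuples H 2" for w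
      using multilinear_closed[OF trilinear_multilinear[OF F], of "[w ! 0, w ! 1, _]"] F that
      by (auto simp: tuples_2 trilinear_def multilinear_Suc multilinear_0)
    have "tensor_lift N ?f (tensor_concat R H 2 1 (comult H r) (pure R H [z])) =
        tensor_lift N (\<lambda>w. tensor_lift N (\<lambda>v. ?f (w @ v)) (pure R H [z])) (comult H r)"
      by (rule tensor_lift_concat[OF N f R Z])
    also have "\<dots> = tensor_lift N (\<lambda>w. F (w ! 0) (w ! 1) z) (comult H r)"
      using tensor_lift_pure[OF N ml, of _ "[z]"] z
      by (intro tensor_lift_cong[OF N bilinear_multilinear[OF b] _ R, symmetric])
         (auto simp: tuples_2)
    also have "\<dots> = sw N r (\<lambda>x y. F x y z)" by (rule sw_lift[OF N b r])
    finally show ?thesis .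
  qed
  note inner = this
  have "tensor_lift N ?f (comult3 R H a) =
      sw N a (\<lambda>x y. tensor_lift N ?f (tensor_concat R H 2 1 (comult H x) (pure R H [y])))"
    unfolding comult3_sw[OF a]
    by (rule sw_lift_lift[OF N trilinear_multilinear[OF F] a bilinear_closed[OF comult3_multilinear(1)]])
  also have "\<dots> = sw N a (\<lambda>r z. sw N r (\<lambda>x y. F x y z))"
    by (rule sw_cong[OF HOL.refl a]) (rule inner)
  finally show ?thesis .
qed

text \<open>Coassociativity is an identity in \<open>H\<^sup>\<otimes>\<^sup>3\<close>; the map induced there by the trilinear \<open>F\<close>
  carries it to any module.\<close>

lemma sw_coassoc:
  assumes N: "module R N" and a: "a \<in> carrier H"
    and F1: "\<And>x y. \<lbrakk>x \<in> carrier H; y \<in> carrier H\<rbrakk> \<Longrightarrow> (\<lambda>z. F x y z) \<in> linear_maps R H N"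
    and F2: "\<And>x z. \<lbrakk>x \<in> carrier H; z \<in> carrier H\<rbrakk> \<Longrightarrow> (\<lambda>y. F x y z) \<in> linear_maps R H N"
    and F3: "\<And>y z. \<lbrakk>y \<in> carrier H; z \<in> carrier H\<rbrakk> \<Longrightarrow> (\<lambda>x. F x y z) \<in> linear_maps R H N"
  shows "sw N a (\<lambda>r z. sw N r (\<lambda>x y. F x y z)) = sw N a (\<lambda>x r. sw N r (\<lambda>y z. F x y z))"
proof -
  let ?f = "\<lambda>w. F (w ! 0) (w ! 1) (w ! 2)"
  have F: "trilinear N F" using F1 F2 F3 by (simp add: trilinear_def)
  have f: "multilinear R H N (1 + 2) ?f"
    using trilinear_multilinear[OF F] unfolding numeral_3_eq_3 by (simp add: numeral_2_eq_2)
  have inner: "tensor_lift N ?f (tensor_concat R H 1 2 (pure R H [x]) (comult H r)) =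
      sw N r (\<lambda>y z. F x y z)"
    if r: "r \<in> carrier H" and x: "x \<in> carrier H" for r x
  proof -
    have R: "comult H r \<in> carrier (T 2)" using linear_closed[OF comult_linear r] .
    have X: "pure R H [x] \<in> carrier (T 1)" using x by (intro pure_closed) simp
    have b: "bilinear N (\<lambda>y z. F u y z)" if "u \<in> carrier H" for u
      using F that by (auto simp: trilinear_def intro!: bilinearI)
    have lin: "(\<lambda>u. sw N r (\<lambda>y z. F u y z)) \<in> linear_maps R H N"
      using N r F3 by (auto intro!: linear_sw_body)
    have ml: "multilinear R H N 1 (\<lambda>w. sw N r (\<lambda>y z. F (w ! 0) y z))"
      using lin by (auto simp: multilinear_Suc multilinear_0 intro: linear_closed)
    have "tensor_lift N ?f (tensor_concat R H 1 2 (pure R H [x]) (comult H r)) =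
        tensor_lift N (\<lambda>w. tensor_lift N (\<lambda>v. ?f (w @ v)) (comult H r)) (pure R H [x])"
      by (rule tensor_lift_concat[OF N f X R])
    also have "\<dots> = tensor_lift N (\<lambda>w. sw N r (\<lambda>y z. F (w ! 0) y z)) (pure R H [x])"
      using sw_lift[OF N b r]
      by (intro tensor_lift_cong[OF N ml _ X, symmetric])
         (auto simp: tuples_Suc numeral_2_eq_2 nth_append)
    also have "\<dots> = sw N r (\<lambda>y z. F x y z)"
      using tensor_lift_pure[OF N ml, of "[x]"] x by simp
    finally show ?thesis .
  qed
  have "sw N a (\<lambda>r z. sw N r (\<lambda>x y. F x y z)) = tensor_lift N ?f (comult3 R H a)"
    by (rule lift_comult3[OF N F a, symmetric])
  also have "comult3 R H a =
      sw (T 3) a (\<lambda>x y. tensor_concat R H 1 2 (pure R H [x]) (comult H y))"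
    unfolding comult3_def coassociative[OF a]
    by (rule sw_lift[OF tensor_module comult3_multilinear(2) a])
  also have "tensor_lift N ?f \<dots> =
      sw N a (\<lambda>x y. tensor_lift N ?f (tensor_concat R H 1 2 (pure R H [x]) (comult H y)))"
    by (rule sw_lift_lift[OF N trilinear_multilinear[OF F] a bilinear_closed[OF comult3_multilinear(2)]])
  also have "\<dots> = sw N a (\<lambda>x r. sw N r (\<lambda>y z. F x y z))"
    by (rule sw_cong[OF HOL.refl a]) (rule inner)
  finally show ?thesis .
qed

end

section \<open>The antipode\<close>

context hopf_algebra
begin

lemma antipode_one [simp]: "S \<one>\<^bsub>H\<^esub> = \<one>\<^bsub>H\<^esub>"
proof -
  have "sw H \<one>\<^bsub>H\<^esub> (\<lambda>x y. S x \<cdot> y) = S \<one>\<^bsub>H\<^esub> \<cdot> \<one>\<^bsub>H\<^esub>"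
    by (rule sw_one) (auto intro!: linear_intros)
  moreover have "sw H \<one>\<^bsub>H\<^esub> (\<lambda>x y. S x \<cdot> y) = eps \<one>\<^bsub>H\<^esub> \<odot>\<^bsub>H\<^esub> \<one>\<^bsub>H\<^esub>"
    by (rule sw_antipode_left[OF hopf_module linear_ident]) simp
  ultimately show ?thesis by simp
qed

text \<open>Insert \<open>b\<^sup>(\<^sup>2\<^sup>) S(b\<^sup>(\<^sup>3\<^sup>))\<close>: in \<open>S(a\<^sup>(\<^sup>1\<^sup>) b\<^sup>(\<^sup>1\<^sup>)) a\<^sup>(\<^sup>2\<^sup>) b\<^sup>(\<^sup>2\<^sup>) S(b\<^sup>(\<^sup>3\<^sup>))\<close> the first three factors
  cancel, because \<open>\<Delta>\<close> is multiplicative.\<close>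

lemma antipode_mult_aux:
  assumes a: "a \<in> carrier H" and b: "b \<in> carrier H"
  shows "sw H a (\<lambda>x y. S (x \<cdot> b) \<cdot> y) = eps a \<odot>\<^bsub>H\<^esub> S b"
proof -
  have "sw H a (\<lambda>x y. S (x \<cdot> b) \<cdot> y) =
      sw H b (\<lambda>u v. eps v \<odot>\<^bsub>H\<^esub> sw H a (\<lambda>x y. S (x \<cdot> u) \<cdot> y))"
    by (rule sw_counit_right[symmetric]) (auto intro!: linear_intros simp: a b)
  also have "\<dots> = sw H b (\<lambda>u v. sw H v (\<lambda>w z. sw H a (\<lambda>x y. (S (x \<cdot> u) \<cdot> y) \<cdot> (w \<cdot> S z))))"
  proof (rule sw_cong[OF HOL.refl b])
    fix u v assume uv: "u \<in> carrier H" "v \<in> carrier H"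
    have "sw H v (\<lambda>w z. sw H a (\<lambda>x y. (S (x \<cdot> u) \<cdot> y) \<cdot> (w \<cdot> S z))) =
        eps v \<odot>\<^bsub>H\<^esub> sw H a (\<lambda>x y. (S (x \<cdot> u) \<cdot> y) \<cdot> \<one>\<^bsub>H\<^esub>)"
      by (rule sw_antipode_right) (auto intro!: linear_intros simp: a uv)
    also have "sw H a (\<lambda>x y. (S (x \<cdot> u) \<cdot> y) \<cdot> \<one>\<^bsub>H\<^esub>) =
        sw H a (\<lambda>x y. S (x \<cdot> u) \<cdot> y)"
      by (rule sw_cong[OF HOL.refl a]) (simp add: uv)
    finally show "eps v \<odot>\<^bsub>H\<^esub> sw H a (\<lambda>x y. S (x \<cdot> u) \<cdot> y) =
      sw H v (\<lambda>w z. sw H a (\<lambda>x y. (S (x \<cdot> u) \<cdot> y) \<cdot> (w \<cdot> S z)))" ..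
  qed
  also have "\<dots> = sw H b (\<lambda>r z. sw H r (\<lambda>u w. sw H a (\<lambda>x y. (S (x \<cdot> u) \<cdot> y) \<cdot> (w \<cdot> S z))))"
    by (rule sw_coassoc[symmetric]) (auto intro!: linear_intros simp: a b)
  also have "\<dots> = sw H b (\<lambda>r z. eps r \<odot>\<^bsub>H\<^esub> (eps a \<odot>\<^bsub>H\<^esub> S z))"
  proof (rule sw_cong[OF HOL.refl b])
    fix r z assume rz: "r \<in> carrier H" "z \<in> carrier H"
    have "sw H r (\<lambda>u w. sw H a (\<lambda>x y. (S (x \<cdot> u) \<cdot> y) \<cdot> (w \<cdot> S z))) =
        sw H a (\<lambda>x y. sw H r (\<lambda>u w. (S (x \<cdot> u) \<cdot> (y \<cdot> w)) \<cdot> S z))"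
      by (subst sw_swap) (auto simp: a rz m_assoc intro!: sw_cong)
    also have "\<dots> = sw H (a \<cdot> r) (\<lambda>p q. (S p \<cdot> q) \<cdot> S z)"
      by (rule sw_mult[symmetric]) (auto intro!: linear_intros simp: a rz)
    also have "\<dots> = eps (a \<cdot> r) \<odot>\<^bsub>H\<^esub> (\<one>\<^bsub>H\<^esub> \<cdot> S z)"
      by (rule sw_antipode_left) (auto intro!: linear_intros simp: a rz)
    also have "\<dots> = eps r \<odot>\<^bsub>H\<^esub> (eps a \<odot>\<^bsub>H\<^esub> S z)"
      using a rz by (simp add: smult_assoc1[symmetric] R.m_comm)
    finally show "sw H r (\<lambda>u w. sw H a (\<lambda>x y. (S (x \<cdot> u) \<cdot> y) \<cdot> (w \<cdot> S z))) =
        eps r \<odot>\<^bsub>H\<^esub> (eps a \<odot>\<^bsub>H\<^esub> S z)" .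
  qed
  also have "\<dots> = eps a \<odot>\<^bsub>H\<^esub> S b"
    by (rule sw_counit_left) (auto intro!: linear_intros simp: a b)
  finally show ?thesis .
qed

text \<open>\<open>S(a b) = S(a\<^sup>(\<^sup>1\<^sup>) b) a\<^sup>(\<^sup>2\<^sup>) S(a\<^sup>(\<^sup>3\<^sup>))\<close>, to which the preceding lemma applies.\<close>

lemma antipode_mult:
  assumes a: "a \<in> carrier H" and b: "b \<in> carrier H"
  shows "S (a \<cdot> b) = S b \<cdot> S a"
proof -
  have "S (a \<cdot> b) = sw H a (\<lambda>x y. eps y \<odot>\<^bsub>H\<^esub> S (x \<cdot> b))"
    by (rule sw_counit_right[symmetric]) (auto intro!: linear_intros simp: a b)
  also have "\<dots> = sw H a (\<lambda>x y. sw H y (\<lambda>w z. S (x \<cdot> b) \<cdot> (w \<cdot> S z)))"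
    by (rule sw_cong[OF HOL.refl a], subst sw_antipode_right) (auto intro!: linear_intros simp: a b)
  also have "\<dots> = sw H a (\<lambda>r z. sw H r (\<lambda>x w. S (x \<cdot> b) \<cdot> (w \<cdot> S z)))"
    by (rule sw_coassoc[symmetric]) (auto intro!: linear_intros simp: a b)
  also have "\<dots> = sw H a (\<lambda>r z. sw H r (\<lambda>x w. S (x \<cdot> b) \<cdot> w) \<cdot> S z)"
    using b by (intro sw_cong[OF HOL.refl a], subst sw_apply[where g = "\<lambda>h. h \<cdot> S _" and N = H])
      (auto intro!: linear_intros sw_cong simp: m_assoc)
  also have "\<dots> = sw H a (\<lambda>r z. eps r \<odot>\<^bsub>H\<^esub> (S b \<cdot> S z))"
    by (rule sw_cong[OF HOL.refl a]) (simp add: antipode_mult_aux b)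
  also have "\<dots> = S b \<cdot> S a"
    by (rule sw_counit_left) (auto intro!: linear_intros simp: a b)
  finally show ?thesis .
qed

text \<open>\<open>a\<^sup>(\<^sup>1\<^sup>) S(a\<^sup>(\<^sup>4\<^sup>)) \<otimes> a\<^sup>(\<^sup>2\<^sup>) S(a\<^sup>(\<^sup>3\<^sup>)) = \<epsilon>(a) 1 \<otimes> 1\<close>: the inner pair cancels first, then the
  outer one.  So \<open>S(a\<^sup>(\<^sup>2\<^sup>)) \<otimes> S(a\<^sup>(\<^sup>1\<^sup>))\<close> is a right convolution inverse of \<open>\<Delta>\<close>.\<close>

lemma sw_antipode_aux:
  assumes N: "module R N" and B: "bilinear N B" and a: "a \<in> carrier H"
  shows "sw N a (\<lambda>r s. sw N r (\<lambda>x y. sw N s (\<lambda>z w. B (x \<cdot> S w) (y \<cdot> S z)))) =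
    eps a \<odot>\<^bsub>N\<^esub> B \<one>\<^bsub>H\<^esub> \<one>\<^bsub>H\<^esub>"
proof -
  note [intro!] = bilinear_compose[OF B] linear_intros bilinear_closed[OF B]
  note [simp] = N a
  have "sw N a (\<lambda>r s. sw N r (\<lambda>x y. sw N s (\<lambda>z w. B (x \<cdot> S w) (y \<cdot> S z)))) =
      sw N a (\<lambda>x r. sw N r (\<lambda>y s. sw N s (\<lambda>z w. B (x \<cdot> S w) (y \<cdot> S z))))"
    by (rule sw_coassoc) auto
  also have "\<dots> = sw N a (\<lambda>x r. sw N r (\<lambda>q w. sw N q (\<lambda>y z. B (x \<cdot> S w) (y \<cdot> S z))))"
    by (rule sw_cong[OF HOL.refl a], rule sw_coassoc[symmetric]) auto
  also have "\<dots> = sw N a (\<lambda>x r. sw N r (\<lambda>q w. eps q \<odot>\<^bsub>N\<^esub> B (x \<cdot> S w) \<one>\<^bsub>H\<^esub>))"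
    by (rule sw_cong[OF HOL.refl a], rule sw_cong[OF HOL.refl], assumption, rule sw_antipode_right) auto
  also have "\<dots> = sw N a (\<lambda>x r. B (x \<cdot> S r) \<one>\<^bsub>H\<^esub>)"
    by (rule sw_cong[OF HOL.refl a], rule sw_counit_left) auto
  also have "\<dots> = eps a \<odot>\<^bsub>N\<^esub> B \<one>\<^bsub>H\<^esub> \<one>\<^bsub>H\<^esub>"
    by (rule sw_antipode_right) auto
  finally show ?thesis .
qed

text \<open>\<open>\<Delta> \<circ> S\<close> is a left convolution inverse of \<open>\<Delta>\<close>, hence equal to the right inverse above; the
  calculation is the usual proof that the two inverses agree, written out in sums.\<close>

lemma sw_antipode:
  assumes N: "module R N" and B: "bilinear N B" and a: "a \<in> carrier H"
  shows "sw N (S a) B = sw N a (\<lambda>x y. B (S y) (S x))"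
proof -
  note [intro!] = bilinear_compose[OF B] linear_intros bilinear_closed[OF B]
  note [simp] = N a
  let ?B = "\<lambda>x r s z w. sw N (S x) (\<lambda>p q. B (p \<cdot> (r \<cdot> S w)) (q \<cdot> (s \<cdot> S z)))"
  have "sw N (S a) B = sw N a (\<lambda>x y. eps y \<odot>\<^bsub>N\<^esub> sw N (S x) B)"
    using linear_sw[OF N B hopf_module linear_antipode[OF linear_ident]]
    by (intro sw_counit_right[symmetric]) auto
  also have "\<dots> = sw N a (\<lambda>x y. sw N y (\<lambda>t u. sw N t (\<lambda>r s. sw N u (\<lambda>z w. ?B x r s z w))))"
  proof (rule sw_cong[OF HOL.refl a])
    fix x y assume xy: "x \<in> carrier H" "y \<in> carrier H"
    have "bilinear N (\<lambda>r s. sw N (S x) (\<lambda>p q. B (p \<cdot> r) (q \<cdot> s)))"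
      using xy by auto
    note sw_antipode_aux[OF N this xy(2)]
    also have "sw N (S x) (\<lambda>p q. B (p \<cdot> \<one>\<^bsub>H\<^esub>) (q \<cdot> \<one>\<^bsub>H\<^esub>)) = sw N (S x) B"
      using xy by (intro sw_cong) auto
    finally show "eps y \<odot>\<^bsub>N\<^esub> sw N (S x) B =
        sw N y (\<lambda>t u. sw N t (\<lambda>r s. sw N u (\<lambda>z w. ?B x r s z w)))" ..
  qed
  also have "\<dots> = sw N a (\<lambda>v u. sw N v (\<lambda>x t. sw N t (\<lambda>r s. sw N u (\<lambda>z w. ?B x r s z w))))"
    by (rule sw_coassoc[symmetric]) auto
  also have "\<dots> = sw N a (\<lambda>v u. eps v \<odot>\<^bsub>N\<^esub> sw N u (\<lambda>z w. B (S w) (S z)))"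
  proof (rule sw_cong[OF HOL.refl a])
    fix v u assume vu: "v \<in> carrier H" "u \<in> carrier H"
    let ?f = "\<lambda>h. sw N u (\<lambda>z w. sw N h (\<lambda>p q. B (p \<cdot> S w) (q \<cdot> S z)))"
    have "sw N v (\<lambda>x t. sw N t (\<lambda>r s. sw N u (\<lambda>z w. ?B x r s z w))) =
        sw N v (\<lambda>x t. ?f (S x \<cdot> t))"
    proof (rule sw_cong[OF HOL.refl vu(1)])
      fix x t assume xt: "x \<in> carrier H" "t \<in> carrier H"
      have "sw N t (\<lambda>r s. sw N u (\<lambda>z w. ?B x r s z w)) = sw N u (\<lambda>z w. sw N t (\<lambda>r s. ?B x r s z w))"
        using vu xt by (intro sw_swap) auto
      also have "\<dots> = ?f (S x \<cdot> t)"
      proof (rule sw_cong[OF HOL.refl vu(2)])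
        fix z w assume zw: "z \<in> carrier H" "w \<in> carrier H"
        have "sw N t (\<lambda>r s. ?B x r s z w) = sw N (S x) (\<lambda>p q. sw N t (\<lambda>r s.
            B ((p \<cdot> r) \<cdot> S w) ((q \<cdot> s) \<cdot> S z)))"
          using xt zw by (subst sw_swap) (auto simp: m_assoc intro!: sw_cong)
        also have "\<dots> = sw N (S x \<cdot> t) (\<lambda>p q. B (p \<cdot> S w) (q \<cdot> S z))"
          using xt zw by (intro sw_mult[symmetric]) auto
        finally show "sw N t (\<lambda>r s. ?B x r s z w) =
          sw N (S x \<cdot> t) (\<lambda>p q. B (p \<cdot> S w) (q \<cdot> S z))" .
      qed
      finally show "sw N t (\<lambda>r s. sw N u (\<lambda>z w. ?B x r s z w)) = ?f (S x \<cdot> t)" .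
    qed
    also have "\<dots> = eps v \<odot>\<^bsub>N\<^esub> ?f \<one>\<^bsub>H\<^esub>"
      using vu by (intro sw_antipode_left) auto
    also have "?f \<one>\<^bsub>H\<^esub> = sw N u (\<lambda>z w. B (S w) (S z))"
      using vu by (intro sw_cong, simp, simp, subst sw_one) auto
    finally show "sw N v (\<lambda>x t. sw N t (\<lambda>r s. sw N u (\<lambda>z w. ?B x r s z w))) =
      eps v \<odot>\<^bsub>N\<^esub> sw N u (\<lambda>z w. B (S w) (S z))" .
  qed
  also have "\<dots> = sw N a (\<lambda>x y. B (S y) (S x))"
    by (rule sw_counit_left) auto
  finally show ?thesis .
qed

end

section \<open>The coaction on tuples\<close>

lemma tuples_induct [consumes 1, case_names Nil Cons]:
  assumes "as \<in> tuples M n" "P 0 []"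
    and "\<And>n a as. \<lbrakk>a \<in> carrier M; as \<in> tuples M n; P n as\<rbrakk> \<Longrightarrow> P (Suc n) (a # as)"
  shows "P n as"
  using assms(1)
proof (induction n arbitrary: as)
  case 0
  then show ?case using assms(2) by simp
next
  case (Suc n)
  then show ?case using assms(3) by (auto simp: tuples_Suc)
qed

context hopf_algebra
begin

text \<open>\<open>coact N [a\<^sub>1, \<dots>, a\<^sub>n] F\<close> is \<open>F (a\<^sub>1\<^sup>(\<^sup>1\<^sup>) \<cdots> a\<^sub>n\<^sup>(\<^sup>1\<^sup>)) [a\<^sub>1\<^sup>(\<^sup>2\<^sup>), \<dots>, a\<^sub>n\<^sup>(\<^sup>2\<^sup>)]\<close>, i.e. the codiagonal left
  coaction of \<open>H\<close> on \<open>H\<^sup>\<otimes>\<^sup>n\<close> followed by \<open>F\<close>.\<close>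

primrec coact :: "('k, 'b, 'n) module_scheme \<Rightarrow> 'h list \<Rightarrow> ('h \<Rightarrow> 'h list \<Rightarrow> 'b) \<Rightarrow> 'b" where
  "coact N [] F = F \<one>\<^bsub>H\<^esub> []"
| "coact N (a # as) F = sw N a (\<lambda>x y. coact N as (\<lambda>z zs. F (x \<cdot> z) (y # zs)))"

definition colinear ::
  "('k, 'b, 'n) module_scheme \<Rightarrow> nat \<Rightarrow> ('h \<Rightarrow> 'h list \<Rightarrow> 'b) \<Rightarrow> bool" where
  "colinear N n F \<longleftrightarrow> (\<forall>zs\<in>tuples H n. (\<lambda>x. F x zs) \<in> linear_maps R H N) \<and>
     (\<forall>x\<in>carrier H. multilinear R H N n (\<lambda>zs. F x zs))"

lemma colinearI:
  assumes "\<And>zs. zs \<in> tuples H n \<Longrightarrow> (\<lambda>x. F x zs) \<in> linear_maps R H N"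
    and "\<And>x. x \<in> carrier H \<Longrightarrow> multilinear R H N n (\<lambda>zs. F x zs)"
  shows "colinear N n F"
  using assms by (simp add: colinear_def)

lemma colinear_head:
  assumes "colinear N n F" "f \<in> linear_maps R M H" "zs \<in> tuples H n"
  shows "(\<lambda>x. F (f x) zs) \<in> linear_maps R M N"
proof -
  have "(\<lambda>x. F x zs) \<in> linear_maps R H N" using assms by (simp add: colinear_def)
  from linear_compose[OF this assms(2)] show ?thesis .
qed

lemma colinear_tail: "colinear N n F \<Longrightarrow> x \<in> carrier H \<Longrightarrow> multilinear R H N n (\<lambda>zs. F x zs)"
  by (simp add: colinear_def)

lemma colinear_second:
  assumes "colinear N (Suc n) F" "f \<in> linear_maps R M H" "x \<in> carrier H" "zs \<in> tuples H n"
  shows "(\<lambda>y. F x (f y # zs)) \<in> linear_maps R M N"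
proof -
  have "(\<lambda>y. F x (y # zs)) \<in> linear_maps R H N"
    using colinear_tail[OF assms(1,3)] assms(4) by (simp add: multilinear_Suc)
  from linear_compose[OF this assms(2)] show ?thesis .
qed

lemma colinear_closed:
  "\<lbrakk>colinear N n F; x \<in> carrier H; zs \<in> tuples H n\<rbrakk> \<Longrightarrow> F x zs \<in> carrier N"
  using multilinear_closed[OF colinear_tail] .

lemma colinear_Cons:
  assumes "colinear N (Suc n) F" "f \<in> linear_maps R H H" "y \<in> carrier H"
  shows "colinear N n (\<lambda>z zs. F (f z) (y # zs))"
proof (rule colinearI)
  show "(\<lambda>x. F (f x) (y # zs)) \<in> linear_maps R H N" if "zs \<in> tuples H n" for zs
    using that assms by (auto intro: colinear_head)
  show "multilinear R H N n (\<lambda>zs. F (f x) (y # zs))" if "x \<in> carrier H" for x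
    using colinear_tail[OF assms(1) linear_closed[OF assms(2) that]] assms(3)
    by (simp add: multilinear_Suc)
qed

lemma colinear_compose:
  assumes "colinear N n F" "f \<in> linear_maps R H H"
  shows "colinear N n (\<lambda>z zs. F (f z) zs)"
  using colinear_head[OF assms] colinear_tail[OF assms(1) linear_closed[OF assms(2)]]
  by (intro colinearI)

lemma coact_closed:
  assumes "as \<in> tuples H n" "module R N"
    "\<And>x zs. \<lbrakk>x \<in> carrier H; zs \<in> tuples H n\<rbrakk> \<Longrightarrow> F x zs \<in> carrier N"
  shows "coact N as F \<in> carrier N"
  using assms(1,3)
proof (induction arbitrary: F rule: tuples_induct)
  case (Cons n a as)
  show ?case by (auto intro!: sw_closed[OF assms(2)] Cons)
qed simp

lemma coact_cong:
  assumes "as \<in> tuples H n"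
    "\<And>x zs. \<lbrakk>x \<in> carrier H; zs \<in> tuples H n\<rbrakk> \<Longrightarrow> F x zs = G x zs"
  shows "coact N as F = coact N as G"
  using assms
proof (induction arbitrary: F G rule: tuples_induct)
  case (Cons n a as)
  show ?case by (auto intro!: sw_cong Cons)
qed simp

lemma coact_apply:
  assumes "as \<in> tuples H n" "module R M" "module R N" "g \<in> linear_maps R M N"
    "\<And>x zs. \<lbrakk>x \<in> carrier H; zs \<in> tuples H n\<rbrakk> \<Longrightarrow> F x zs \<in> carrier M"
  shows "g (coact M as F) = coact N as (\<lambda>x zs. g (F x zs))"
  using assms(1,5)
proof (induction arbitrary: F rule: tuples_induct)
  case (Cons n a as)
  have "g (coact M (a # as) F) =
      sw N a (\<lambda>x y. g (coact M as (\<lambda>z zs. F (x \<cdot> z) (y # zs))))"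
    using Cons by (auto intro!: sw_apply[OF assms(2-4)] coact_closed assms(2))
  also have "\<dots> = coact N (a # as) (\<lambda>x zs. g (F x zs))"
    using Cons by (auto intro!: sw_cong)
  finally show ?case .
qed simp

lemma coact_scale:
  assumes "as \<in> tuples H n" "module R N" "c \<in> carrier R"
    "\<And>x zs. \<lbrakk>x \<in> carrier H; zs \<in> tuples H n\<rbrakk> \<Longrightarrow> F x zs \<in> carrier N"
  shows "c \<odot>\<^bsub>N\<^esub> coact N as F = coact N as (\<lambda>x zs. c \<odot>\<^bsub>N\<^esub> F x zs)"
  by (rule coact_apply[OF assms(1,2,2) _ assms(4)])
    (rule linear_scale[OF assms(2) linear_ident assms(3)])

lemma coact_sw_swap:
  assumes "as \<in> tuples H n" "module R N" "b \<in> carrier H"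
    "\<And>x zs u v. \<lbrakk>x \<in> carrier H; zs \<in> tuples H n; u \<in> carrier H; v \<in> carrier H\<rbrakk> \<Longrightarrow>
      F x zs u v \<in> carrier N"
  shows "coact N as (\<lambda>x zs. sw N b (\<lambda>u v. F x zs u v)) =
    sw N b (\<lambda>u v. coact N as (\<lambda>x zs. F x zs u v))"
  using assms(1,4)
proof (induction arbitrary: F rule: tuples_induct)
  case (Cons n a as)
  have "coact N (a # as) (\<lambda>x zs. sw N b (\<lambda>u v. F x zs u v)) =
      sw N a (\<lambda>x y. sw N b (\<lambda>u v. coact N as (\<lambda>z zs. F (x \<cdot> z) (y # zs) u v)))"
    using Cons by (auto intro!: sw_cong)
  also have "\<dots> = sw N b (\<lambda>u v. coact N (a # as) (\<lambda>x zs. F x zs u v))"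
    using Cons assms(2,3) by (simp, intro sw_swap) (auto intro!: coact_closed)
  finally show ?case .
qed simp

lemma linear_coact_body:
  assumes "as \<in> tuples H n" "module R M" "module R N"
    "\<And>u zs. \<lbrakk>u \<in> carrier H; zs \<in> tuples H n\<rbrakk> \<Longrightarrow> (\<lambda>x. F x u zs) \<in> linear_maps R M N"
  shows "(\<lambda>x. coact N as (\<lambda>u zs. F x u zs)) \<in> linear_maps R M N"
  using assms(1,4)
proof (induction arbitrary: F rule: tuples_induct)
  case (Cons n a as)
  show ?case using Cons.hyps
    by (auto intro!: linear_sw_body[OF assms(2,3)] Cons.IH Cons.prems)
qed simp

lemma coact_multilinear:
  assumes N: "module R N" and F: "colinear N n F"
  shows "multilinear R H N n (\<lambda>as. coact N as F)"
  using F
proof (induction n arbitrary: F)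
  case 0
  then show ?case by (simp add: multilinear_0 colinear_closed)
next
  case (Suc n)
  have col: "colinear N n (\<lambda>z zs. F (x \<cdot> z) (y # zs))" if "x \<in> carrier H" "y \<in> carrier H" for x y
    using that by (intro colinear_Cons[OF Suc.prems]) (auto intro!: linear_intros)
  have bil: "bilinear N (\<lambda>x y. coact N as (\<lambda>z zs. F (x \<cdot> z) (y # zs)))"
    if "as \<in> tuples H n" for as
    using that N
    by (intro bilinearI linear_coact_body)
       (auto intro!: colinear_head[OF Suc.prems] colinear_second[OF Suc.prems] linear_intros)
  have IH: "multilinear R H N n (\<lambda>as. coact N as (\<lambda>z zs. F (x \<cdot> z) (y # zs)))"
    if "x \<in> carrier H" "y \<in> carrier H" for x y
    using Suc.IH[OF col] that .
  have "multilinear R H N n (\<lambda>as. sw N a (\<lambda>x y. coact N as (\<lambda>z zs. F (x \<cdot> z) (y # zs))))"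
    if a: "a \<in> carrier H" for a
    unfolding multilinear_def
  proof (intro conjI ballI allI impI)
    show "sw N a (\<lambda>x y. coact N w (\<lambda>z zs. F (x \<cdot> z) (y # zs))) \<in> carrier N"
      if "w \<in> tuples H n" for w
      using multilinear_closed[OF IH that] a N by auto
    show "(\<lambda>b. sw N a (\<lambda>x y. coact N (us @ b # vs) (\<lambda>z zs. F (x \<cdot> z) (y # zs)))) \<in> linear_maps R H N"
      if "us @ vs \<in> tuples H (n - 1) \<and> 0 < n" for us vs
      using multilinear_slot[OF IH] that a N by (auto intro!: linear_sw_body)
  qed
  then show ?case
    using linear_sw[OF N bil hopf_module linear_ident]
    by (simp add: multilinear_Suc)
qed

text \<open>A multiplicative functional of the product \<open>a\<^sub>1\<^sup>(\<^sup>1\<^sup>) \<cdots> a\<^sub>n\<^sup>(\<^sup>1\<^sup>)\<close> acts on each entry separately.\<close>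

lemma coact_character:
  assumes "as \<in> tuples H n" and N: "module R N" and G: "multilinear R H N n G"
    and chi: "\<chi> \<in> characters R H"
  shows "coact N as (\<lambda>x zs. \<chi> x \<odot>\<^bsub>N\<^esub> G zs) = G (map (\<lambda>a. sw H a (\<lambda>x y. \<chi> x \<odot>\<^bsub>H\<^esub> y)) as)"
  using assms(1) G
proof (induction arbitrary: G rule: tuples_induct)
  case Nil
  interpret N: module R N by fact
  show ?case using Nil by (simp add: character_simps[OF chi] multilinear_0)
next
  case (Cons n a as)
  interpret N: module R N by fact
  let ?th = "\<lambda>a. sw H a (\<lambda>x y. \<chi> x \<odot>\<^bsub>H\<^esub> y)"
  note chi_simps [simp] = character_simps[OF chi]
  have th: "map ?th as \<in> tuples H n"
    using Cons.hyps(2) by (auto simp: tuples_def intro!: sw_closed)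
  have G: "G (y # zs) \<in> carrier N" if "y \<in> carrier H" "zs \<in> tuples H n" for y zs
    using multilinear_closed[OF Cons.prems] that by simp
  have "coact N (a # as) (\<lambda>x zs. \<chi> x \<odot>\<^bsub>N\<^esub> G zs) =
      sw N a (\<lambda>x y. \<chi> x \<odot>\<^bsub>N\<^esub> coact N as (\<lambda>z zs. \<chi> z \<odot>\<^bsub>N\<^esub> G (y # zs)))"
    using Cons.hyps
    by (auto intro!: sw_cong coact_cong simp: coact_scale[OF Cons.hyps(2) N] G N.smult_assoc1)
  also have "\<dots> = sw N a (\<lambda>x y. G ((\<chi> x \<odot>\<^bsub>H\<^esub> y) # map ?th as))"
  proof (rule sw_cong[OF HOL.refl Cons.hyps(1)])
    fix x y assume xy: "x \<in> carrier H" "y \<in> carrier H"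
    have "coact N as (\<lambda>z zs. \<chi> z \<odot>\<^bsub>N\<^esub> G (y # zs)) = G (y # map ?th as)"
      using Cons.prems xy by (intro Cons.IH) (simp add: multilinear_Suc)
    moreover have "(\<lambda>y. G (y # map ?th as)) \<in> linear_maps R H N"
      using Cons.prems th by (simp add: multilinear_Suc)
    ultimately show "\<chi> x \<odot>\<^bsub>N\<^esub> coact N as (\<lambda>z zs. \<chi> z \<odot>\<^bsub>N\<^esub> G (y # zs)) =
        G ((\<chi> x \<odot>\<^bsub>H\<^esub> y) # map ?th as)"
      using xy linear_smult[of "\<lambda>y. G (y # map ?th as)" R H N "\<chi> x" y] by simp
  qed
  also have "\<dots> = G (?th a # map ?th as)"
    using Cons.hyps Cons.prems th by (intro sw_apply[symmetric] N) (auto simp: multilinear_Suc)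
  finally show ?case by simp
qed

lemma coact_counit:
  assumes "as \<in> tuples H n" "module R N" "multilinear R H N n G"
  shows "coact N as (\<lambda>x zs. eps x \<odot>\<^bsub>N\<^esub> G zs) = G as"
proof -
  have "map (\<lambda>a. sw H a (\<lambda>x y. eps x \<odot>\<^bsub>H\<^esub> y)) as = as"
    using assms(1) sw_counit_left[OF hopf_module linear_ident]
    by (intro map_idI) (auto simp: tuples_def)
  then show ?thesis using coact_character[OF assms counit_hom] by simp
qed

text \<open>The coaction inherits coassociativity from \<open>H\<close>, because \<open>\<Delta>\<close> is multiplicative.\<close>

lemma coact_coassoc:
  assumes "as \<in> tuples H n" and N: "module R N"
    and F: "\<And>q. q \<in> carrier H \<Longrightarrow> colinear N n (\<lambda>p zs. F p q zs)"
      "\<And>p. p \<in> carrier H \<Longrightarrow> colinear N n (\<lambda>q zs. F p q zs)"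
  shows "coact N as (\<lambda>x zs. sw N x (\<lambda>p q. F p q zs)) =
    coact N as (\<lambda>x zs. coact N zs (\<lambda>z ws. F x z ws))"
  using assms(1) F
proof (induction arbitrary: F rule: tuples_induct)
  case Nil
  have "bilinear N (\<lambda>p q. F p q [])"
    by (intro bilinearI colinear_head[OF Nil(1) linear_ident] colinear_head[OF Nil(2) linear_ident])
       auto
  then show ?case by (simp add: sw_one[OF N])
next
  case (Cons n a as)
  note [simp] = N Cons.hyps
  note F1 = Cons.prems(1) and F2 = Cons.prems(2)
  note [intro!] = linear_intros colinear_head[OF F1] colinear_head[OF F2] colinear_second[OF F1]
    colinear_closed[OF F1] linear_coact_body[OF Cons.hyps(2)] coact_closed[OF Cons.hyps(2)]
  have col1: "colinear N n (\<lambda>z zs. F (x \<cdot> z) q (y # zs))"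
    if "x \<in> carrier H" "y \<in> carrier H" "q \<in> carrier H" for x y q
    using that by (intro colinear_Cons[OF F1]) auto
  have col2: "colinear N n (\<lambda>z zs. F p (x \<cdot> z) (y # zs))"
    if "x \<in> carrier H" "y \<in> carrier H" "p \<in> carrier H" for x y p
    using that by (intro colinear_Cons[OF F2]) auto
  have "coact N (a # as) (\<lambda>x zs. sw N x (\<lambda>p q. F p q zs)) =
      sw N a (\<lambda>x y. sw N x (\<lambda>u v. coact N as (\<lambda>z zs. sw N z (\<lambda>p q. F (u \<cdot> p) (v \<cdot> q) (y # zs)))))"
    unfolding coact.simps
  proof (rule sw_cong[OF HOL.refl Cons.hyps(1)])
    fix x y assume xy: "x \<in> carrier H" "y \<in> carrier H"
    have "coact N as (\<lambda>z zs. sw N (x \<cdot> z) (\<lambda>p q. F p q (y # zs))) =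
        coact N as (\<lambda>z zs. sw N x (\<lambda>u v. sw N z (\<lambda>p q. F (u \<cdot> p) (v \<cdot> q) (y # zs))))"
      using xy by (intro coact_cong[OF Cons.hyps(2)] sw_mult) auto
    also have "\<dots> = sw N x (\<lambda>u v. coact N as (\<lambda>z zs. sw N z (\<lambda>p q. F (u \<cdot> p) (v \<cdot> q) (y # zs))))"
      using xy by (intro coact_sw_swap[OF Cons.hyps(2)]) auto
    finally show "coact N as (\<lambda>z zs. sw N (x \<cdot> z) (\<lambda>p q. F p q (y # zs))) =
        sw N x (\<lambda>u v. coact N as (\<lambda>z zs. sw N z (\<lambda>p q. F (u \<cdot> p) (v \<cdot> q) (y # zs))))" .
  qed
  also have "\<dots> = sw N a (\<lambda>x y. sw N x (\<lambda>u v. coact N as (\<lambda>z zs. coact N zs (\<lambda>w ws. F (u \<cdot> z) (v \<cdot> w) (y # ws)))))"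
    by (intro sw_cong Cons.IH) (auto intro!: col1 col2)
  also have "\<dots> = sw N a (\<lambda>x r. sw N r (\<lambda>u y. coact N as (\<lambda>z zs. coact N zs (\<lambda>w ws. F (x \<cdot> z) (u \<cdot> w) (y # ws)))))"
    by (rule sw_coassoc) (auto intro!: linear_coact_body)
  also have "\<dots> = sw N a (\<lambda>x r. coact N as (\<lambda>z zs. coact N (r # zs) (\<lambda>w ws. F (x \<cdot> z) w ws)))"
    by (intro sw_cong, simp, simp, simp, rule coact_sw_swap[OF Cons.hyps(2), symmetric])
      (auto intro!: coact_closed)
  finally show ?case by simp
qed

lemma coact_snoc:
  assumes "as \<in> tuples H n" and N: "module R N" and c: "c \<in> carrier H"
    and F: "\<And>x zs. \<lbrakk>x \<in> carrier H; zs \<in> tuples H (Suc n)\<rbrakk> \<Longrightarrow> F x zs \<in> carrier N"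
  shows "coact N (as @ [c]) F = coact N as (\<lambda>x zs. sw N c (\<lambda>z w. F (x \<cdot> z) (zs @ [w])))"
  using assms(1) F
proof (induction arbitrary: F rule: tuples_induct)
  case Nil
  show ?case by (auto intro!: sw_cong c)
next
  case (Cons n a as)
  show ?case
    using Cons.hyps Cons.prems c
    by (auto intro!: sw_cong coact_cong simp: Cons.IH m_assoc)
qed

text \<open>With \<open>x\<^sup>(\<^sup>i\<^sup>)\<close> for the successive components of the coaction on the tuple, the term
  \<open>x\<^sup>(\<^sup>1\<^sup>) \<otimes> S(x\<^sup>(\<^sup>2\<^sup>)) x\<^sup>(\<^sup>3\<^sup>) \<otimes> \<dots>\<close> collapses to \<open>x\<^sup>(\<^sup>1\<^sup>) \<otimes> 1 \<otimes> \<dots>\<close> by coassociativity of the coaction.\<close>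

lemma coact_antipode:
  assumes as: "as \<in> tuples H n" and N: "module R N"
    and F1: "\<And>q. q \<in> carrier H \<Longrightarrow> colinear N n (\<lambda>p zs. F p q zs)"
    and F2: "\<And>p. p \<in> carrier H \<Longrightarrow> colinear N n (\<lambda>q zs. F p q zs)"
  shows "coact N as (\<lambda>x ys. sw N x (\<lambda>p q. coact N ys (\<lambda>w zs. F p (S q \<cdot> w) zs))) =
    coact N as (\<lambda>x ys. F x \<one>\<^bsub>H\<^esub> ys)"
proof -
  note [simp] = N
  note [intro!] = linear_intros colinear_head[OF F1] colinear_head[OF F2] colinear_closed[OF F1]
    linear_coact_body coact_closed
  have "coact N as (\<lambda>x ys. sw N x (\<lambda>p q. coact N ys (\<lambda>w zs. F p (S q \<cdot> w) zs))) =
      coact N as (\<lambda>x ys. coact N ys (\<lambda>q rs. coact N rs (\<lambda>w zs. F x (S q \<cdot> w) zs)))"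
    using colinear_tail[OF F1]
    by (intro coact_coassoc[OF as N] colinearI)
       (auto intro!: coact_multilinear colinear_compose[OF F2])
  also have "\<dots> = coact N as (\<lambda>x ys. coact N ys (\<lambda>r zs. sw N r (\<lambda>q w. F x (S q \<cdot> w) zs)))"
    by (rule coact_cong[OF as], rule coact_coassoc[symmetric])
       (auto intro!: colinearI colinear_tail[OF F2])
  also have "\<dots> = coact N as (\<lambda>x ys. coact N ys (\<lambda>r zs. eps r \<odot>\<^bsub>N\<^esub> F x \<one>\<^bsub>H\<^esub> zs))"
    by (rule coact_cong[OF as], rule coact_cong, assumption, rule sw_antipode_left) auto
  also have "\<dots> = coact N as (\<lambda>x ys. F x \<one>\<^bsub>H\<^esub> ys)"
    by (rule coact_cong[OF as], rule coact_counit) (auto intro!: colinear_tail[OF F2])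
  finally show ?thesis .
qed

end

section \<open>The twisted antipode\<close>

context hopf_algebra
begin

lemma characterI:
  assumes "(\<lambda>x. \<chi> x) \<in> linear_maps R H K"
    and "\<And>x y. \<lbrakk>x \<in> carrier H; y \<in> carrier H\<rbrakk> \<Longrightarrow> \<chi> (x \<cdot> y) = \<chi> x \<otimes> \<chi> y"
    and "\<chi> \<one>\<^bsub>H\<^esub> = \<one>"
  shows "\<chi> \<in> characters R H"
proof -
  have "\<chi> \<in> ring_hom H K"
    using linear_closed[OF assms(1)] linear_add[OF assms(1)] assms(2,3)
    by (auto intro!: ring_hom_memI)
  then show ?thesis using assms(1) by (simp add: characters_def algebra_homs_def)
qed

lemma character_antipode:
  assumes "\<chi> \<in> characters R H"
  shows "(\<lambda>x. \<chi> (S x)) \<in> characters R H"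
  using character_simps[OF assms]
  by (auto intro!: characterI character_linear[OF assms] linear_intros
      simp: antipode_mult R.m_comm)

lemma sw_character_antipode:
  assumes chi: "\<chi> \<in> characters R H" and N: "module R N" and a: "a \<in> carrier H"
    and v: "v \<in> carrier N"
  shows "sw N a (\<lambda>x y. (\<chi> (S x) \<otimes> \<chi> y) \<odot>\<^bsub>N\<^esub> v) = eps a \<odot>\<^bsub>N\<^esub> v"
    and "sw N a (\<lambda>x y. (\<chi> x \<otimes> \<chi> (S y)) \<odot>\<^bsub>N\<^esub> v) = eps a \<odot>\<^bsub>N\<^esub> v"
proof -
  interpret N: module R N by fact
  have lin: "(\<lambda>h. \<chi> h \<odot>\<^bsub>N\<^esub> v) \<in> linear_maps R H N"
    using character_linear[OF chi] N v by (auto intro!: linear_intros)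
  note [simp] = character_simps[OF chi]
  have "sw N a (\<lambda>x y. (\<chi> (S x) \<otimes> \<chi> y) \<odot>\<^bsub>N\<^esub> v) = sw N a (\<lambda>x y. \<chi> (S x \<cdot> y) \<odot>\<^bsub>N\<^esub> v)"
    by (rule sw_cong[OF HOL.refl a]) simp
  then show "sw N a (\<lambda>x y. (\<chi> (S x) \<otimes> \<chi> y) \<odot>\<^bsub>N\<^esub> v) = eps a \<odot>\<^bsub>N\<^esub> v"
    using sw_antipode_left[OF N lin a] v by simp
  have "sw N a (\<lambda>x y. (\<chi> x \<otimes> \<chi> (S y)) \<odot>\<^bsub>N\<^esub> v) = sw N a (\<lambda>x y. \<chi> (x \<cdot> S y) \<odot>\<^bsub>N\<^esub> v)"
    by (rule sw_cong[OF HOL.refl a]) simp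
  then show "sw N a (\<lambda>x y. (\<chi> x \<otimes> \<chi> (S y)) \<odot>\<^bsub>N\<^esub> v) = eps a \<odot>\<^bsub>N\<^esub> v"
    using sw_antipode_right[OF N lin a] v by simp
qed

end

locale modular_datum = hopf_algebra R H
  for R :: "('k, 'r) ring_scheme" (structure) and H :: "('k, 'h, 'z) hopf_scheme" (structure) +
  fixes \<alpha> \<beta> :: "'h \<Rightarrow> 'k" and p :: 'h
  assumes alpha: "\<alpha> \<in> characters R H" and beta: "\<beta> \<in> characters R H"
    and p_grouplike: "grouplike R H p"
    and CM: "condition_CM R H p \<alpha> \<beta>"
begin

lemmas alpha_simps [simp] = character_simps[OF alpha]
lemmas beta_simps [simp] = character_simps[OF beta]

lemma p_closed [simp]: "p \<in> carrier H" and counit_p [simp]: "eps p = \<one>"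
  using p_grouplike by (simp_all add: grouplike_def)

lemma alpha_p [simp]: "\<alpha> p = \<one>" and beta_p [simp]: "\<beta> p = \<one>"
  using CM by (simp_all add: condition_CM_def)

lemma p_antipode [simp]: "p \<cdot> S p = \<one>\<^bsub>H\<^esub>"
proof -
  have "sw H p (\<lambda>x y. x \<cdot> S y) = p \<cdot> S p"
    by (rule sw_grouplike[OF hopf_module _ p_grouplike]) (auto intro!: linear_intros)
  then show ?thesis using sw_antipode_right[OF hopf_module linear_ident, of p] by simp
qed

text \<open>\<open>f = \<alpha> * S\<^sub>\<pi>\<close>\<close>

definition twist :: "'h \<Rightarrow> 'h" where
  "twist = convolution H H (smult H) \<alpha> (twisted_antipode H p)"

text \<open>The map \<open>\<theta>\<close> by which an entry changes when the cyclic operator carries it from the last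
  position to the first.\<close>

definition theta :: "'h \<Rightarrow> 'h" where
  "theta a = sw H a (\<lambda>x y. \<beta> y \<odot>\<^bsub>H\<^esub> twist (p \<cdot> S x))"

lemma twist_sw:
  assumes "a \<in> carrier H"
  shows "twist a = sw H a (\<lambda>x y. \<alpha> x \<odot>\<^bsub>H\<^esub> (p \<cdot> S y))"
proof -
  have "bilinear H (\<lambda>x y. \<alpha> x \<odot>\<^bsub>H\<^esub> (p \<cdot> S y))"
    by (auto intro!: linear_intros character_linear[OF alpha])
  from sw_lift[OF hopf_module this assms] show ?thesis
    unfolding twist_def convolution_def twisted_antipode_def .
qed

lemma linear_twist:
  assumes "module R M" "f \<in> linear_maps R M H"
  shows "(\<lambda>x. twist (f x)) \<in> linear_maps R M H"
  by (subst linear_cong[OF assms(1) twist_sw[OF linear_closed[OF assms(2)]]])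
     (auto intro!: linear_intros character_linear[OF alpha] assms)

lemma twist_closed [simp, intro]: "a \<in> carrier H \<Longrightarrow> twist a \<in> carrier H"
  using linear_closed[OF linear_twist[OF hopf_module linear_ident]] .

lemma linear_theta:
  assumes "module R M" "f \<in> linear_maps R M H"
  shows "(\<lambda>x. theta (f x)) \<in> linear_maps R M H"
  unfolding theta_def
  by (auto intro!: linear_intros character_linear[OF beta] linear_twist assms)

lemma theta_closed [simp, intro]: "a \<in> carrier H \<Longrightarrow> theta a \<in> carrier H"
  using linear_closed[OF linear_theta[OF hopf_module linear_ident]] .

lemmas twist_intros = linear_intros character_linear[OF alpha] character_linear[OF beta]
  linear_twist linear_theta

lemma alpha_twist [simp]:
  assumes a: "a \<in> carrier H"
  shows "\<alpha> (twist a) = eps a"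
proof -
  have "\<alpha> (twist a) = sw K a (\<lambda>x y. \<alpha> (\<alpha> x \<odot>\<^bsub>H\<^esub> (p \<cdot> S y)))"
    unfolding twist_sw[OF a] using a by (intro sw_apply[where N = K]) (auto intro!: twist_intros)
  also have "\<dots> = sw K a (\<lambda>x y. (\<alpha> x \<otimes> \<alpha> (S y)) \<odot>\<^bsub>K\<^esub> \<one>)"
    using a by (intro sw_cong) auto
  also have "\<dots> = eps a"
    using sw_character_antipode(2)[OF alpha base_module a, of \<one>] a by simp
  finally show ?thesis .
qed

lemma twist_p [simp]: "twist p = \<one>\<^bsub>H\<^esub>"
proof -
  have "sw H p (\<lambda>x y. \<alpha> x \<odot>\<^bsub>H\<^esub> (p \<cdot> S y)) = \<alpha> p \<odot>\<^bsub>H\<^esub> (p \<cdot> S p)"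
    by (rule sw_grouplike[OF hopf_module _ p_grouplike]) (auto intro!: twist_intros)
  then show ?thesis by (simp add: twist_sw)
qed

lemma twist_one [simp]: "twist \<one>\<^bsub>H\<^esub> = p"
proof -
  have "sw H \<one>\<^bsub>H\<^esub> (\<lambda>x y. \<alpha> x \<odot>\<^bsub>H\<^esub> (p \<cdot> S y)) = \<alpha> \<one>\<^bsub>H\<^esub> \<odot>\<^bsub>H\<^esub> (p \<cdot> S \<one>\<^bsub>H\<^esub>)"
    by (rule sw_one) (auto intro!: twist_intros)
  then show ?thesis by (simp add: twist_sw)
qed

text \<open>In \<open>f(a\<^sup>(\<^sup>1\<^sup>) b) a\<^sup>(\<^sup>2\<^sup>) = \<alpha>(a\<^sup>(\<^sup>1\<^sup>) b\<^sup>(\<^sup>1\<^sup>)) \<pi> S(b\<^sup>(\<^sup>2\<^sup>)) S(a\<^sup>(\<^sup>2\<^sup>)) a\<^sup>(\<^sup>3\<^sup>)\<close> the last two factors cancel.\<close>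

lemma sw_twist_mult:
  assumes a: "a \<in> carrier H" and b: "b \<in> carrier H"
  shows "sw H a (\<lambda>x y. twist (x \<cdot> b) \<cdot> y) = \<alpha> a \<odot>\<^bsub>H\<^esub> twist b"
proof -
  note [intro!] = twist_intros
  note [simp] = a b
  let ?F = "\<lambda>x y z. sw H b (\<lambda>v w. \<alpha> (x \<cdot> v) \<odot>\<^bsub>H\<^esub> ((p \<cdot> S w) \<cdot> (S y \<cdot> z)))"
  have "sw H a (\<lambda>x y. twist (x \<cdot> b) \<cdot> y) = sw H a (\<lambda>r z. sw H r (\<lambda>x y. ?F x y z))"
  proof (rule sw_cong[OF HOL.refl a])
    fix r z assume rz: "r \<in> carrier H" "z \<in> carrier H"
    have "twist (r \<cdot> b) = sw H r (\<lambda>x y. sw H b (\<lambda>v w. \<alpha> (x \<cdot> v) \<odot>\<^bsub>H\<^esub> (p \<cdot> S (y \<cdot> w))))"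
      unfolding twist_sw[OF m_closed[OF rz(1) b]] using rz by (intro sw_mult) auto
    then have "twist (r \<cdot> b) \<cdot> z = sw H r (\<lambda>x y. sw H b
        (\<lambda>v w. (\<alpha> (x \<cdot> v) \<odot>\<^bsub>H\<^esub> (p \<cdot> S (y \<cdot> w))) \<cdot> z))"
      using rz by (simp add: sw_apply[OF hopf_module hopf_module mult_linear(2)] sw_closed
          cong: sw_cong)
    also have "\<dots> = sw H r (\<lambda>x y. ?F x y z)"
      using rz by (intro sw_cong) (auto simp: antipode_mult m_assoc)
    finally show "twist (r \<cdot> b) \<cdot> z = sw H r (\<lambda>x y. ?F x y z)" .
  qed
  also have "\<dots> = sw H a (\<lambda>x r. sw H r (\<lambda>y z. ?F x y z))"
    by (rule sw_coassoc) auto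
  also have "\<dots> = sw H a (\<lambda>x r. eps r \<odot>\<^bsub>H\<^esub>
      sw H b (\<lambda>v w. \<alpha> (x \<cdot> v) \<odot>\<^bsub>H\<^esub> ((p \<cdot> S w) \<cdot> \<one>\<^bsub>H\<^esub>)))"
    by (rule sw_cong[OF HOL.refl a], rule sw_antipode_left) auto
  also have "\<dots> = sw H b (\<lambda>v w. \<alpha> (a \<cdot> v) \<odot>\<^bsub>H\<^esub> ((p \<cdot> S w) \<cdot> \<one>\<^bsub>H\<^esub>))"
    by (rule sw_counit_right) auto
  also have "\<dots> = \<alpha> a \<odot>\<^bsub>H\<^esub> twist b"
    unfolding twist_sw[OF b]
    by (subst sw_scale) (auto intro!: sw_cong simp: smult_assoc1)
  finally show ?thesis .
qed

text \<open>\<open>\<Delta>(f(a)) = \<pi> S(a\<^sup>(\<^sup>2\<^sup>)) \<otimes> f(a\<^sup>(\<^sup>1\<^sup>))\<close>, since \<open>\<pi>\<close> is grouplike and \<open>S\<close> reverses the coproduct.\<close>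

lemma sw_twist:
  assumes N: "module R N" and B: "bilinear N B" and a: "a \<in> carrier H"
  shows "sw N (twist a) B = sw N a (\<lambda>x y. B (p \<cdot> S y) (twist x))"
proof -
  interpret N: module R N by fact
  note [intro!] = twist_intros bilinear_compose[OF B] bilinear_closed[OF B]
  note [simp] = a N
  have "sw N (twist a) B = sw N a (\<lambda>x y. sw N (\<alpha> x \<odot>\<^bsub>H\<^esub> (p \<cdot> S y)) B)"
    unfolding twist_sw[OF a] using linear_sw[OF N B hopf_module linear_ident] by (intro sw_apply) auto
  also have "\<dots> = sw N a (\<lambda>x t. sw N t (\<lambda>z w. \<alpha> x \<odot>\<^bsub>N\<^esub> B (p \<cdot> S w) (p \<cdot> S z)))"
  proof (rule sw_cong[OF HOL.refl a])
    fix x y assume xy: "x \<in> carrier H" "y \<in> carrier H"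
    have bp: "bilinear N (\<lambda>r s. B (p \<cdot> r) (p \<cdot> s))" by auto
    have "sw N (p \<cdot> S y) B = sw N p (\<lambda>u v. sw N (S y) (\<lambda>r s. B (u \<cdot> r) (v \<cdot> s)))"
      using xy by (intro sw_mult[OF N B]) auto
    also have "\<dots> = sw N (S y) (\<lambda>r s. B (p \<cdot> r) (p \<cdot> s))"
      using xy by (intro sw_grouplike[OF N _ p_grouplike]) auto
    also have "\<dots> = sw N y (\<lambda>z w. B (p \<cdot> S w) (p \<cdot> S z))"
      by (rule sw_antipode[OF N bp xy(2)])
    finally have "sw N (\<alpha> x \<odot>\<^bsub>H\<^esub> (p \<cdot> S y)) B =
        \<alpha> x \<odot>\<^bsub>N\<^esub> sw N y (\<lambda>z w. B (p \<cdot> S w) (p \<cdot> S z))"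
      using linear_smult[OF linear_sw[OF N B hopf_module linear_ident], of "\<alpha> x" "p \<cdot> S y"] xy
      by simp
    also have "\<dots> = sw N y (\<lambda>z w. \<alpha> x \<odot>\<^bsub>N\<^esub> B (p \<cdot> S w) (p \<cdot> S z))"
      using xy by (intro sw_scale) auto
    finally show "sw N (\<alpha> x \<odot>\<^bsub>H\<^esub> (p \<cdot> S y)) B =
        sw N y (\<lambda>z w. \<alpha> x \<odot>\<^bsub>N\<^esub> B (p \<cdot> S w) (p \<cdot> S z))" .
  qed
  also have "\<dots> = sw N a (\<lambda>r w. sw N r (\<lambda>x z. \<alpha> x \<odot>\<^bsub>N\<^esub> B (p \<cdot> S w) (p \<cdot> S z)))"
    by (rule sw_coassoc[symmetric]) auto
  also have "\<dots> = sw N a (\<lambda>x y. B (p \<cdot> S y) (twist x))"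
  proof (rule sw_cong[OF HOL.refl a])
    fix r w assume rw: "r \<in> carrier H" "w \<in> carrier H"
    have lin: "(\<lambda>h. B (p \<cdot> S w) h) \<in> linear_maps R H N"
      using rw by (intro bilinear_right[OF B]) auto
    have "B (p \<cdot> S w) (twist r) = sw N r (\<lambda>x z. B (p \<cdot> S w) (\<alpha> x \<odot>\<^bsub>H\<^esub> (p \<cdot> S z)))"
      unfolding twist_sw[OF rw(1)] using rw by (intro sw_apply[OF hopf_module N lin]) auto
    also have "\<dots> = sw N r (\<lambda>x z. \<alpha> x \<odot>\<^bsub>N\<^esub> B (p \<cdot> S w) (p \<cdot> S z))"
      using rw by (intro sw_cong) (auto simp: linear_smult[OF lin])
    finally show "sw N r (\<lambda>x z. \<alpha> x \<odot>\<^bsub>N\<^esub> B (p \<cdot> S w) (p \<cdot> S z)) = B (p \<cdot> S w) (twist r)" ..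
  qed
  finally show ?thesis .
qed

section \<open>Consequences of the square condition\<close>

text \<open>\<open>\<beta> \<circ> f = \<alpha> * (\<beta> \<circ> S)\<close> because \<open>\<beta>(\<pi>) = 1\<close>, and a convolution product of characters is a
  character because the base ring is commutative.\<close>

lemma beta_twist_character: "(\<lambda>x. \<beta> (twist x)) \<in> characters R H"
proof (rule characterI)
  show "(\<lambda>x. \<beta> (twist x)) \<in> linear_maps R H K" by (auto intro!: twist_intros)
  have eq: "\<beta> (twist a) = sw K a (\<lambda>x y. \<alpha> x \<otimes> \<beta> (S y))" if a: "a \<in> carrier H" for a
  proof -
    have "\<beta> (twist a) = sw K a (\<lambda>x y. \<beta> (\<alpha> x \<odot>\<^bsub>H\<^esub> (p \<cdot> S y)))"
      unfolding twist_sw[OF a] using a by (intro sw_apply[where N = K]) (auto intro!: twist_intros)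
    also have "\<dots> = sw K a (\<lambda>x y. \<alpha> x \<otimes> \<beta> (S y))"
      using a by (intro sw_cong) auto
    finally show ?thesis .
  qed
  fix a b assume [simp]: "a \<in> carrier H" "b \<in> carrier H"
  have cl: "sw K a (\<lambda>x y. \<alpha> x \<otimes> \<beta> (S y)) \<in> carrier R" "sw K b (\<lambda>x y. \<alpha> x \<otimes> \<beta> (S y)) \<in> carrier R"
    using sw_closed[of K a] sw_closed[of K b] by simp_all
  have "\<beta> (twist (a \<cdot> b)) = sw K a (\<lambda>x y. sw K b (\<lambda>z w. \<alpha> (x \<cdot> z) \<otimes> \<beta> (S (y \<cdot> w))))"
    unfolding eq[OF m_closed[OF \<open>a \<in> carrier H\<close> \<open>b \<in> carrier H\<close>]]
    by (rule sw_mult) (auto intro!: twist_intros)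
  also have "\<dots> = sw K a (\<lambda>x y. sw K b (\<lambda>z w. (\<alpha> x \<otimes> \<beta> (S y)) \<odot>\<^bsub>K\<^esub> (\<alpha> z \<otimes> \<beta> (S w))))"
    by (intro sw_cong) (auto simp: antipode_mult R.m_ac)
  also have "\<dots> = sw K a (\<lambda>x y. sw K b (\<lambda>z w. \<alpha> z \<otimes> \<beta> (S w)) \<odot>\<^bsub>K\<^esub> (\<alpha> x \<otimes> \<beta> (S y)))"
    using cl by (intro sw_cong, simp, simp, subst sw_scale[symmetric]) (auto simp: R.m_comm)
  also have "\<dots> = sw K b (\<lambda>z w. \<alpha> z \<otimes> \<beta> (S w)) \<odot>\<^bsub>K\<^esub> sw K a (\<lambda>x y. \<alpha> x \<otimes> \<beta> (S y))"
    using cl by (intro sw_scale[symmetric]) auto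
  also have "\<dots> = \<beta> (twist a) \<otimes> \<beta> (twist b)"
    using cl eq by (simp add: R.m_comm)
  finally show "\<beta> (twist (a \<cdot> b)) = \<beta> (twist a) \<otimes> \<beta> (twist b)" .
qed simp

text \<open>The convolution inverse of the character \<open>\<beta> \<circ> f\<close>.\<close>

definition psi :: "'h \<Rightarrow> 'k" where
  "psi a = \<beta> (twist (S a))"

lemma psi: "psi \<in> characters R H"
  using character_antipode[OF beta_twist_character] by (simp add: psi_def[abs_def])

lemmas psi_simps [simp] = character_simps[OF psi]

lemma psi_p [simp]: "psi p = \<one>"
proof -
  have "sw K p (\<lambda>x y. (\<beta> (twist (S x)) \<otimes> \<beta> (twist y)) \<odot>\<^bsub>K\<^esub> \<one>) = (\<beta> (twist (S p)) \<otimes> \<beta> (twist p)) \<odot>\<^bsub>K\<^esub> \<one>"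
    by (rule sw_grouplike[OF base_module _ p_grouplike])
       (auto intro!: linear_intros character_linear[OF beta] linear_twist)
  then show ?thesis
    using sw_character_antipode(1)[OF beta_twist_character base_module p_closed, of \<one>]
    by (simp add: psi_def)
qed

text \<open>The left-hand side is \<open>(\<alpha> * S\<^sub>\<pi> * \<beta>)\<^sup>2\<close>, as one sees by applying the formula for \<open>\<Delta>(f(a))\<close> to
  the outer of the two maps.\<close>

lemma CM_theta:
  assumes a: "a \<in> carrier H"
  shows "sw H a (\<lambda>x y. \<beta> (twist x) \<odot>\<^bsub>H\<^esub> theta y) = a"
proof -
  note [intro!] = twist_intros
  note [simp] = a
  let ?T = "\<lambda>a. sw H a (\<lambda>x y. \<beta> y \<odot>\<^bsub>H\<^esub> twist x)"
  have T: "twisted_conv H p \<alpha> \<beta> b = ?T b" if "b \<in> carrier H" for b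
  proof -
    have "bilinear H (\<lambda>x y. \<beta> y \<odot>\<^bsub>H\<^esub> twist x)" by auto
    from sw_lift[OF hopf_module this that] show ?thesis
      by (simp add: twisted_conv_def convolution_def[of H H "\<lambda>x c. c \<odot>\<^bsub>H\<^esub> x"] flip: twist_def)
  qed
  have lin: "(\<lambda>b. ?T b) \<in> linear_maps R H H" by auto
  have Tc: "?T b \<in> carrier H" if "b \<in> carrier H" for b using linear_closed[OF lin that] .
  have "twisted_conv H p \<alpha> \<beta> (twisted_conv H p \<alpha> \<beta> a) = a"
    using CM by (simp add: condition_CM_def)
  then have "a = ?T (?T a)"
    unfolding T[OF a] T[OF Tc[OF a]] by (rule HOL.sym)
  also have "\<dots> = sw H a (\<lambda>x y. ?T (\<beta> y \<odot>\<^bsub>H\<^esub> twist x))"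
    by (rule sw_apply[OF hopf_module hopf_module lin]) auto
  also have "\<dots> = sw H a (\<lambda>r z. sw H r (\<lambda>x y. \<beta> z \<odot>\<^bsub>H\<^esub> (\<beta> (twist x) \<odot>\<^bsub>H\<^esub> twist (p \<cdot> S y))))"
  proof (rule sw_cong[OF HOL.refl a])
    fix r z assume rz: "r \<in> carrier H" "z \<in> carrier H"
    have "?T (twist r) = sw H r (\<lambda>x y. \<beta> (twist x) \<odot>\<^bsub>H\<^esub> twist (p \<cdot> S y))"
      using rz by (intro sw_twist) auto
    then show "?T (\<beta> z \<odot>\<^bsub>H\<^esub> twist r) =
        sw H r (\<lambda>x y. \<beta> z \<odot>\<^bsub>H\<^esub> (\<beta> (twist x) \<odot>\<^bsub>H\<^esub> twist (p \<cdot> S y)))"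
      using rz linear_smult[OF lin, of "\<beta> z" "twist r"] by (simp, intro sw_scale) auto
  qed
  also have "\<dots> = sw H a (\<lambda>x r. sw H r (\<lambda>y z. \<beta> z \<odot>\<^bsub>H\<^esub> (\<beta> (twist x) \<odot>\<^bsub>H\<^esub> twist (p \<cdot> S y))))"
    by (rule sw_coassoc) auto
  also have "\<dots> = sw H a (\<lambda>x y. \<beta> (twist x) \<odot>\<^bsub>H\<^esub> theta y)"
    unfolding theta_def
    by (rule sw_cong[OF HOL.refl a], subst sw_scale)
       (auto intro!: sw_cong simp: smult_assoc1[symmetric] R.m_comm)
  finally show ?thesis ..
qed

text \<open>Convolve \<open>(\<beta> \<circ> f) * \<theta> = id\<close> with \<open>\<psi>\<close> from the left.\<close>

lemma theta_psi:
  assumes a: "a \<in> carrier H"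
  shows "sw H a (\<lambda>x y. psi x \<odot>\<^bsub>H\<^esub> y) = theta a"
proof -
  note [intro!] = twist_intros character_linear[OF psi]
  note [simp] = a
  have "sw H a (\<lambda>x y. psi x \<odot>\<^bsub>H\<^esub> y) =
      sw H a (\<lambda>x r. sw H r (\<lambda>y z. psi x \<odot>\<^bsub>H\<^esub> (\<beta> (twist y) \<odot>\<^bsub>H\<^esub> theta z)))"
    by (intro sw_cong[OF HOL.refl a], subst sw_scale[symmetric]) (auto simp: CM_theta)
  also have "\<dots> = sw H a (\<lambda>r z. sw H r (\<lambda>x y. psi x \<odot>\<^bsub>H\<^esub> (\<beta> (twist y) \<odot>\<^bsub>H\<^esub> theta z)))"
    by (rule sw_coassoc[symmetric]) auto
  also have "\<dots> = sw H a (\<lambda>r z. eps r \<odot>\<^bsub>H\<^esub> theta z)"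
    using sw_character_antipode(1)[OF beta_twist_character hopf_module]
    by (intro sw_cong[OF HOL.refl a]) (auto simp: psi_def smult_assoc1 cong: sw_cong)
  also have "\<dots> = theta a" by (rule sw_counit_left) auto
  finally show ?thesis .
qed

text \<open>As \<open>\<psi>(\<pi>) = 1\<close>, one has \<open>\<theta>(f(a)) = \<psi>(S(a\<^sup>(\<^sup>2\<^sup>))) f(a\<^sup>(\<^sup>1\<^sup>))\<close>, and \<open>\<psi>(S(a\<^sup>(\<^sup>2\<^sup>))) \<psi>(a\<^sup>(\<^sup>3\<^sup>))\<close> cancels.\<close>

lemma sw_psi_theta_twist:
  assumes a: "a \<in> carrier H"
  shows "sw H a (\<lambda>x y. psi y \<odot>\<^bsub>H\<^esub> theta (twist x)) = twist a"
proof -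
  note [intro!] = twist_intros character_linear[OF psi]
  note [simp] = a
  have th: "theta (twist x) = sw H x (\<lambda>u v. psi (S v) \<odot>\<^bsub>H\<^esub> twist u)" if x: "x \<in> carrier H" for x
  proof -
    have "theta (twist x) = sw H (twist x) (\<lambda>x y. psi x \<odot>\<^bsub>H\<^esub> y)" using x by (simp add: theta_psi)
    also have "\<dots> = sw H x (\<lambda>u v. psi (p \<cdot> S v) \<odot>\<^bsub>H\<^esub> twist u)"
      using x by (intro sw_twist) auto
    also have "\<dots> = sw H x (\<lambda>u v. psi (S v) \<odot>\<^bsub>H\<^esub> twist u)"
      using x by (intro sw_cong) auto
    finally show ?thesis .
  qed
  have "sw H a (\<lambda>x y. psi y \<odot>\<^bsub>H\<^esub> theta (twist x)) =
      sw H a (\<lambda>r z. sw H r (\<lambda>x y. psi z \<odot>\<^bsub>H\<^esub> (psi (S y) \<odot>\<^bsub>H\<^esub> twist x)))"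
    by (intro sw_cong[OF HOL.refl a], subst sw_scale[symmetric]) (auto simp: th)
  also have "\<dots> = sw H a (\<lambda>x r. sw H r (\<lambda>y z. psi z \<odot>\<^bsub>H\<^esub> (psi (S y) \<odot>\<^bsub>H\<^esub> twist x)))"
    by (rule sw_coassoc) auto
  also have "\<dots> = sw H a (\<lambda>x r. sw H r (\<lambda>y z. (psi (S y) \<otimes> psi z) \<odot>\<^bsub>H\<^esub> twist x))"
    by (intro sw_cong) (auto simp: smult_assoc1[symmetric] R.m_comm)
  also have "\<dots> = sw H a (\<lambda>x r. eps r \<odot>\<^bsub>H\<^esub> twist x)"
    by (intro sw_cong[OF HOL.refl a] sw_character_antipode(1)[OF psi hopf_module]) auto
  also have "\<dots> = twist a" by (rule sw_counit_right) auto
  finally show ?thesis .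
qed

end

section \<open>Merging and inserting entries of tuples\<close>

context hopf_algebra
begin

text \<open>The tuples that occur in the inner faces and in the degeneracies.  The recursive equations
  below reduce the simplicial identities between them to induction on the position.\<close>

definition merge :: "nat \<Rightarrow> 'h list \<Rightarrow> 'h list" where
  "merge k w = take k w @ [w ! k \<cdot> w ! Suc k] @ drop (Suc (Suc k)) w"

definition insert_one :: "nat \<Rightarrow> 'h list \<Rightarrow> 'h list" where
  "insert_one k w = take k w @ [\<one>\<^bsub>H\<^esub>] @ drop k w"

lemma merge_simps [simp]:
  "merge 0 (a # b # w) = (a \<cdot> b) # w"
  "merge (Suc k) (a # w) = a # merge k w"
  by (simp_all add: merge_def)

lemma insert_one_simps [simp]:
  "insert_one 0 w = \<one>\<^bsub>H\<^esub> # w"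
  "insert_one (Suc k) (a # w) = a # insert_one k w"
  by (simp_all add: insert_one_def)

lemma merge_tuples: "w \<in> tuples H (Suc n) \<Longrightarrow> k < n \<Longrightarrow> merge k w \<in> tuples H n"
proof (induction k arbitrary: n w)
  case 0
  then show ?case by (cases n) (auto simp: tuples_Suc)
next
  case (Suc k)
  then obtain m x u where "n = Suc m" "k < m" "w = x # u" "x \<in> carrier H" "u \<in> tuples H (Suc m)"
    by (cases n) (auto simp: tuples_Suc[of _ _ "Suc _"])
  then show ?case using Suc.IH[of u m] by simp
qed

lemma insert_one_tuples: "w \<in> tuples H n \<Longrightarrow> k \<le> n \<Longrightarrow> insert_one k w \<in> tuples H (Suc n)"
proof (induction k arbitrary: n w)
  case (Suc k)
  then obtain m x u where "n = Suc m" "k \<le> m" "w = x # u" "x \<in> carrier H" "u \<in> tuples H m"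
    by (cases n) (auto simp: tuples_Suc)
  then show ?case using Suc.IH[of u m] by simp
qed simp

lemma merge_merge:
  "w \<in> tuples H n \<Longrightarrow> Suc (Suc l) < n \<Longrightarrow> i \<le> l \<Longrightarrow> merge i (merge (Suc l) w) = merge l (merge i w)"
proof (induction i arbitrary: l n w)
  case 0
  then obtain a b c v where "w = a # b # c # v" "a \<in> carrier H" "b \<in> carrier H" "c \<in> carrier H"
    by (auto simp: tuples_Suc dest!: less_imp_Suc_add)
  then show ?case by (cases l) (auto simp: m_assoc)
next
  case (Suc i)
  then show ?case by (cases l; cases n) (auto simp: tuples_Suc)
qed

lemma insert_one_insert_one:
  "j \<le> length w \<Longrightarrow> i \<le> j \<Longrightarrow> insert_one i (insert_one j w) = insert_one (Suc j) (insert_one i w)"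
proof (induction i arbitrary: j w)
  case (Suc i)
  then show ?case by (cases j; cases w) auto
qed simp

lemma merge_insert_one_less:
  "Suc j \<le> length w \<Longrightarrow> i < j \<Longrightarrow> merge i (insert_one (Suc j) w) = insert_one j (merge i w)"
proof (induction i arbitrary: j w)
  case 0
  then obtain j' a b v where "j = Suc j'" "w = a # b # v"
    by (cases j; cases w; cases "tl w") auto
  then show ?case by simp
next
  case (Suc i)
  then show ?case by (cases j; cases w) auto
qed

lemma merge_insert_one_same:
  "w \<in> tuples H n \<Longrightarrow> j < n \<Longrightarrow> merge j (insert_one j w) = w"
  "w \<in> tuples H n \<Longrightarrow> j < n \<Longrightarrow> merge j (insert_one (Suc j) w) = w"
proof (induction j arbitrary: n w)
  case 0
  { case 1 then show ?case by (auto simp: gr0_conv_Suc tuples_Suc) }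
  { case 2 then show ?case by (auto simp: gr0_conv_Suc tuples_Suc) }
next
  case (Suc j)
  { case 1 then show ?case using Suc.IH(1)[of _ "n - 1"] by (cases n) (auto simp: tuples_Suc) }
  { case 2 then show ?case using Suc.IH(2)[of _ "n - 1"] by (cases n) (auto simp: tuples_Suc) }
qed

lemma merge_insert_one_greater:
  "Suc i < length w \<Longrightarrow> j \<le> i \<Longrightarrow> merge (Suc i) (insert_one j w) = insert_one j (merge i w)"
proof (induction j arbitrary: i w)
  case (Suc j)
  then show ?case by (cases i; cases w) auto
qed simp

lemma merge_snoc:
  "Suc k < length w \<Longrightarrow> merge k (w @ [c]) = merge k w @ [c]"
  "merge (length w) (w @ [b, c]) = w @ [b \<cdot> c]"
  by (simp_all add: merge_def nth_append)

lemma insert_one_snoc: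
  "k \<le> length w \<Longrightarrow> insert_one k (w @ [c]) = insert_one k w @ [c]"
  "insert_one (length w) w = w @ [\<one>\<^bsub>H\<^esub>]"
  by (simp_all add: insert_one_def)

lemma multilinear_merge:
  "multilinear R H N n G \<Longrightarrow> k < n \<Longrightarrow> multilinear R H N (Suc n) (\<lambda>w. G (merge k w))"
proof (induction k arbitrary: n G)
  case 0
  then obtain m where n: "n = Suc m" by (auto simp: gr0_conv_Suc)
  have lin: "(\<lambda>x. G (f x # w)) \<in> linear_maps R H N"
    if "w \<in> tuples H m" "f \<in> linear_maps R H H" for w f
  proof -
    have "(\<lambda>x. G (x # w)) \<in> linear_maps R H N"
      using 0(1) n that(1) by (simp add: multilinear_Suc)
    from linear_compose[OF this that(2)] show ?thesis .
  qed
  have "(\<lambda>x. G (merge 0 (x # w))) \<in> linear_maps R H N" if "w \<in> tuples H (Suc m)" for w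
    using that by (auto simp: tuples_Suc intro!: lin linear_intros)
  then show ?case unfolding n
    using 0(1) n by (auto simp: multilinear_Suc intro!: lin linear_intros)
next
  case (Suc k)
  then obtain m where n: "n = Suc m" "k < m" by (auto dest: Suc_lessE)
  have "multilinear R H N (Suc m) (\<lambda>w. G (x # merge k w))" if "x \<in> carrier H" for x
    using Suc n that by (auto simp: multilinear_Suc)
  moreover have "(\<lambda>x. G (x # merge k w)) \<in> linear_maps R H N" if "w \<in> tuples H (Suc m)" for w
    using Suc.prems n merge_tuples[OF that] by (simp add: multilinear_Suc)
  ultimately show ?case
    unfolding n(1) by (subst multilinear_Suc) simp
qed

lemma multilinear_insert_one:
  "multilinear R H N (Suc n) G \<Longrightarrow> k \<le> n \<Longrightarrow> multilinear R H N n (\<lambda>w. G (insert_one k w))"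
proof (induction k arbitrary: n G)
  case 0
  then show ?case by (simp add: multilinear_Suc)
next
  case (Suc k)
  then obtain m where n: "n = Suc m" "k \<le> m" by (cases n) auto
  have "multilinear R H N m (\<lambda>w. G (x # insert_one k w))" if "x \<in> carrier H" for x
    using Suc.prems n that by (intro Suc.IH) (auto simp: multilinear_Suc[of _ _ _ "Suc m"])
  moreover have "(\<lambda>x. G (x # insert_one k w)) \<in> linear_maps R H N" if "w \<in> tuples H m" for w
    using Suc.prems n insert_one_tuples[OF that] by (simp add: multilinear_Suc[of _ _ _ "Suc m"])
  ultimately show ?case
    unfolding n(1) by (subst multilinear_Suc) simp
qed

lemma multilinear_last:
  "colinear N n G \<Longrightarrow> multilinear R H N (Suc n) (\<lambda>w. G (w ! n) (take n w))"
proof (induction n arbitrary: G)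
  case 0
  then show ?case
    using colinear_head[OF 0 linear_ident, of "[]"] colinear_closed[OF 0]
    by (auto simp: multilinear_Suc multilinear_0)
next
  case (Suc n)
  have "multilinear R H N (Suc n) (\<lambda>w. G (w ! n) (x # take n w))" if "x \<in> carrier H" for x
    using colinear_Cons[OF Suc.prems linear_ident that] by (rule Suc.IH)
  moreover have "(\<lambda>x. G (w ! n) (x # take n w)) \<in> linear_maps R H N"
    if w: "w \<in> tuples H (Suc n)" for w
    using tuples_nth[OF w, of n] w
    by (intro colinear_second[OF Suc.prems linear_ident]) (auto simp: tuples_def dest: in_set_takeD)
  ultimately show ?case by (subst multilinear_Suc) simp
qed

text \<open>Merging entries commutes with the coaction because \<open>\<Delta>\<close> is multiplicative, inserting
  units because \<open>\<Delta>\<close> is unital.\<close>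

lemma coact_merge:
  "\<lbrakk>as \<in> tuples H (Suc n); k < n; module R N; colinear N n F\<rbrakk> \<Longrightarrow>
    coact N (merge k as) F = coact N as (\<lambda>x zs. F x (merge k zs))"
proof (induction k arbitrary: n as F)
  case 0
  note N = \<open>module R N\<close> and F = \<open>colinear N n F\<close>
  from 0 obtain a b vs m where n: "n = Suc m" and as: "as = a # b # vs"
    and [simp]: "a \<in> carrier H" "b \<in> carrier H" "vs \<in> tuples H m"
    by (auto simp: gr0_conv_Suc tuples_Suc)
  note F = F[unfolded n]
  note [intro!] = linear_intros colinear_head[OF F] colinear_second[OF F] colinear_closed[OF F]
  have "coact N ((a \<cdot> b) # vs) F = sw N a (\<lambda>x y. sw N b (\<lambda>u v. coact N vs
      (\<lambda>z zs. F ((x \<cdot> u) \<cdot> z) ((y \<cdot> v) # zs))))"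
    unfolding coact.simps using N
    by (intro sw_mult[OF N] bilinearI linear_coact_body[of vs m]) auto
  also have "\<dots> = coact N (a # b # vs) (\<lambda>x zs. F x (merge 0 zs))"
    by (auto intro!: sw_cong coact_cong[of vs m] simp: m_assoc)
  finally show ?case by (simp add: as)
next
  case (Suc k)
  then obtain c us m where n: "n = Suc m" "k < m" and as: "as = c # us"
    and c: "c \<in> carrier H" and us: "us \<in> tuples H (Suc m)"
    by (cases n) (auto simp: tuples_Suc[of _ _ "Suc _"])
  have "colinear N m (\<lambda>z zs. F (x \<cdot> z) (y # zs))" if "x \<in> carrier H" "y \<in> carrier H" for x y
    using that Suc.prems by (intro colinear_Cons[of N m F]) (auto intro!: linear_intros simp: n)
  then show ?case using c Suc.prems(3) unfolding as
    by (auto intro!: sw_cong simp: Suc.IH[OF us n(2)])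
qed

lemma coact_insert_one:
  "\<lbrakk>as \<in> tuples H n; k \<le> n; module R N; colinear N (Suc n) F\<rbrakk> \<Longrightarrow>
    coact N (insert_one k as) F = coact N as (\<lambda>x zs. F x (insert_one k zs))"
proof (induction k arbitrary: n as F)
  case 0
  note N = \<open>module R N\<close> and F = \<open>colinear N (Suc n) F\<close>
  note [intro!] = linear_intros colinear_head[OF F] colinear_second[OF F] colinear_closed[OF F]
  have "coact N (\<one>\<^bsub>H\<^esub> # as) F = coact N as (\<lambda>z zs. F (\<one>\<^bsub>H\<^esub> \<cdot> z) (\<one>\<^bsub>H\<^esub> # zs))"
    unfolding coact.simps using N
    by (intro sw_one[OF N] bilinearI linear_coact_body[OF 0(1)]) auto
  also have "\<dots> = coact N as (\<lambda>x zs. F x (insert_one 0 zs))"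
    by (rule coact_cong[OF 0(1)]) simp
  finally show ?case by simp
next
  case (Suc k)
  then obtain c us m where n: "n = Suc m" "k \<le> m" and as: "as = c # us"
    and c: "c \<in> carrier H" and us: "us \<in> tuples H m"
    by (cases n) (auto simp: tuples_Suc)
  have "colinear N (Suc m) (\<lambda>z zs. F (x \<cdot> z) (y # zs))"
    if "x \<in> carrier H" "y \<in> carrier H" for x y
    using that Suc.prems by (intro colinear_Cons[of N "Suc m" F]) (auto intro!: linear_intros simp: n)
  then show ?case using c Suc.prems(3) unfolding as
    by (auto intro!: sw_cong simp: Suc.IH[OF us n(2)])
qed

section \<open>The threefold coproduct of a tuple\<close>

text \<open>The entries of \<open>w\<close> are read as the rows of an \<open>n \<times> 3\<close> matrix; \<open>P\<close> receives the products of
  the first two columns and the third column itself.\<close>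

definition columns :: "('h \<Rightarrow> 'h \<Rightarrow> 'h list \<Rightarrow> 'b) \<Rightarrow> nat \<Rightarrow> 'h list \<Rightarrow> 'b" where
  "columns P n w = P (list_prod H (map (\<lambda>i. w ! (3 * i)) [0..<n]))
     (list_prod H (map (\<lambda>i. w ! (3 * i + 1)) [0..<n])) (map (\<lambda>i. w ! (3 * i + 2)) [0..<n])"

lemma columns_0: "columns P 0 w = P \<one>\<^bsub>H\<^esub> \<one>\<^bsub>H\<^esub> []"
  by (simp add: columns_def list_prod_def)

lemma columns_Suc:
  "columns P (Suc n) (x # y # z # w) = columns (\<lambda>u v ys. P (x \<cdot> u) (y \<cdot> v) (z # ys)) n w"
proof -
  have "(x # y # z # w) ! (3 * Suc i) = w ! (3 * i)"
    "(x # y # z # w) ! (3 * Suc i + 1) = w ! (3 * i + 1)"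
    "(x # y # z # w) ! (3 * Suc i + 2) = w ! (3 * i + 2)" for i
    by simp_all
  then show ?thesis
    unfolding columns_def list_prod_def map_upt_Suc by simp
qed

definition bicolinear ::
  "('k, 'b, 'n) module_scheme \<Rightarrow> nat \<Rightarrow> ('h \<Rightarrow> 'h \<Rightarrow> 'h list \<Rightarrow> 'b) \<Rightarrow> bool" where
  "bicolinear N n P \<longleftrightarrow> (\<forall>q\<in>carrier H. colinear N n (\<lambda>p zs. P p q zs)) \<and>
     (\<forall>p\<in>carrier H. colinear N n (\<lambda>q zs. P p q zs))"

lemma bicolinearD:
  assumes "bicolinear N n P"
  shows "q \<in> carrier H \<Longrightarrow> colinear N n (\<lambda>p zs. P p q zs)"
    "p \<in> carrier H \<Longrightarrow> colinear N n (\<lambda>q zs. P p q zs)"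
  using assms by (simp_all add: bicolinear_def)

lemma bicolinear_Cons:
  assumes "bicolinear N (Suc n) P" "x \<in> carrier H" "y \<in> carrier H" "z \<in> carrier H"
  shows "bicolinear N n (\<lambda>u v ys. P (x \<cdot> u) (y \<cdot> v) (z # ys))"
  unfolding bicolinear_def using assms(2-4)
  by (auto intro!: colinear_Cons[OF bicolinearD(1)[OF assms(1)]]
      colinear_Cons[OF bicolinearD(2)[OF assms(1)]] linear_intros)

lemma list_prod_columns_closed:
  assumes "w \<in> tuples H (3 * n)"
  shows "list_prod H (map (\<lambda>i. w ! (3 * i)) [0..<n]) \<in> carrier H"
    "list_prod H (map (\<lambda>i. w ! (3 * i + 1)) [0..<n]) \<in> carrier H"
    "map (\<lambda>i. w ! (3 * i + 2)) [0..<n] \<in> tuples H n"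
proof -
  have lp: "list_prod H us \<in> carrier H" if "set us \<subseteq> carrier H" for us
    using that unfolding list_prod_def by (induction us) auto
  show "list_prod H (map (\<lambda>i. w ! (3 * i)) [0..<n]) \<in> carrier H"
    "list_prod H (map (\<lambda>i. w ! (3 * i + 1)) [0..<n]) \<in> carrier H"
    "map (\<lambda>i. w ! (3 * i + 2)) [0..<n] \<in> tuples H n"
    using tuples_nth[OF assms] by (auto intro!: lp simp: tuples_def)
qed

lemma columns_multilinear:
  "bicolinear N n P \<Longrightarrow> multilinear R H N (3 * n) (columns P n)"
proof (induction n arbitrary: P)
  case 0
  then show ?case
    using colinear_closed[OF bicolinearD(1)[OF 0]]
    by (simp add: multilinear_0 columns_0)
next
  case (Suc n)
  have eq: "3 * Suc n = Suc (Suc (Suc (3 * n)))" by simp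
  note P1 = bicolinearD(1)[OF Suc.prems] and P2 = bicolinearD(2)[OF Suc.prems]
  show ?case
    unfolding eq multilinear_Suc
  proof (intro conjI ballI)
    show "(\<lambda>x. columns P (Suc n) (x # w)) \<in> linear_maps R H N" if w: "w \<in> tuples H (Suc (Suc (3 * n)))" for w
    proof -
      obtain y z v where [simp]: "w = y # z # v" "y \<in> carrier H" "z \<in> carrier H" "v \<in> tuples H (3 * n)"
        using w by (auto simp: tuples_Suc)
      show ?thesis unfolding \<open>w = _\<close> columns_Suc unfolding columns_def
        using list_prod_columns_closed[of v n]
        by (auto intro!: colinear_head[OF P1] linear_intros)
    qed
    fix x assume x: "x \<in> carrier H"
    show "(\<lambda>y. columns P (Suc n) (x # y # w)) \<in> linear_maps R H N" if w: "w \<in> tuples H (Suc (3 * n))" for w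
    proof -
      obtain z v where [simp]: "w = z # v" "z \<in> carrier H" "v \<in> tuples H (3 * n)"
        using w by (auto simp: tuples_Suc)
      show ?thesis unfolding \<open>w = _\<close> columns_Suc unfolding columns_def
        using list_prod_columns_closed[of v n] x
        by (auto intro!: colinear_head[OF P2] linear_intros)
    qed
    fix y assume y: "y \<in> carrier H"
    show "(\<lambda>z. columns P (Suc n) (x # y # z # w)) \<in> linear_maps R H N" if w: "w \<in> tuples H (3 * n)" for w
      unfolding columns_Suc unfolding columns_def
      using list_prod_columns_closed[OF w] x y
      by (auto intro!: colinear_second[OF P1] linear_intros)
    fix z assume z: "z \<in> carrier H"
    show "multilinear R H N (3 * n) (\<lambda>w. columns P (Suc n) (x # y # z # w))"
      unfolding columns_Suc by (rule Suc.IH[OF bicolinear_Cons[OF Suc.prems x y z]])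
  qed
qed

lemma comult3_closed: "a \<in> carrier H \<Longrightarrow> comult3 R H a \<in> carrier (T 3)"
  unfolding comult3_sw[of a]
  using bilinear_closed[OF comult3_multilinear(1)] by (auto simp: comult3_sw)

lemma comult3_list_closed: "as \<in> tuples H n \<Longrightarrow> comult3_list R H as \<in> carrier (T (3 * n))"
proof (induction rule: tuples_induct)
  case Nil
  then show ?case by (simp add: pure_closed)
next
  case (Cons n a as)
  then show ?case
    using tensor_concat_closed[OF comult3_closed[of a] Cons.IH] tuples_length[of as H n] by simp
qed

text \<open>Because \<open>\<Delta>\<close> is multiplicative, the coproducts of the single entries assemble to the
  coproduct of the product \<open>x\<close> of their first components.\<close>

lemma lift_comult3_list:
  assumes "as \<in> tuples H n" and N: "module R N" and P: "bicolinear N n P"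
  shows "tensor_lift N (columns P n) (comult3_list R H as) =
    coact N as (\<lambda>x ys. sw N x (\<lambda>u v. P u v ys))"
  using assms(1) P
proof (induction arbitrary: P rule: tuples_induct)
  case Nil
  note P1 = bicolinearD(1)[OF Nil] and P2 = bicolinearD(2)[OF Nil]
  have "bilinear N (\<lambda>u v. P u v [])"
    by (intro bilinearI colinear_head[OF P1 linear_ident] colinear_head[OF P2 linear_ident]) auto
  then show ?case
    using tensor_lift_pure[OF N columns_multilinear[OF Nil], of "[]"]
    by (simp add: sw_one[OF N] columns_0[of P "[]"])
next
  case (Cons n a as)
  note [simp] = N Cons.hyps
  note P1 = bicolinearD(1)[OF Cons.prems] and P2 = bicolinearD(2)[OF Cons.prems]
  note [intro!] = linear_intros colinear_head[OF P1] colinear_head[OF P2] colinear_second[OF P1]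
    colinear_closed[OF P1] linear_coact_body[OF Cons.hyps(2)] coact_closed[OF Cons.hyps(2)]
  let ?F = "\<lambda>x y z. coact N as (\<lambda>s ys. sw N s (\<lambda>u v. P (x \<cdot> u) (y \<cdot> v) (z # ys)))"
  have ml: "multilinear R H N (3 + 3 * n) (columns P (Suc n))"
    using columns_multilinear[OF Cons.prems] by simp
  have tri: "trilinear N ?F" unfolding trilinear_def by auto
  have "tensor_lift N (columns P (Suc n)) (comult3_list R H (a # as)) =
      tensor_lift N (\<lambda>w. tensor_lift N (\<lambda>z. columns P (Suc n) (w @ z)) (comult3_list R H as)) (comult3 R H a)"
    using tensor_lift_concat[OF N ml comult3_closed[of a] comult3_list_closed[OF Cons.hyps(2)]]
      tuples_length[OF Cons.hyps(2)] by simp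
  also have "\<dots> = tensor_lift N (\<lambda>w. ?F (w ! 0) (w ! 1) (w ! 2)) (comult3 R H a)"
  proof (rule tensor_lift_cong[OF N trilinear_multilinear[OF tri] _ comult3_closed, symmetric])
    fix w assume "w \<in> tuples H 3"
    then obtain x y z where [simp]: "w = [x, y, z]" "x \<in> carrier H" "y \<in> carrier H" "z \<in> carrier H"
      by (auto simp: numeral_3_eq_3 tuples_Suc)
    show "?F (w ! 0) (w ! 1) (w ! 2) =
        tensor_lift N (\<lambda>z. columns P (Suc n) (w @ z)) (comult3_list R H as)"
      using Cons.IH[OF bicolinear_Cons[OF Cons.prems, of x y z]] by (simp add: columns_Suc)
  qed simp
  also have "\<dots> = sw N a (\<lambda>r z. sw N r (\<lambda>x y. ?F x y z))"
    by (rule lift_comult3[OF N tri]) simp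
  also have "\<dots> = coact N (a # as) (\<lambda>x ys. sw N x (\<lambda>u v. P u v ys))"
    unfolding coact.simps
  proof (rule sw_cong[OF HOL.refl Cons.hyps(1)])
    fix r z assume rz: "r \<in> carrier H" "z \<in> carrier H"
    have "sw N r (\<lambda>x y. ?F x y z) = coact N as (\<lambda>s ys. sw N r (\<lambda>x y. sw N s
        (\<lambda>u v. P (x \<cdot> u) (y \<cdot> v) (z # ys))))"
      using rz by (intro coact_sw_swap[OF Cons.hyps(2), symmetric]) auto
    also have "\<dots> = coact N as (\<lambda>s ys. sw N (r \<cdot> s) (\<lambda>u v. P u v (z # ys)))"
      using rz by (intro coact_cong[OF Cons.hyps(2)] sw_mult[symmetric]) auto
    finally show "sw N r (\<lambda>x y. ?F x y z) =
      coact N as (\<lambda>s ys. sw N (r \<cdot> s) (\<lambda>u v. P u v (z # ys)))" .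
  qed
  finally show ?case .
qed

end

section \<open>The extra degeneracy\<close>

context hopf_algebra
begin

lemma pure_Cons_multilinear:
  "c \<in> carrier H \<Longrightarrow> multilinear R H (T (Suc n)) n (\<lambda>ys. pure R H (c # ys))"
  using pure_multilinear[of "Suc n"] by (simp add: multilinear_Suc)

lemma pure_Cons_Cons_multilinear:
  "\<lbrakk>b \<in> carrier H; c \<in> carrier H\<rbrakk> \<Longrightarrow>
    multilinear R H (T (Suc (Suc n))) n (\<lambda>ys. pure R H (b # c # ys))"
  using pure_multilinear[of "Suc (Suc n)"] by (simp add: multilinear_Suc)

lemma pure_Cons_colinear:
  assumes "f \<in> linear_maps R H H"
  shows "colinear (T (Suc n)) n (\<lambda>x ys. pure R H (f x # ys))"
  using assms
  by (auto intro!: colinearI pure_linear_0 pure_Cons_multilinear simp: linear_closed[OF assms])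

lemma scaled_colinear:
  assumes "module R N" "multilinear R H N n G" "f \<in> linear_maps R H K"
  shows "colinear N n (\<lambda>x ys. f x \<odot>\<^bsub>N\<^esub> G ys)"
proof (rule colinearI)
  show "(\<lambda>x. f x \<odot>\<^bsub>N\<^esub> G zs) \<in> linear_maps R H N" if "zs \<in> tuples H n" for zs
    by (rule linear_coeff[OF assms(1,3) multilinear_closed[OF assms(2) that]])
  show "multilinear R H N n (\<lambda>zs. f x \<odot>\<^bsub>N\<^esub> G zs)" if "x \<in> carrier H" for x
    using linear_closed[OF assms(3) that]
    by (intro multilinear_compose[OF linear_scale[OF assms(1) linear_ident] assms(2)]) simp
qed

end

context modular_datum
begin

text \<open>The extra degeneracy \<open>J\<close>.\<close>

definition extra :: "nat \<Rightarrow> ('k, 'h) tensor \<Rightarrow> ('k, 'h) tensor" where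
  "extra n = tensor_lift (T (Suc n)) (\<lambda>as. coact (T (Suc n)) as (\<lambda>x ys. pure R H (twist x # ys)))"

lemma twist_colinear: "colinear (T (Suc n)) n (\<lambda>x ys. pure R H (twist x # ys))"
  by (rule pure_Cons_colinear[OF linear_twist[OF hopf_module linear_ident]])

lemma extra_linear: "extra n \<in> linear_maps R (T n) (T (Suc n))"
  unfolding extra_def by (rule tensor_lift_linear[OF tensor_module coact_multilinear[OF tensor_module twist_colinear]])

lemma extra_closed [simp, intro]: "X \<in> carrier (T n) \<Longrightarrow> extra n X \<in> carrier (T (Suc n))"
  by (rule linear_closed[OF extra_linear])

lemma extra_pure:
  "as \<in> tuples H n \<Longrightarrow>
    extra n (pure R H as) = coact (T (Suc n)) as (\<lambda>x ys. pure R H (twist x # ys))"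
  unfolding extra_def
  by (rule tensor_lift_pure[OF tensor_module coact_multilinear[OF tensor_module twist_colinear]])

text \<open>The formula for \<open>\<Delta>(f(x c))\<close> produces \<open>f(\<pi> S(c\<^sup>(\<^sup>2\<^sup>)) S(x\<^sup>(\<^sup>2\<^sup>)) x\<^sup>(\<^sup>3\<^sup>)) \<otimes> f(x\<^sup>(\<^sup>1\<^sup>) c\<^sup>(\<^sup>1\<^sup>))\<close> in the first
  two factors, where \<open>x\<^sup>(\<^sup>3\<^sup>)\<close> stems from the coaction on the remaining entries, and the middle
  terms cancel.  The parameter \<open>c\<close> is \<open>1\<close> for \<open>J J = s\<^sub>0 J\<close> and the last entry of the tuple for
  \<open>J t\<^sub>n\<close>.\<close>

lemma extra_coact:
  assumes bs: "bs \<in> tuples H n" and c: "c \<in> carrier H"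
  defines "N \<equiv> T (Suc (Suc n))"
  shows "coact N bs (\<lambda>x ys. extra (Suc n) (pure R H (twist (x \<cdot> c) # ys))) =
    sw N c (\<lambda>u v. coact N bs (\<lambda>x zs. pure R H (twist (p \<cdot> S v) # twist (x \<cdot> u) # zs)))"
proof -
  have N: "module R N" by (simp add: N_def)
  note [simp] = c N
  note [intro!] = twist_intros linear_coact_body coact_closed
  have cl [simp, intro!]: "pure R H (a # b # zs) \<in> carrier N"
    if "a \<in> carrier H" "b \<in> carrier H" "zs \<in> tuples H n" for a b zs
    using that unfolding N_def by (intro pure_closed) simp
  have l0 [intro!]: "(\<lambda>x. pure R H (f x # b # zs)) \<in> linear_maps R H N"
    if "f \<in> linear_maps R H H" "b \<in> carrier H" "zs \<in> tuples H n" for f b zs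
    using that unfolding N_def by (intro pure_linear_0) simp_all
  have l1 [intro!]: "(\<lambda>x. pure R H (b # f x # zs)) \<in> linear_maps R H N"
    if "f \<in> linear_maps R H H" "b \<in> carrier H" "zs \<in> tuples H n" for f b zs
    using that unfolding N_def by (intro pure_linear_1) simp_all
  let ?F = "\<lambda>u v x q zs. pure R H (twist ((p \<cdot> S v) \<cdot> q) # twist (x \<cdot> u) # zs)"
  have "extra (Suc n) (pure R H (twist (x \<cdot> c) # ys)) =
      sw N c (\<lambda>u v. sw N x (\<lambda>r q. coact N ys (\<lambda>w zs. ?F u v r (S q \<cdot> w) zs)))"
    if x: "x \<in> carrier H" and ys: "ys \<in> tuples H n" for x ys
  proof -
    have "extra (Suc n) (pure R H (twist (x \<cdot> c) # ys)) =
        sw N (twist (x \<cdot> c)) (\<lambda>q r. coact N ys (\<lambda>w zs. pure R H (twist (q \<cdot> w) # r # zs)))"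
      using x ys by (subst extra_pure) (simp_all add: N_def)
    also have "\<dots> = sw N (x \<cdot> c)
        (\<lambda>q r. coact N ys (\<lambda>w zs. pure R H (twist ((p \<cdot> S r) \<cdot> w) # twist q # zs)))"
      using x ys by (intro sw_twist[OF N]) auto
    also have "\<dots> = sw N x (\<lambda>r q. sw N c (\<lambda>u v. coact N ys
        (\<lambda>w zs. pure R H (twist ((p \<cdot> S (q \<cdot> v)) \<cdot> w) # twist (r \<cdot> u) # zs))))"
      using x ys by (intro sw_mult[OF N]) auto
    also have "\<dots> = sw N x (\<lambda>r q. sw N c (\<lambda>u v. coact N ys (\<lambda>w zs. ?F u v r (S q \<cdot> w) zs)))"
      using x ys by (intro sw_cong coact_cong[OF ys]) (auto simp: antipode_mult m_assoc)
    also have "\<dots> = sw N c (\<lambda>u v. sw N x (\<lambda>r q. coact N ys (\<lambda>w zs. ?F u v r (S q \<cdot> w) zs)))"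
      using x ys by (intro sw_swap[OF N]) auto
    finally show ?thesis .
  qed
  then have "coact N bs (\<lambda>x ys. extra (Suc n) (pure R H (twist (x \<cdot> c) # ys))) =
      coact N bs (\<lambda>x ys. sw N c (\<lambda>u v. sw N x (\<lambda>r q. coact N ys (\<lambda>w zs. ?F u v r (S q \<cdot> w) zs))))"
    by (intro coact_cong[OF bs]) auto
  also have "\<dots> = sw N c (\<lambda>u v. coact N bs
      (\<lambda>x ys. sw N x (\<lambda>r q. coact N ys (\<lambda>w zs. ?F u v r (S q \<cdot> w) zs))))"
    by (intro coact_sw_swap[OF bs]) auto
  also have "\<dots> = sw N c (\<lambda>u v. coact N bs (\<lambda>x zs. ?F u v x \<one>\<^bsub>H\<^esub> zs))"
  proof (rule sw_cong[OF HOL.refl c], rule coact_antipode[OF bs N])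
    fix u v q assume "u \<in> carrier H" "v \<in> carrier H" "q \<in> carrier H"
    then show "colinear N n (\<lambda>x zs. ?F u v x q zs)" "colinear N n (\<lambda>x zs. ?F u v q x zs)"
      using pure_Cons_Cons_multilinear[of _ _ n] unfolding N_def[symmetric]
      by (auto intro!: colinearI)
  qed
  also have "\<dots> = sw N c (\<lambda>u v. coact N bs (\<lambda>x zs. pure R H (twist (p \<cdot> S v) # twist (x \<cdot> u) # zs)))"
    by (intro sw_cong coact_cong[OF bs]) auto
  finally show ?thesis .
qed

lemma extra_extra_pure:
  assumes as: "as \<in> tuples H n"
  shows "extra (Suc n) (extra n (pure R H as)) =
    coact (T (Suc (Suc n))) as (\<lambda>x zs. pure R H (\<one>\<^bsub>H\<^esub> # twist x # zs))"
proof -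
  let ?N = "T (Suc (Suc n))"
  have b: "bilinear ?N (\<lambda>u v. coact ?N as (\<lambda>x zs. pure R H (twist (p \<cdot> S v) # twist (x \<cdot> u) # zs)))"
    by (auto intro!: bilinearI linear_coact_body[OF as] twist_intros)
  have "extra (Suc n) (extra n (pure R H as)) =
      coact ?N as (\<lambda>x ys. extra (Suc n) (pure R H (twist (x \<cdot> \<one>\<^bsub>H\<^esub>) # ys)))"
    unfolding extra_pure[OF as]
    by (subst coact_apply[OF as tensor_module tensor_module extra_linear])
       (auto intro!: pure_closed coact_cong[OF as])
  also have "\<dots> = coact ?N as (\<lambda>x zs. pure R H (twist (p \<cdot> S \<one>\<^bsub>H\<^esub>) # twist (x \<cdot> \<one>\<^bsub>H\<^esub>) # zs))"
    by (subst extra_coact[OF as one_closed], subst sw_one[OF tensor_module b]) simp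
  also have "\<dots> = coact ?N as (\<lambda>x zs. pure R H (\<one>\<^bsub>H\<^esub> # twist x # zs))"
    by (rule coact_cong[OF as]) simp
  finally show ?thesis .
qed

definition rotate_theta :: "nat \<Rightarrow> ('k, 'h) tensor \<Rightarrow> ('k, 'h) tensor" where
  "rotate_theta n = tensor_lift (T (Suc n)) (\<lambda>w. pure R H (theta (w ! n) # take n w))"

lemma rotate_theta_multilinear:
  "multilinear R H (T (Suc n)) (Suc n) (\<lambda>w. pure R H (theta (w ! n) # take n w))"
  by (rule multilinear_last[OF pure_Cons_colinear[OF linear_theta[OF hopf_module linear_ident]]])

lemma rotate_theta_linear: "rotate_theta n \<in> linear_maps R (T (Suc n)) (T (Suc n))"
  unfolding rotate_theta_def by (rule tensor_lift_linear[OF tensor_module rotate_theta_multilinear])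

lemma rotate_theta_pure:
  assumes "us \<in> tuples H n" "c \<in> carrier H"
  shows "rotate_theta n (pure R H (us @ [c])) = pure R H (theta c # us)"
proof -
  have n: "n = length us" and w: "us @ [c] \<in> tuples H (Suc n)"
    using assms by (auto simp: tuples_def)
  have "rotate_theta n (pure R H (us @ [c])) =
      pure R H (theta ((us @ [c]) ! n) # take n (us @ [c]))"
    unfolding rotate_theta_def by (rule tensor_lift_pure[OF tensor_module rotate_theta_multilinear w])
  then show ?thesis by (simp add: n)
qed

lemma rotate_theta_power:
  "\<lbrakk>us @ vs \<in> tuples H (Suc n)\<rbrakk> \<Longrightarrow>
    (rotate_theta n ^^ length vs) (pure R H (us @ vs)) = pure R H (map theta vs @ us)"
proof (induction vs arbitrary: us rule: rev_induct)
  case (snoc y vs)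
  then have "us @ vs \<in> tuples H n" "y \<in> carrier H" "(theta y # us) @ vs \<in> tuples H (Suc n)"
    by (auto simp: tuples_def)
  then show ?case
    using rotate_theta_pure[of "us @ vs" n y] snoc.IH[of "theta y # us"]
    by (simp add: funpow_Suc_right del: funpow.simps)
qed simp

text \<open>The power is \<open>\<theta>\<^sup>\<otimes>\<^sup>n\<^sup>+\<^sup>1\<close>.  On the entries \<open>\<theta> = \<psi> * id\<close> is absorbed into one further factor \<open>\<psi>\<close> of
  the coaction, which meets \<open>\<theta> \<circ> f\<close> in the first factor.\<close>

lemma rotate_theta_power_extra:
  assumes X: "X \<in> carrier (T n)"
  shows "(rotate_theta n ^^ Suc n) (extra n X) = extra n X"
proof -
  let ?N = "T (Suc n)"
  have lin: "(rotate_theta n ^^ k) \<in> linear_maps R ?N ?N" for k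
  proof (induction k)
    case 0
    show ?case using linear_ident[of R ?N] by (simp add: id_def)
  next
    case (Suc k)
    show ?case using linear_compose[OF rotate_theta_linear Suc] by (simp add: comp_def)
  qed
  show ?thesis
  proof (rule tensor_ext[OF tensor_module linear_compose[OF lin extra_linear] extra_linear _ X])
    fix as assume as: "as \<in> tuples H n"
    let ?G = "\<lambda>c zs. pure R H (c # zs)"
    note [intro!] = twist_intros character_linear[OF psi] pure_closed
    have "(rotate_theta n ^^ Suc n) (extra n (pure R H as)) =
        coact ?N as (\<lambda>x ys. (rotate_theta n ^^ Suc n) (pure R H (twist x # ys)))"
      unfolding extra_pure[OF as] by (rule coact_apply[OF as _ _ lin]) auto
    also have "\<dots> = coact ?N as (\<lambda>x ys. ?G (theta (twist x)) (map theta ys))"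
    proof (rule coact_cong[OF as])
      fix x ys assume "x \<in> carrier H" "ys \<in> tuples H n"
      then show "(rotate_theta n ^^ Suc n) (pure R H (twist x # ys)) = ?G (theta (twist x)) (map theta ys)"
        using rotate_theta_power[of "[]" "twist x # ys" n] tuples_length[of ys H n] by simp
    qed
    also have "\<dots> = coact ?N as (\<lambda>x ys. coact ?N ys (\<lambda>z zs. psi z \<odot>\<^bsub>?N\<^esub> ?G (theta (twist x)) zs))"
    proof (rule coact_cong[OF as])
      fix x ys assume x: "x \<in> carrier H" and ys: "ys \<in> tuples H n"
      have eq: "map (\<lambda>a. sw H a (\<lambda>x y. psi x \<odot>\<^bsub>H\<^esub> y)) ys = map theta ys"
        using ys by (intro map_cong) (auto simp: theta_psi tuples_def)
      have "coact ?N ys (\<lambda>z zs. psi z \<odot>\<^bsub>?N\<^esub> ?G (theta (twist x)) zs) =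
          ?G (theta (twist x)) (map (\<lambda>a. sw H a (\<lambda>x y. psi x \<odot>\<^bsub>H\<^esub> y)) ys)"
        using x by (intro coact_character[OF ys tensor_module pure_Cons_multilinear psi]) auto
      then show "?G (theta (twist x)) (map theta ys) =
          coact ?N ys (\<lambda>z zs. psi z \<odot>\<^bsub>?N\<^esub> ?G (theta (twist x)) zs)"
        unfolding eq by (rule HOL.sym)
    qed
    also have "\<dots> = coact ?N as (\<lambda>r zs. sw ?N r (\<lambda>x z. psi z \<odot>\<^bsub>?N\<^esub> ?G (theta (twist x)) zs))"
    proof (rule coact_coassoc[OF as tensor_module, symmetric])
      show "colinear ?N n (\<lambda>z zs. psi z \<odot>\<^bsub>?N\<^esub> ?G (theta (twist x)) zs)" if "x \<in> carrier H" for x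
        using that by (intro scaled_colinear pure_Cons_multilinear) auto
      show "colinear ?N n (\<lambda>x zs. psi z \<odot>\<^bsub>?N\<^esub> ?G (theta (twist x)) zs)" if "z \<in> carrier H" for z
      proof (rule colinearI)
        show "multilinear R H ?N n (\<lambda>zs. psi z \<odot>\<^bsub>?N\<^esub> ?G (theta (twist x)) zs)" if "x \<in> carrier H" for x
          using that \<open>z \<in> carrier H\<close>
          by (intro multilinear_compose[OF linear_scale[OF tensor_module linear_ident]]
              pure_Cons_multilinear) auto
      qed (use that in auto)
    qed
    also have "\<dots> = coact ?N as (\<lambda>r zs. ?G (twist r) zs)"
    proof (rule coact_cong[OF as])
      fix r zs assume r: "r \<in> carrier H" and zs: "zs \<in> tuples H n"
      have lin: "(\<lambda>c. ?G c zs) \<in> linear_maps R H ?N" using zs by auto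
      have "sw ?N r (\<lambda>x z. psi z \<odot>\<^bsub>?N\<^esub> ?G (theta (twist x)) zs) =
          sw ?N r (\<lambda>x z. ?G (psi z \<odot>\<^bsub>H\<^esub> theta (twist x)) zs)"
        using r by (intro sw_cong) (auto simp: linear_smult[OF lin])
      also have "\<dots> = ?G (sw H r (\<lambda>x z. psi z \<odot>\<^bsub>H\<^esub> theta (twist x))) zs"
        using r by (intro sw_apply[OF hopf_module tensor_module lin, symmetric]) auto
      finally show "sw ?N r (\<lambda>x z. psi z \<odot>\<^bsub>?N\<^esub> ?G (theta (twist x)) zs) = ?G (twist r) zs"
        using r by (simp add: sw_psi_theta_twist)
    qed
    finally show "(rotate_theta n ^^ Suc n) (extra n (pure R H as)) = extra n (pure R H as)"
      by (simp add: extra_pure[OF as])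
  qed
qed

end

section \<open>The cyclic module\<close>

context modular_datum
begin

text \<open>The defining formula of \<open>t\<^sub>n\<close> contains \<open>\<alpha>(x\<^sup>(\<^sup>1\<^sup>)) S\<^sub>\<pi>(x\<^sup>(\<^sup>2\<^sup>)) = f(x)\<close> for
  \<open>x = a\<^sub>1\<^sup>(\<^sup>1\<^sup>) \<cdots> a\<^sub>n\<^sup>(\<^sup>1\<^sup>)\<close>.\<close>

lemma cyclic_formula:
  assumes as: "as \<in> tuples H n" and n: "1 \<le> n"
  shows "tensor_lift (T n)
            (\<lambda>w. (\<alpha> (list_prod H (map (\<lambda>i. w ! (3 * i)) [0..<n])) \<otimes> \<beta> (w ! (3 * (n - 1) + 2)))
                 \<odot>\<^bsub>T n\<^esub>
                 pure R H (twisted_antipode H p (list_prod H (map (\<lambda>i. w ! (3 * i + 1)) [0..<n])) #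
                           map (\<lambda>i. w ! (3 * i + 2)) [0..<n - 1]))
            (comult3_list R H as) =
    coact (T n) as (\<lambda>x ys. \<beta> (ys ! (n - 1)) \<odot>\<^bsub>T n\<^esub> pure R H (twist x # take (n - 1) ys))"
proof -
  obtain m where m: "n = Suc m" using n by (cases n) auto
  let ?N = "T (Suc m)"
  interpret N: module R ?N by simp
  let ?P = "\<lambda>u v ys. (\<alpha> u \<otimes> \<beta> (ys ! m)) \<odot>\<^bsub>?N\<^esub> pure R H ((p \<cdot> S v) # take m ys)"
  note [intro!] = twist_intros pure_closed
  have take: "take m ys \<in> tuples H m" "ys ! m \<in> carrier H" if "ys \<in> tuples H (Suc m)" for ys
    using that by (auto simp: tuples_def dest: in_set_takeD)
  have ml: "multilinear R H ?N (Suc m) (\<lambda>ys. \<beta> (ys ! m) \<odot>\<^bsub>?N\<^esub> pure R H (c # take m ys))"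
    if "c \<in> carrier H" for c
    using that by (intro multilinear_last[where G = "\<lambda>y ys. \<beta> y \<odot>\<^bsub>?N\<^esub> pure R H (c # ys)"]
        scaled_colinear pure_Cons_multilinear) auto
  have P: "bicolinear ?N (Suc m) ?P"
    unfolding bicolinear_def
  proof (intro conjI ballI colinearI)
    fix u v assume uv: "u \<in> carrier H" "v \<in> carrier H"
    have "multilinear R H ?N (Suc m)
        (\<lambda>ys. \<alpha> u \<odot>\<^bsub>?N\<^esub> (\<beta> (ys ! m) \<odot>\<^bsub>?N\<^esub> pure R H ((p \<cdot> S v) # take m ys)))"
      using uv by (intro multilinear_compose[OF linear_scale[OF tensor_module linear_ident] ml]) auto
    then have "multilinear R H ?N (Suc m) (\<lambda>ys. ?P u v ys)"
      by (rule multilinear_cong[THEN iffD2, OF _ hopf_module, rotated])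
         (use uv in \<open>simp add: take N.smult_assoc1 pure_closed\<close>)
    then show "multilinear R H ?N (Suc m) (\<lambda>ys. ?P u v ys)"
      and "multilinear R H ?N (Suc m) (\<lambda>ys. ?P u v ys)" by simp_all
  qed (auto simp: take)
  have "tensor_lift (T n) (columns ?P (Suc m)) (comult3_list R H as) =
      coact ?N as (\<lambda>x ys. sw ?N x (\<lambda>u v. ?P u v ys))"
    using lift_comult3_list[OF as[unfolded m] tensor_module P] m by simp
  also have "\<dots> = coact ?N as (\<lambda>x ys. \<beta> (ys ! m) \<odot>\<^bsub>?N\<^esub> pure R H (twist x # take m ys))"
  proof (rule coact_cong[OF as[unfolded m]])
    fix x ys assume x: "x \<in> carrier H" and ys: "ys \<in> tuples H (Suc m)"
    have lin: "(\<lambda>c. \<beta> (ys ! m) \<odot>\<^bsub>?N\<^esub> pure R H (c # take m ys)) \<in> linear_maps R H ?N"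
      using take[OF ys] by auto
    have "\<beta> (ys ! m) \<odot>\<^bsub>?N\<^esub> pure R H (twist x # take m ys) =
        sw ?N x (\<lambda>u v. \<beta> (ys ! m) \<odot>\<^bsub>?N\<^esub> pure R H ((\<alpha> u \<odot>\<^bsub>H\<^esub> (p \<cdot> S v)) # take m ys))"
      unfolding twist_sw[OF x] by (rule sw_apply[OF hopf_module tensor_module lin x]) auto
    also have "\<dots> = sw ?N x (\<lambda>u v. ?P u v ys)"
      using x take[OF ys] by (intro sw_cong) (simp_all add: linear_smult[OF lin] N.smult_assoc1 pure_closed)
    finally show "sw ?N x (\<lambda>u v. ?P u v ys) = \<beta> (ys ! m) \<odot>\<^bsub>?N\<^esub> pure R H (twist x # take m ys)" ..
  qed
  finally show ?thesis
    by (simp add: columns_def[abs_def] m twisted_antipode_def take_map nth_append)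
qed

end

locale cyclic_datum = modular_datum R H \<alpha> \<beta> p
  for R :: "('k, 'r) ring_scheme" (structure) and H :: "('k, 'h, 'z) hopf_scheme" (structure)
    and \<alpha> \<beta> :: "'h \<Rightarrow> 'k" and p :: 'h +
  fixes d s :: "nat \<Rightarrow> nat \<Rightarrow> ('k, 'h) tensor \<Rightarrow> ('k, 'h) tensor"
    and t :: "nat \<Rightarrow> ('k, 'h) tensor \<Rightarrow> ('k, 'h) tensor"
  assumes faces: "face_operators R H \<alpha> \<beta> d"
    and degeneracies: "degeneracy_operators R H s"
    and cyclics: "cyclic_operators R H p \<alpha> \<beta> t"
begin

lemma d_linear: "i \<le> Suc n \<Longrightarrow> d (Suc n) i \<in> linear_maps R (T (Suc n)) (T n)"
  using faces by (simp add: face_operators_def)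

lemma s_linear: "i \<le> n \<Longrightarrow> s n i \<in> linear_maps R (T n) (T (Suc n))"
  using degeneracies by (simp add: degeneracy_operators_def)

lemma t_linear: "t n \<in> linear_maps R (T n) (T n)"
  using cyclics by (simp add: cyclic_operators_def)

lemma d_closed [simp]: "i \<le> Suc n \<Longrightarrow> X \<in> carrier (T (Suc n)) \<Longrightarrow> d (Suc n) i X \<in> carrier (T n)"
  using linear_closed[OF d_linear] .

lemma s_closed [simp]: "i \<le> n \<Longrightarrow> X \<in> carrier (T n) \<Longrightarrow> s n i X \<in> carrier (T (Suc n))"
  using linear_closed[OF s_linear] .

lemma t_closed [simp]: "X \<in> carrier (T n) \<Longrightarrow> t n X \<in> carrier (T n)"
  using linear_closed[OF t_linear] .

lemma d_first:
  assumes "a \<in> carrier H" "as \<in> tuples H n"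
  shows "d (Suc n) 0 (pure R H (a # as)) = \<alpha> a \<odot>\<^bsub>T n\<^esub> pure R H as"
  using assms faces
  by (cases "n = 0") (auto simp: face_operators_def scalar_tensor_def)

lemma d_last:
  assumes "c \<in> carrier H" "as \<in> tuples H n"
  shows "d (Suc n) (Suc n) (pure R H (as @ [c])) = \<beta> c \<odot>\<^bsub>T n\<^esub> pure R H as"
proof (cases "n = 0")
  case True
  then show ?thesis using assms faces by (auto simp: face_operators_def scalar_tensor_def)
next
  case False
  have "as @ [c] \<in> tuples H (Suc n)" "n = length as"
    using assms by (auto simp: tuples_def)
  moreover have "d (Suc n) (Suc n) (pure R H w) = \<beta> (w ! n) \<odot>\<^bsub>T n\<^esub> pure R H (take n w)"
    if "w \<in> tuples H (Suc n)" for w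
    using faces False that by (simp add: face_operators_def)
  ultimately show ?thesis by simp
qed

lemma d_merge:
  assumes "k < n" "w \<in> tuples H (Suc n)"
  shows "d (Suc n) (Suc k) (pure R H w) = pure R H (merge k w)"
  using assms faces by (auto simp: face_operators_def merge_def)

lemma s_insert_one:
  assumes "k \<le> n" "w \<in> tuples H n"
  shows "s n k (pure R H w) = pure R H (insert_one k w)"
proof (cases "n = 0")
  case True
  interpret T0: module R "T 0" by simp
  have "\<forall>c\<in>carrier R. s 0 0 (scalar_tensor R H c) = pure R H [c \<odot>\<^bsub>H\<^esub> \<one>\<^bsub>H\<^esub>]"
    using degeneracies by (simp add: degeneracy_operators_def)
  from bspec[OF this R.one_closed] show ?thesis
    using True assms pure_closed[of "[]" 0] by (simp add: scalar_tensor_def)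
next
  case False
  then show ?thesis using assms degeneracies
    by (auto simp: degeneracy_operators_def insert_one_def)
qed

section \<open>The simplicial identities\<close>

lemma face_ext:
  assumes "f \<in> linear_maps R (T n) (T m)" "g \<in> linear_maps R (T n) (T m)"
    "\<And>w. w \<in> tuples H n \<Longrightarrow> f (pure R H w) = g (pure R H w)" "X \<in> carrier (T n)"
  shows "f X = g X"
  by (rule tensor_ext[OF tensor_module assms])

lemma tuples_snocE:
  assumes "w \<in> tuples H (Suc n)"
  obtains us c where "w = us @ [c]" "us \<in> tuples H n" "c \<in> carrier H" "length us = n"
  using assms by (cases w rule: rev_exhaust) (auto simp: tuples_def)

lemma tuples_ConsE:
  assumes "w \<in> tuples H (Suc n)"
  obtains a us where "w = a # us" "us \<in> tuples H n" "a \<in> carrier H"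
  using assms by (auto simp: tuples_Suc)

lemma snoc_tuples [simp]: "us \<in> tuples H n \<Longrightarrow> c \<in> carrier H \<Longrightarrow> us @ [c] \<in> tuples H (Suc n)"
  by (auto simp: tuples_def)

lemma d_d_pure:
  assumes ij: "i < j" "j \<le> Suc (Suc n)" and w: "w \<in> tuples H (Suc (Suc n))"
  shows "d (Suc n) i (d (Suc (Suc n)) j (pure R H w)) =
    d (Suc n) (j - 1) (d (Suc (Suc n)) i (pure R H w))"
proof -
  interpret N: module R "T n" by simp
  obtain l where j: "j = Suc l" using ij by (cases j) auto
  note smult = linear_smult[OF d_linear]
  show ?thesis
  proof (cases i)
    case 0
    obtain a us where w': "w = a # us" "us \<in> tuples H (Suc n)" "a \<in> carrier H"
      using w by (rule tuples_ConsE)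
    show ?thesis
    proof (cases l)
      case l: 0
      obtain b vs where "us = b # vs" "vs \<in> tuples H n" "b \<in> carrier H"
        using w'(2) by (rule tuples_ConsE)
      then show ?thesis
        using 0 l j w' by (simp add: d_merge d_first smult pure_closed N.smult_assoc1)
    next
      case l: (Suc k)
      show ?thesis
      proof (cases "k = n")
        case True
        obtain vs c where "us = vs @ [c]" "vs \<in> tuples H n" "c \<in> carrier H"
          using w'(2) by (rule tuples_snocE)
        then show ?thesis
          using 0 l j w' True d_last[of c "a # vs" "Suc n"]
          by (simp add: d_first d_last smult pure_closed N.smult_assoc1[symmetric] R.m_comm)
      next
        case False
        then show ?thesis
          using 0 l j w' ij merge_tuples[OF w'(2), of k]
          by (simp add: d_merge d_first smult pure_closed)
      qed
    qed
  next
    case i: (Suc i')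
    show ?thesis
    proof (cases "l = Suc n")
      case True
      obtain us c where w': "w = us @ [c]" "us \<in> tuples H (Suc n)" "c \<in> carrier H"
        "length us = Suc n"
        using w by (rule tuples_snocE)
      show ?thesis
      proof (cases "i' = n")
        case n: True
        obtain vs b where vs: "us = vs @ [b]" "vs \<in> tuples H n" "b \<in> carrier H" "length vs = n"
          using w'(2) by (rule tuples_snocE)
        have "d (Suc (Suc n)) (Suc n) (pure R H w) = pure R H (vs @ [b \<cdot> c])"
          using d_merge[of n "Suc n" w] w merge_snoc(2)[of vs b c] vs w' by simp
        then show ?thesis
          using n True i j w' vs d_last[of c "vs @ [b]" "Suc n"]
          by (simp add: d_last smult pure_closed N.smult_assoc1[symmetric] R.m_comm)
      next
        case False
        then have "i' < n" using i j ij True by simp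
        then show ?thesis
          using i j True w' w merge_tuples[OF w'(2), of i']
          by (simp add: d_merge d_last smult pure_closed merge_snoc(1))
      qed
    next
      case False
      then obtain l' where l': "l = Suc l'" "l' < n" "i' \<le> l'" using i j ij by (cases l) auto
      then show ?thesis
        using i j w merge_merge[OF w, of l' i'] merge_tuples[OF w, of l] merge_tuples[OF w, of i']
        by (simp add: d_merge)
    qed
  qed
qed

lemma d_d:
  assumes "i < j" "j \<le> Suc (Suc n)" and "X \<in> carrier (T (Suc (Suc n)))"
  shows "d (Suc n) i (d (Suc (Suc n)) j X) = d (Suc n) (j - 1) (d (Suc (Suc n)) i X)"
  by (rule face_ext[OF linear_compose[OF d_linear d_linear] linear_compose[OF d_linear d_linear]
        d_d_pure[OF assms(1,2)] assms(3)]) (use assms in auto)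

lemma s_s:
  assumes "i \<le> j" "j \<le> n" and "X \<in> carrier (T n)"
  shows "s (Suc n) i (s n j X) = s (Suc n) (Suc j) (s n i X)"
proof (rule face_ext[OF linear_compose[OF s_linear s_linear] linear_compose[OF s_linear s_linear]
      _ assms(3)])
  fix w assume w: "w \<in> tuples H n"
  then show "s (Suc n) i (s n j (pure R H w)) = s (Suc n) (Suc j) (s n i (pure R H w))"
    using assms insert_one_tuples[OF w] insert_one_insert_one[of j w i] tuples_length[OF w]
    by (simp add: s_insert_one)
qed (use assms in auto)

lemma d_s_less:
  assumes "i < j" "j \<le> n" and X: "X \<in> carrier (T n)"
  shows "d (Suc n) i (s n j X) = s (n - 1) (j - 1) (d n i X)"
proof -
  obtain m k where m: "n = Suc m" "j = Suc k" using assms by (cases n; cases j) auto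
  have "d (Suc (Suc m)) i (s (Suc m) j X) = s m k (d (Suc m) i X)"
  proof (rule face_ext[OF linear_compose[OF d_linear s_linear] linear_compose[OF s_linear d_linear]])
    fix w assume w: "w \<in> tuples H (Suc m)"
    show "d (Suc (Suc m)) i (s (Suc m) j (pure R H w)) = s m k (d (Suc m) i (pure R H w))"
    proof (cases i)
      case 0
      obtain a us where "w = a # us" "us \<in> tuples H m" "a \<in> carrier H"
        using w by (rule tuples_ConsE)
      then show ?thesis
        using 0 m assms insert_one_tuples[of us m k]
        by (simp add: s_insert_one d_first linear_smult[OF s_linear] pure_closed)
    next
      case (Suc i')
      then show ?thesis
        using m assms w insert_one_tuples[OF w, of j] merge_tuples[OF w, of i']
          merge_insert_one_less[of k w i'] tuples_length[OF w]
        by (simp add: s_insert_one d_merge)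
    qed
  qed (use assms m in auto)
  then show ?thesis using m by simp
qed

lemma d_s_eq:
  assumes "i = j \<or> i = Suc j" "j \<le> n" and X: "X \<in> carrier (T n)"
  shows "d (Suc n) i (s n j X) = X"
proof (rule face_ext[OF linear_compose[OF d_linear s_linear] linear_ident _ X])
  interpret N: module R "T n" by simp
  fix w assume w: "w \<in> tuples H n"
  consider "i = 0" "j = 0" | k where "i = Suc k" "j = Suc k" "k < n" | "i = Suc j" "j < n"
    | "i = Suc n" "j = n"
    using assms(1,2) by (cases j) (auto simp: le_less)
  then show "d (Suc n) i (s n j (pure R H w)) = pure R H w"
  proof cases
    case 1
    then show ?thesis using w by (simp add: s_insert_one d_first pure_closed)
  next
    case 2
    then show ?thesis
      using w insert_one_tuples[OF w, of j] merge_insert_one_same(2)[OF w]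
      by (simp add: s_insert_one d_merge)
  next
    case 3
    then show ?thesis
      using w insert_one_tuples[OF w, of j] merge_insert_one_same(1)[OF w]
      by (simp add: s_insert_one d_merge)
  next
    case 4
    then show ?thesis
      using w tuples_length[OF w] insert_one_snoc(2)[of w]
      by (simp add: s_insert_one d_last pure_closed)
  qed
qed (use assms in auto)

lemma d_s_greater:
  assumes "Suc j < i" "i \<le> Suc n" and X: "X \<in> carrier (T n)"
  shows "d (Suc n) i (s n j X) = s (n - 1) j (d n (i - 1) X)"
proof -
  obtain m k where m: "n = Suc m" "i = Suc (Suc k)" "j \<le> k" "k \<le> m"
    using assms by (cases n; cases i; cases "i - 1") auto
  have "d (Suc (Suc m)) i (s (Suc m) j X) = s m j (d (Suc m) (Suc k) X)"
  proof (rule face_ext[OF linear_compose[OF d_linear s_linear] linear_compose[OF s_linear d_linear]])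
    fix w assume w: "w \<in> tuples H (Suc m)"
    show "d (Suc (Suc m)) i (s (Suc m) j (pure R H w)) = s m j (d (Suc m) (Suc k) (pure R H w))"
    proof (cases "k = m")
      case True
      obtain us c where "w = us @ [c]" "us \<in> tuples H m" "c \<in> carrier H" "length us = m"
        using w by (rule tuples_snocE)
      then show ?thesis
        using True m insert_one_tuples[of us m j]
        by (simp add: s_insert_one d_last insert_one_snoc(1) linear_smult[OF s_linear] pure_closed)
    next
      case False
      then show ?thesis
        using m w insert_one_tuples[OF w, of j] merge_tuples[OF w, of k]
          merge_insert_one_greater[of k w j] tuples_length[OF w]
        by (simp add: s_insert_one d_merge)
    qed
  qed (use X m in auto)
  then show ?thesis using m by simp
qed

lemma simplicial: "simplicial_module R T d s"
  by (rule simplicial_module.intro)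
     (rule tensor_module | rule d_linear s_linear d_d s_s d_s_less d_s_eq d_s_greater; assumption)+

section \<open>The extra degeneracy and the operators\<close>

lemma extra_d_first:
  assumes X: "X \<in> carrier (T n)"
  shows "d (Suc n) 0 (extra n X) = X"
proof (rule face_ext[OF linear_compose[OF d_linear extra_linear] linear_ident _ X])
  fix as assume as: "as \<in> tuples H n"
  have "d (Suc n) 0 (extra n (pure R H as)) =
      coact (T n) as (\<lambda>x ys. d (Suc n) 0 (pure R H (twist x # ys)))"
    unfolding extra_pure[OF as]
    by (rule coact_apply[OF as _ _ d_linear]) (auto intro!: pure_closed)
  also have "\<dots> = coact (T n) as (\<lambda>x ys. eps x \<odot>\<^bsub>T n\<^esub> pure R H ys)"
    by (rule coact_cong[OF as]) (simp add: d_first)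
  also have "\<dots> = pure R H as"
    by (rule coact_counit[OF as tensor_module pure_multilinear])
  finally show "d (Suc n) 0 (extra n (pure R H as)) = pure R H as" .
qed auto

text \<open>For \<open>i = 0\<close> the identity is \<open>f(a\<^sup>(\<^sup>1\<^sup>) z) a\<^sup>(\<^sup>2\<^sup>) = \<alpha>(a) f(z)\<close>; for \<open>i > 0\<close> the face acts only on
  the entries and commutes with the coaction.\<close>

lemma extra_d:
  assumes i: "i \<le> n" and X: "X \<in> carrier (T (Suc n))"
  shows "d (Suc (Suc n)) (Suc i) (extra (Suc n) X) = extra n (d (Suc n) i X)"
proof (rule face_ext[OF linear_compose[OF d_linear extra_linear] linear_compose[OF extra_linear d_linear] _ X])
  let ?N = "T (Suc n)"
  fix as assume as: "as \<in> tuples H (Suc n)"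
  have eq: "d (Suc (Suc n)) (Suc i) (extra (Suc n) (pure R H as)) =
      coact ?N as (\<lambda>x ys. pure R H (merge i (twist x # ys)))"
    unfolding extra_pure[OF as] using i
    by (subst coact_apply[OF as tensor_module tensor_module d_linear])
       (auto intro!: pure_closed coact_cong[OF as] simp: d_merge)
  show "d (Suc (Suc n)) (Suc i) (extra (Suc n) (pure R H as)) = extra n (d (Suc n) i (pure R H as))"
  proof (cases i)
    case 0
    obtain a us where w: "as = a # us" "us \<in> tuples H n" "a \<in> carrier H"
      using as by (rule tuples_ConsE)
    have "coact ?N as (\<lambda>x ys. pure R H (merge i (twist x # ys))) =
        sw ?N a (\<lambda>x y. coact ?N us (\<lambda>z zs. pure R H ((twist (x \<cdot> z) \<cdot> y) # zs)))"
      by (simp add: w 0)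
    also have "\<dots> = coact ?N us (\<lambda>z zs. sw ?N a (\<lambda>x y. pure R H ((twist (x \<cdot> z) \<cdot> y) # zs)))"
      using w(3) by (intro coact_sw_swap[OF w(2), symmetric]) (auto intro!: pure_closed)
    also have "\<dots> = coact ?N us (\<lambda>z zs. \<alpha> a \<odot>\<^bsub>?N\<^esub> pure R H (twist z # zs))"
    proof (rule coact_cong[OF w(2)])
      fix z zs assume z: "z \<in> carrier H" and zs: "zs \<in> tuples H n"
      have lin: "(\<lambda>c. pure R H (c # zs)) \<in> linear_maps R H ?N"
        using zs by (rule pure_linear_0[OF linear_ident])
      have "sw ?N a (\<lambda>x y. pure R H ((twist (x \<cdot> z) \<cdot> y) # zs)) =
          pure R H (sw H a (\<lambda>x y. twist (x \<cdot> z) \<cdot> y) # zs)"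
        using z w(3) by (intro sw_apply[OF hopf_module tensor_module lin, symmetric]) auto
      then show "sw ?N a (\<lambda>x y. pure R H ((twist (x \<cdot> z) \<cdot> y) # zs)) =
          \<alpha> a \<odot>\<^bsub>?N\<^esub> pure R H (twist z # zs)"
        using z w(3) linear_smult[OF lin, of "\<alpha> a" "twist z"] by (simp add: sw_twist_mult)
    qed
    also have "\<dots> = \<alpha> a \<odot>\<^bsub>?N\<^esub> extra n (pure R H us)"
      unfolding extra_pure[OF w(2)] using w(3)
      by (intro coact_scale[OF w(2), symmetric]) (auto intro!: pure_closed)
    also have "\<dots> = extra n (d (Suc n) i (pure R H as))"
      using w 0 by (simp add: d_first linear_smult[OF extra_linear] pure_closed)
    finally show ?thesis using eq by simp
  next
    case (Suc k)
    then show ?thesis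
      using eq i as merge_tuples[OF as, of k]
      by (simp add: d_merge extra_pure coact_merge[OF as _ tensor_module twist_colinear])
  qed
qed (use i in auto)

text \<open>In degree \<open>0\<close> the coaction is trivial and \<open>J(1) = f(1) = \<pi>\<close>, so \<open>d\<^sub>1 J = \<beta>(\<pi>) = 1\<close>.  This
  makes \<open>t\<^sub>n = d\<^sub>n\<^sub>+\<^sub>1 J\<close> hold for \<open>n = 0\<close> as well.\<close>

lemma extra_d_last_0:
  assumes X: "X \<in> carrier (T 0)"
  shows "d (Suc 0) (Suc 0) (extra 0 X) = X"
proof (rule face_ext[OF linear_compose[OF d_linear extra_linear] linear_ident _ X])
  interpret N: module R "T 0" by simp
  fix w assume w: "w \<in> tuples H 0"
  then show "d (Suc 0) (Suc 0) (extra 0 (pure R H w)) = pure R H w"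
    using d_last[of p "[]" 0] pure_closed[of "[]" 0] by (simp add: extra_pure)
qed auto

lemma extra_s:
  assumes i: "i \<le> n" and X: "X \<in> carrier (T n)"
  shows "s (Suc n) (Suc i) (extra n X) = extra (Suc n) (s n i X)"
proof (rule face_ext[OF linear_compose[OF s_linear extra_linear] linear_compose[OF extra_linear s_linear] _ X])
  fix as assume as: "as \<in> tuples H n"
  have "s (Suc n) (Suc i) (extra n (pure R H as)) =
      coact (T (Suc (Suc n))) as (\<lambda>x ys. pure R H (twist x # insert_one i ys))"
    unfolding extra_pure[OF as] using i
    by (subst coact_apply[OF as tensor_module tensor_module s_linear])
       (auto intro!: pure_closed coact_cong[OF as] simp: s_insert_one)
  then show "s (Suc n) (Suc i) (extra n (pure R H as)) = extra (Suc n) (s n i (pure R H as))"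
    using i as insert_one_tuples[OF as i]
    by (simp add: s_insert_one extra_pure coact_insert_one[OF as i tensor_module twist_colinear])
qed (use i in auto)

lemma extra_extra:
  assumes X: "X \<in> carrier (T n)"
  shows "extra (Suc n) (extra n X) = s (Suc n) 0 (extra n X)"
proof (rule face_ext[OF linear_compose[OF extra_linear extra_linear] linear_compose[OF s_linear extra_linear] _ X])
  fix as assume as: "as \<in> tuples H n"
  have "s (Suc n) 0 (extra n (pure R H as)) =
      coact (T (Suc (Suc n))) as (\<lambda>x ys. pure R H (\<one>\<^bsub>H\<^esub> # twist x # ys))"
    unfolding extra_pure[OF as]
    by (subst coact_apply[OF as tensor_module tensor_module s_linear])
       (auto intro!: pure_closed coact_cong[OF as] simp: s_insert_one)
  then show "extra (Suc n) (extra n (pure R H as)) = s (Suc n) 0 (extra n (pure R H as))"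
    by (simp add: extra_extra_pure[OF as])
qed auto

lemma t_extra:
  assumes X: "X \<in> carrier (T n)"
  shows "t n X = d (Suc n) (Suc n) (extra n X)"
proof (cases n)
  case 0
  then show ?thesis using X cyclics extra_d_last_0 by (simp add: cyclic_operators_def)
next
  case (Suc m)
  show ?thesis
  proof (rule face_ext[OF t_linear linear_compose[OF d_linear extra_linear] _ X])
    fix as assume as: "as \<in> tuples H n"
    have "t n (pure R H as) =
        coact (T n) as (\<lambda>x ys. \<beta> (ys ! (n - 1)) \<odot>\<^bsub>T n\<^esub> pure R H (twist x # take (n - 1) ys))"
      using cyclics as Suc cyclic_formula[OF as] unfolding cyclic_operators_def by simp
    also have "\<dots> = coact (T n) as (\<lambda>x ys. d (Suc n) (Suc n) (pure R H (twist x # ys)))"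
    proof (rule coact_cong[OF as])
      fix x ys assume x: "x \<in> carrier H" and "ys \<in> tuples H n"
      then obtain zs c where "ys = zs @ [c]" "zs \<in> tuples H m" "c \<in> carrier H" "length zs = m"
        unfolding Suc by (elim tuples_snocE)
      then show "\<beta> (ys ! (n - 1)) \<odot>\<^bsub>T n\<^esub> pure R H (twist x # take (n - 1) ys) =
          d (Suc n) (Suc n) (pure R H (twist x # ys))"
        using Suc x d_last[of c "twist x # zs" n] by (simp add: nth_append)
    qed
    also have "\<dots> = d (Suc n) (Suc n) (extra n (pure R H as))"
      unfolding extra_pure[OF as]
      by (rule coact_apply[OF as _ _ d_linear, symmetric]) (auto intro!: pure_closed)
    finally show "t n (pure R H as) = d (Suc n) (Suc n) (extra n (pure R H as))" .
  qed auto
qed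

text \<open>Both sides are evaluated on \<open>b\<^sub>1 \<otimes> \<dots> \<otimes> b\<^sub>m \<otimes> c\<close>: the entry \<open>c\<close> contributes
  \<open>f(\<pi> S(c\<^sup>(\<^sup>2\<^sup>))) \<beta>(c\<^sup>(\<^sup>3\<^sup>)) = \<theta>(c\<^sup>(\<^sup>2\<^sup>))\<close> in the front, while \<open>c\<^sup>(\<^sup>1\<^sup>)\<close> remains in the argument of \<open>f\<close>.\<close>

lemma extra_t:
  assumes X: "X \<in> carrier (T (Suc m))"
  shows "extra (Suc m) (t (Suc m) X) = rotate_theta (Suc m) (extra (Suc m) X)"
proof (rule face_ext[OF linear_compose[OF extra_linear t_linear]
      linear_compose[OF rotate_theta_linear extra_linear] _ X])
  let ?N = "T (Suc (Suc m))"
  interpret N: module R ?N by simp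
  fix as assume "as \<in> tuples H (Suc m)"
  then obtain bs c where as: "as = bs @ [c]" and bs: "bs \<in> tuples H m" and c: "c \<in> carrier H"
    by (rule tuples_snocE)
  note [intro!] = twist_intros pure_closed coact_closed[OF bs] linear_coact_body[OF bs]
  note [simp] = c
  let ?G = "\<lambda>a u. coact ?N bs (\<lambda>x zs. pure R H (a # twist (x \<cdot> u) # zs))"
  have Jas: "extra (Suc m) (pure R H as) =
      coact ?N bs (\<lambda>x ys. sw ?N c (\<lambda>u v. pure R H (twist (x \<cdot> u) # ys @ [v])))"
    unfolding as extra_pure[OF snoc_tuples[OF bs c]]
    by (rule coact_snoc[OF bs tensor_module c]) auto
  have Jc: "extra (Suc m) (pure R H (twist (x \<cdot> u) # zs)) \<in> carrier ?N"
    if "x \<in> carrier H" "u \<in> carrier H" "zs \<in> tuples H m" for x u zs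
    using that by (intro extra_closed pure_closed) simp
  have sc: "(\<lambda>x. extra (Suc m) (d (Suc (Suc m)) (Suc (Suc m)) x)) \<in> linear_maps R ?N ?N"
    by (rule linear_compose[OF extra_linear d_linear]) simp
  have "extra (Suc m) (t (Suc m) (pure R H as)) =
      extra (Suc m) (d (Suc (Suc m)) (Suc (Suc m)) (extra (Suc m) (pure R H as)))"
    using bs by (simp add: t_extra as pure_closed)
  also have "\<dots> = coact ?N bs (\<lambda>x ys. sw ?N c (\<lambda>u v.
      \<beta> v \<odot>\<^bsub>?N\<^esub> extra (Suc m) (pure R H (twist (x \<cdot> u) # ys))))"
    unfolding Jas
  proof (subst coact_apply[OF bs tensor_module tensor_module sc])
    show "coact ?N bs (\<lambda>x zs. extra (Suc m) (d (Suc (Suc m)) (Suc (Suc m))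
          (sw ?N c (\<lambda>u v. pure R H (twist (x \<cdot> u) # zs @ [v]))))) =
        coact ?N bs (\<lambda>x ys. sw ?N c (\<lambda>u v. \<beta> v \<odot>\<^bsub>?N\<^esub> extra (Suc m) (pure R H (twist (x \<cdot> u) # ys))))"
    proof (rule coact_cong[OF bs])
      fix x zs assume x: "x \<in> carrier H" and zs: "zs \<in> tuples H m"
      have d: "extra (Suc m) (d (Suc (Suc m)) (Suc (Suc m)) (pure R H (twist (x \<cdot> u) # zs @ [v]))) =
          \<beta> v \<odot>\<^bsub>?N\<^esub> extra (Suc m) (pure R H (twist (x \<cdot> u) # zs))"
        if "u \<in> carrier H" "v \<in> carrier H" for u v
        using x zs that d_last[of v "twist (x \<cdot> u) # zs" "Suc m"]
        by (simp add: linear_smult[OF extra_linear] pure_closed)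
      have "extra (Suc m) (d (Suc (Suc m)) (Suc (Suc m))
            (sw ?N c (\<lambda>u v. pure R H (twist (x \<cdot> u) # zs @ [v])))) =
          sw ?N c (\<lambda>u v. extra (Suc m) (d (Suc (Suc m)) (Suc (Suc m))
            (pure R H (twist (x \<cdot> u) # zs @ [v]))))"
        using x zs by (intro sw_apply[OF tensor_module tensor_module sc c]) auto
      also have "\<dots> = sw ?N c (\<lambda>u v. \<beta> v \<odot>\<^bsub>?N\<^esub> extra (Suc m) (pure R H (twist (x \<cdot> u) # zs)))"
        by (rule sw_cong[OF HOL.refl c]) (rule d)
      finally show "extra (Suc m) (d (Suc (Suc m)) (Suc (Suc m))
            (sw ?N c (\<lambda>u v. pure R H (twist (x \<cdot> u) # zs @ [v])))) =
          sw ?N c (\<lambda>u v. \<beta> v \<odot>\<^bsub>?N\<^esub> extra (Suc m) (pure R H (twist (x \<cdot> u) # zs)))"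
        .
    qed
  qed auto
  also have "\<dots> = sw ?N c (\<lambda>u v. \<beta> v \<odot>\<^bsub>?N\<^esub>
      coact ?N bs (\<lambda>x ys. extra (Suc m) (pure R H (twist (x \<cdot> u) # ys))))"
    by (subst coact_sw_swap[OF bs tensor_module c])
       (simp_all add: coact_scale[OF bs] Jc cong: sw_cong)
  also have "\<dots> = sw ?N c (\<lambda>r w. sw ?N r (\<lambda>u v. \<beta> w \<odot>\<^bsub>?N\<^esub> ?G (twist (p \<cdot> S v)) u))"
    by (rule sw_cong[OF HOL.refl c], simp only: extra_coact[OF bs], rule sw_scale) auto
  also have "\<dots> = sw ?N c (\<lambda>u r. sw ?N r (\<lambda>v w. \<beta> w \<odot>\<^bsub>?N\<^esub> ?G (twist (p \<cdot> S v)) u))"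
    by (rule sw_coassoc) auto
  also have "\<dots> = sw ?N c (\<lambda>u r. ?G (theta r) u)"
  proof (rule sw_cong[OF HOL.refl c])
    fix u r assume u: "u \<in> carrier H" and r: "r \<in> carrier H"
    have lin: "(\<lambda>a. ?G a u) \<in> linear_maps R H ?N" using u by auto
    have "?G (theta r) u = sw ?N r (\<lambda>v w. ?G (\<beta> w \<odot>\<^bsub>H\<^esub> twist (p \<cdot> S v)) u)"
      unfolding theta_def by (rule sw_apply[OF hopf_module tensor_module lin r]) auto
    also have "\<dots> = sw ?N r (\<lambda>v w. \<beta> w \<odot>\<^bsub>?N\<^esub> ?G (twist (p \<cdot> S v)) u)"
      using r by (intro sw_cong) (simp_all add: linear_smult[OF lin])
    finally show "sw ?N r (\<lambda>v w. \<beta> w \<odot>\<^bsub>?N\<^esub> ?G (twist (p \<cdot> S v)) u) = ?G (theta r) u" ..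
  qed
  also have "\<dots> = coact ?N bs (\<lambda>x ys. sw ?N c (\<lambda>u v. pure R H (theta v # twist (x \<cdot> u) # ys)))"
    by (rule coact_sw_swap[OF bs tensor_module c, symmetric]) auto
  also have "\<dots> = rotate_theta (Suc m) (extra (Suc m) (pure R H as))"
    unfolding Jas
  proof (subst coact_apply[OF bs tensor_module tensor_module rotate_theta_linear])
    show "coact ?N bs (\<lambda>x ys. sw ?N c (\<lambda>u v. pure R H (theta v # twist (x \<cdot> u) # ys))) =
        coact ?N bs (\<lambda>x zs. rotate_theta (Suc m) (sw ?N c (\<lambda>u v. pure R H (twist (x \<cdot> u) # zs @ [v]))))"
    proof (rule coact_cong[OF bs])
      fix x zs assume x: "x \<in> carrier H" and zs: "zs \<in> tuples H m"
      have rot: "rotate_theta (Suc m) (pure R H (twist (x \<cdot> u) # zs @ [v])) =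
          pure R H (theta v # twist (x \<cdot> u) # zs)"
        if "u \<in> carrier H" "v \<in> carrier H" for u v
        using x zs that rotate_theta_pure[of "twist (x \<cdot> u) # zs" "Suc m" v] by simp
      have "rotate_theta (Suc m) (sw ?N c (\<lambda>u v. pure R H (twist (x \<cdot> u) # zs @ [v]))) =
          sw ?N c (\<lambda>u v. rotate_theta (Suc m) (pure R H (twist (x \<cdot> u) # zs @ [v])))"
        using x zs by (intro sw_apply[OF tensor_module tensor_module rotate_theta_linear c]) auto
      also have "\<dots> = sw ?N c (\<lambda>u v. pure R H (theta v # twist (x \<cdot> u) # zs))"
        by (rule sw_cong[OF HOL.refl c]) (rule rot)
      finally show "sw ?N c (\<lambda>u v. pure R H (theta v # twist (x \<cdot> u) # zs)) =
          rotate_theta (Suc m) (sw ?N c (\<lambda>u v. pure R H (twist (x \<cdot> u) # zs @ [v])))"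
        ..
    qed
  qed auto
  finally show "extra (Suc m) (t (Suc m) (pure R H as)) = rotate_theta (Suc m) (extra (Suc m) (pure R H as))" .
qed

lemma t_power:
  assumes X: "X \<in> carrier (T n)"
  shows "(t n ^^ Suc n) X = X"
proof (cases n)
  case 0
  then show ?thesis using X cyclics by (simp add: cyclic_operators_def)
next
  case (Suc m)
  have extra_power: "(t n ^^ k) X \<in> carrier (T n) \<and> extra n ((t n ^^ k) X) = (rotate_theta n ^^ k) (extra n X)" for k
  proof (induction k)
    case 0
    show ?case using X by simp
  next
    case (Suc k)
    then show ?case using extra_t[of "(t n ^^ k) X" m] \<open>n = Suc m\<close> by simp
  qed
  have "extra n ((t n ^^ Suc n) X) = extra n X"
    using extra_power[of "Suc n"] rotate_theta_power_extra[OF X] by (simp del: funpow.simps)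
  then have "d (Suc n) 0 (extra n ((t n ^^ Suc n) X)) = d (Suc n) 0 (extra n X)"
    by (rule arg_cong)
  moreover have "d (Suc n) 0 (extra n ((t n ^^ Suc n) X)) = (t n ^^ Suc n) X"
    using extra_power[of "Suc n"] by (intro extra_d_first) blast
  ultimately show ?thesis
    using extra_d_first[OF X] by (simp only:)
qed

lemma d_t:
  assumes "1 \<le> i" "i \<le> n" and X: "X \<in> carrier (T n)"
  shows "d n i (t n X) = t (n - 1) (d n (i - 1) X)"
proof -
  obtain m k where m: "n = Suc m" "i = Suc k" using assms by (cases n; cases i) auto
  have "d n i (t n X) = d (Suc m) (Suc m) (d (Suc (Suc m)) (Suc k) (extra (Suc m) X))"
    using assms m d_d[of "Suc k" "Suc (Suc m)" m "extra (Suc m) X"] by (simp add: t_extra)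
  also have "\<dots> = t m (d (Suc m) k X)"
    using assms m by (simp add: extra_d t_extra)
  finally show ?thesis by (simp add: m)
qed

lemma d_0_t:
  assumes "1 \<le> n" and X: "X \<in> carrier (T n)"
  shows "d n 0 (t n X) = d n n X"
proof -
  obtain m where m: "n = Suc m" using assms by (cases n) auto
  show ?thesis
    using assms m d_d[of 0 "Suc (Suc m)" m "extra (Suc m) X"] by (simp add: t_extra extra_d_first)
qed

lemma s_t:
  assumes "1 \<le> i" "i \<le> n" and X: "X \<in> carrier (T n)"
  shows "s n i (t n X) = t (Suc n) (s n (i - 1) X)"
proof -
  obtain k where i: "i = Suc k" using assms by (cases i) auto
  have "s n i (t n X) = d (Suc (Suc n)) (Suc (Suc n)) (s (Suc n) i (extra n X))"
    using assms d_s_greater[of i "Suc (Suc n)" "Suc n" "extra n X"] by (simp add: t_extra)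
  also have "\<dots> = t (Suc n) (s n (i - 1) X)"
    using assms i by (simp add: extra_s t_extra)
  finally show ?thesis .
qed

text \<open>\<open>t\<^sub>n\<^sub>+\<^sub>1 s\<^sub>n = d\<^sub>n\<^sub>+\<^sub>2 J s\<^sub>n = d\<^sub>n\<^sub>+\<^sub>2 s\<^sub>n\<^sub>+\<^sub>1 J = J\<close>, so \<open>t\<^sub>n\<^sub>+\<^sub>1\<^sup>2 s\<^sub>n = d\<^sub>n\<^sub>+\<^sub>2 J J = d\<^sub>n\<^sub>+\<^sub>2 s\<^sub>0 J\<close>.\<close>

lemma s_0_t:
  assumes X: "X \<in> carrier (T n)"
  shows "s n 0 (t n X) = t (Suc n) (t (Suc n) (s n n X))"
proof -
  have "t (Suc n) (s n n X) = d (Suc (Suc n)) (Suc (Suc n)) (s (Suc n) (Suc n) (extra n X))"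
    using X by (simp add: extra_s t_extra)
  also have "\<dots> = extra n X"
    using X by (intro d_s_eq) auto
  finally have "t (Suc n) (t (Suc n) (s n n X)) =
      d (Suc (Suc n)) (Suc (Suc n)) (s (Suc n) 0 (extra n X))"
    using X by (simp add: t_extra extra_extra)
  also have "\<dots> = s n 0 (t n X)"
    using X d_s_greater[of 0 "Suc (Suc n)" "Suc n" "extra n X"] by (simp add: t_extra)
  finally show ?thesis ..
qed

lemma cyclic: "cyclic_module R T d s t"
  by (intro cyclic_module.intro cyclic_module_axioms.intro simplicial)
     (rule t_linear | rule t_power d_t d_0_t s_t s_0_t; assumption)+

end

context modular_datum
begin

text \<open>The faces and degeneracies are induced by multilinear maps of tuples, and \<open>d\<^sub>n\<^sub>+\<^sub>1 J\<close> serves as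
  \<open>t\<^sub>n\<close>.\<close>

lemma operators_exist:
  "\<exists>d s t. face_operators R H \<alpha> \<beta> d \<and> degeneracy_operators R H s \<and> cyclic_operators R H p \<alpha> \<beta> t"
proof -
  define fm where "fm n i as = (if i = 0 then \<alpha> (as ! 0) \<odot>\<^bsub>T n\<^esub> pure R H (tl as)
     else if i \<le> n then pure R H (merge (i - 1) as) else \<beta> (as ! n) \<odot>\<^bsub>T n\<^esub> pure R H (take n as))"
    for n i as
  define d where "d m i = tensor_lift (T (m - 1)) (fm (m - 1) i)" for m i
  define s where "s n i = tensor_lift (T (Suc n)) (\<lambda>as. pure R H (insert_one i as))" for n i
  define t where "t n X = d (Suc n) (Suc n) (extra n X)" for n X
  have col: "colinear (T n) n (\<lambda>x ys. \<chi> x \<odot>\<^bsub>T n\<^esub> pure R H ys)" if "\<chi> \<in> characters R H" for \<chi> n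
    by (intro scaled_colinear tensor_module pure_multilinear character_linear[OF that] linear_ident)
  have fm: "multilinear R H (T n) (Suc n) (fm n i)" if i: "i \<le> Suc n" for n i
  proof -
    consider "i = 0" | k where "i = Suc k" "k < n" | "i = Suc n" using i by (cases i) force+
    then show ?thesis
    proof cases
      case 1
      then show ?thesis
        using col[OF alpha, of n] colinear_head[OF col[OF alpha] linear_ident]
          colinear_tail[OF col[OF alpha]]
        by (auto simp: multilinear_Suc fm_def[abs_def])
    next
      case 2
      then show ?thesis
        using multilinear_merge[OF pure_multilinear, of k n] by (simp add: fm_def[abs_def])
    next
      case 3
      then show ?thesis
        using multilinear_last[OF col[OF beta], of n] by (simp add: fm_def[abs_def])
    qed
  qed
  have d_pure: "d (Suc n) i (pure R H as) = fm n i as" if "i \<le> Suc n" "as \<in> tuples H (Suc n)" for n i as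
    using tensor_lift_pure[OF tensor_module fm that(2)] that(1) by (simp add: d_def)
  have d_linear: "d (Suc n) i \<in> linear_maps R (T (Suc n)) (T n)" if "i \<le> Suc n" for n i
    using tensor_lift_linear[OF tensor_module fm[OF that]] by (simp add: d_def)
  have faces: "face_operators R H \<alpha> \<beta> d"
    unfolding face_operators_def
  proof (intro conjI allI impI ballI)
    fix n i assume "i \<le> Suc n"
    then show "d (Suc n) i \<in> linear_maps R (T (Suc n)) (T n)" by (rule d_linear)
  next
    fix a assume "a \<in> carrier H"
    then show "d 1 0 (pure R H [a]) = scalar_tensor R H (\<alpha> a)"
      "d 1 1 (pure R H [a]) = scalar_tensor R H (\<beta> a)"
      using d_pure[of 0 0 "[a]"] d_pure[of 1 0 "[a]"] by (simp_all add: fm_def scalar_tensor_def)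
  next
    fix n as assume n: "1 \<le> n" and as: "as \<in> tuples H (Suc n)"
    show "d (Suc n) 0 (pure R H as) = \<alpha> (as ! 0) \<odot>\<^bsub>T n\<^esub> pure R H (tl as)"
      using d_pure[of 0 n as] as by (simp add: fm_def)
    show "d (Suc n) (Suc n) (pure R H as) = \<beta> (as ! n) \<odot>\<^bsub>T n\<^esub> pure R H (take n as)"
      using d_pure[of "Suc n" n as] as by (simp add: fm_def)
    show "d (Suc n) i (pure R H as) =
        pure R H (take (i - 1) as @ [as ! (i - 1) \<cdot> as ! i] @ drop (Suc i) as)"
      if "i \<in> {1..n}" for i
      using d_pure[of i n as] as that by (simp add: fm_def merge_def)
  qed
  have s_pure: "s n i (pure R H as) = pure R H (insert_one i as)" if "i \<le> n" "as \<in> tuples H n" for n i as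
    unfolding s_def
    by (rule tensor_lift_pure[OF tensor_module multilinear_insert_one[OF pure_multilinear that(1)] that(2)])
  have s_linear: "s n i \<in> linear_maps R (T n) (T (Suc n))" if "i \<le> n" for n i
    unfolding s_def
    by (rule tensor_lift_linear[OF tensor_module multilinear_insert_one[OF pure_multilinear that]])
  have "s 0 0 (scalar_tensor R H c) = pure R H [c \<odot>\<^bsub>H\<^esub> \<one>\<^bsub>H\<^esub>]" if c: "c \<in> carrier R" for c
  proof -
    have "s 0 0 (scalar_tensor R H c) = c \<odot>\<^bsub>T (Suc 0)\<^esub> pure R H [\<one>\<^bsub>H\<^esub>]"
      using c linear_smult[OF s_linear, of 0 0 c "pure R H []"] s_pure[of 0 0 "[]"]
      by (simp add: scalar_tensor_def pure_closed)
    then show ?thesis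
      using linear_smult[OF pure_linear_0[OF linear_ident, of "[]" 0], of c "\<one>\<^bsub>H\<^esub>"] c by simp
  qed
  then have degeneracies: "degeneracy_operators R H s"
    using s_linear s_pure by (simp add: degeneracy_operators_def insert_one_def)
  have t_linear: "t n \<in> linear_maps R (T n) (T n)" for n
    unfolding t_def[abs_def] by (rule linear_compose[OF d_linear extra_linear]) simp
  have t_pure: "t n (pure R H as) = coact (T n) as (\<lambda>x ys. fm n (Suc n) (twist x # ys))"
    if as: "as \<in> tuples H n" for n as
    unfolding t_def extra_pure[OF as]
    by (subst coact_apply[OF as tensor_module tensor_module d_linear])
       (auto intro!: pure_closed coact_cong[OF as] simp: d_pure)
  have cyclics: "cyclic_operators R H p \<alpha> \<beta> t"
    unfolding cyclic_operators_def
  proof (intro conjI allI impI ballI)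
    show "t n \<in> linear_maps R (T n) (T n)" for n by (rule t_linear)
    interpret T0: module R "T 0" by simp
    show "t 0 X = X" if "X \<in> carrier (T 0)" for X
      by (rule tensor_ext[OF tensor_module t_linear linear_ident _ that])
         (use t_pure[of "[]" 0] pure_closed[of "[]" 0] in \<open>simp add: fm_def\<close>)
    fix n as assume n: "1 \<le> n" and as: "as \<in> tuples H n"
    have "t n (pure R H as) =
        coact (T n) as (\<lambda>x ys. \<beta> (ys ! (n - 1)) \<odot>\<^bsub>T n\<^esub> pure R H (twist x # take (n - 1) ys))"
      unfolding t_pure[OF as] using n by (cases n) (simp_all add: fm_def)
    then show "t n (pure R H as) = tensor_lift (T n)
            (\<lambda>w. (\<alpha> (list_prod H (map (\<lambda>i. w ! (3 * i)) [0..<n])) \<otimes> \<beta> (w ! (3 * (n - 1) + 2)))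
                 \<odot>\<^bsub>T n\<^esub>
                 pure R H (twisted_antipode H p (list_prod H (map (\<lambda>i. w ! (3 * i + 1)) [0..<n])) #
                           map (\<lambda>i. w ! (3 * i + 2)) [0..<n - 1]))
            (comult3_list R H as)"
      unfolding cyclic_formula[OF as n] .
  qed
  show ?thesis using faces degeneracies cyclics by blast
qed

end

theorem mainTheorem1:
  fixes R :: "('k, 'r) ring_scheme"
    and H :: "('k, 'h, 'z) hopf_scheme"
    and \<alpha> \<beta> :: "'h \<Rightarrow> 'k"
    and p :: 'h
  assumes "cring R"
    and "hopf_algebra R H"
    and "\<alpha> \<in> characters R H" and "\<beta> \<in> characters R H"
    and "grouplike R H p"
    and "condition_CM R H p \<alpha> \<beta>"
  shows "(\<exists>d s t. face_operators R H \<alpha> \<beta> d \<and> degeneracy_operators R H s \<and>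
            cyclic_operators R H p \<alpha> \<beta> t) \<and>
         (\<forall>d s t. face_operators R H \<alpha> \<beta> d \<and> degeneracy_operators R H s \<and>
            cyclic_operators R H p \<alpha> \<beta> t \<longrightarrow>
            cyclic_module R (tensor_power R H) d s t)"
proof -
  have datum: "modular_datum R H \<alpha> \<beta> p"
    using assms by (intro modular_datum.intro modular_datum_axioms.intro)
  then show ?thesis
    using modular_datum.operators_exist[OF datum]
    by (blast intro: cyclic_datum.cyclic cyclic_datum.intro cyclic_datum_axioms.intro)
qed

end
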